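(* Let $\beta>0$ be a fixed constant and let $\gamma\in(0,1]$. For each $n\ge 2$ let $a_1=a_1(n)$ and $a_2=a_2(n)$ satisfy $a_1,a_2>\frac{\beta}{2}(n-1)$, and let $\lambda_1,\dots,\lambda_n$ be random variables with the $\beta$-Jacobi joint density $f_{\beta,a_1,a_2}(\lambda)$ on $[0,1]^n$. Set $\lambda_{max}(n)=\max\{\lambda_1,\dots,\lambda_n\}$ and $\lambda_{min}(n)=\min\{\lambda_1,\dots,\lambda_n\}$. Assume that $n\to\infty$, $a_1\to\infty$ and $a_2\to\infty$ in such a way that $a_1=o(\sqrt{a_2})$, $n=o(\sqrt{a_2})$ and $\frac{n\beta}{2a_1}\to\gamma$. Then $$\frac{a_2}{n}\,\lambda_{max}(n)\to\beta\cdot\frac{(1+\sqrt\gamma)^2}{2\gamma}\quad\text{and}\quad \frac{a_2}{n}\,\lambda_{min}(n)\to\beta\cdot\frac{(1-\sqrt\gamma)^2}{2\gamma}$$ in probability.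
   Context: The $\beta$-Jacobi ensemble with parameters $a_1,a_2>\frac{\beta}{2}(n-1)$ has density on $[0,1]^n$ $$f_{\beta,a_1,a_2}(\lambda)=c_J^{\beta,a_1,a_2}\prod_{1\le i<j\le n}|\lambda_i-\lambda_j|^\beta\prod_{i=1}^n\lambda_i^{a_1-p}(1-\lambda_i)^{a_2-p},\qquad p=1+\tfrac{\beta}{2}(n-1),$$ with normalizing constant $$c_J^{\beta,a_1,a_2}=\prod_{j=1}^n\frac{\Gamma(1+\frac\beta2)\Gamma(a_1+a_2-\frac\beta2(n-j))}{\Gamma(1+\frac\beta2 j)\Gamma(a_1-\frac\beta2(n-j))\Gamma(a_2-\frac\beta2(n-j))}.$$ *)

theory Defs
  imports "HOL-Probability.Probability" "HOL-Library.Landau_Symbols"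
begin

definition jacobi_const :: "nat \<Rightarrow> real \<Rightarrow> real \<Rightarrow> real \<Rightarrow> real" where
  "jacobi_const n \<beta> a1 a2 =
     (\<Prod>j=1..n. (Gamma (1 + \<beta>/2) * Gamma (a1 + a2 - \<beta>/2 * (real n - real j))) /
        (Gamma (1 + \<beta>/2 * real j) * Gamma (a1 - \<beta>/2 * (real n - real j)) *
         Gamma (a2 - \<beta>/2 * (real n - real j))))"

text \<open>
  A point of \<open>\<real>\<^sup>n\<close> is an extensional function on \<open>{1..n}\<close>, so that \<open>n\<close> can vary.
  With \<open>0 powr a = 0\<close>, the density takes the value \<open>0\<close> on the null set where some
  coordinate is \<open>0\<close> or \<open>1\<close>, also when the exponent there is zero or negative.
\<close>

definition jacobi_density :: "nat \<Rightarrow> real \<Rightarrow> real \<Rightarrow> real \<Rightarrow> (nat \<Rightarrow> real) \<Rightarrow> real" where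
  "jacobi_density n \<beta> a1 a2 x =
     (let p = 1 + \<beta>/2 * (real n - 1) in
        jacobi_const n \<beta> a1 a2
        * (\<Prod>i=1..n. \<Prod>j\<in>{i<..n}. \<bar>x i - x j\<bar> powr \<beta>)
        * (\<Prod>i=1..n. x i powr (a1 - p) * (1 - x i) powr (a2 - p))
        * (\<Prod>i=1..n. indicator {0..1} (x i)))"

definition jacobi_ensemble ::
  "nat \<Rightarrow> real \<Rightarrow> real \<Rightarrow> real \<Rightarrow> 'a measure \<Rightarrow> (nat \<Rightarrow> 'a \<Rightarrow> real) \<Rightarrow> bool" where
  "jacobi_ensemble n \<beta> a1 a2 M X \<longleftrightarrow>
     prob_space M \<and>
     distributed M (\<Pi>\<^sub>M i\<in>{1..n}. lborel) (\<lambda>\<omega>. \<lambda>i\<in>{1..n}. X i \<omega>)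
       (\<lambda>x. ennreal (jacobi_density n \<beta> a1 a2 x))"

text \<open>
  Convergence in probability to a constant; the variables may live on different spaces.
  Measurability is demanded because \<open>measure\<close> is \<open>0\<close> on non-measurable sets.
  Finitely many indices are irrelevant.
\<close>

definition tendsto_in_prob ::
  "(nat \<Rightarrow> 'a measure) \<Rightarrow> (nat \<Rightarrow> 'a \<Rightarrow> real) \<Rightarrow> real \<Rightarrow> bool" where
  "tendsto_in_prob M Y c \<longleftrightarrow>
     (\<forall>\<^sub>F n in sequentially. prob_space (M n) \<and> Y n \<in> borel_measurable (M n)) \<and>
     (\<forall>\<epsilon>>0. (\<lambda>n. measure (M n) {\<omega> \<in> space (M n). \<bar>Y n \<omega> - c\<bar> > \<epsilon>}) \<longlonglongrightarrow> 0)"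

end

theory Submission
  imports Defs "HOL-Real_Asymp.Real_Asymp"
begin

text \<open>
  The only property of the density that the proof uses is how it changes when one increasing map
  \<open>T\<close> is applied to all coordinates. Let \<open>J\<close> be the density at the image times the product of the
  derivatives, divided by the density at the original point. By change of variables \<open>J\<close> has mean
  at most one, so an event on which \<open>ln J \<ge> K\<close> has probability at most \<open>exp (-K)\<close>
  (\<open>flow_bound\<close>). In \<open>J\<close> the normalizing constant cancels, and the interaction enters only through
  the ratios of \<open>T x\<^sub>i - T x\<^sub>j\<close> and \<open>x\<^sub>i - x\<^sub>j\<close>, which are bounded for Lipschitz \<open>T\<close>. Every
  probabilistic estimate below is one choice of \<open>T\<close>.

  Write \<open>\<alpha> = \<beta>/2\<close>, let \<open>b - 1\<close> and \<open>c\<close> be the exponents of \<open>\<lambda>\<^sub>i\<close> and \<open>1 - \<lambda>\<^sub>i\<close>, and rescale to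
  \<open>x = c \<lambda> / n\<close>. Since \<open>n\<^sup>2/c\<close> tends to zero, the factor \<open>(1 - \<lambda>)\<^sup>c\<close> acts like \<open>exp (- n x)\<close>, so the
  particles behave like a Laguerre ensemble with \<open>b/n \<rightarrow> \<kappa> = \<alpha>/\<gamma> - \<alpha>\<close>. Halving all coordinates
  shows that the mean of the particles stays bounded (\<open>sum_tail\<close>).

  Next take \<open>T x = x + t x/(z - x)\<close>, where all particles lie on one side of \<open>z\<close>. To first order
  \<open>ln J\<close> is \<open>t n\<^sup>2\<close> times \<open>\<alpha> z g\<^sup>2 + (\<kappa> - z) g + 1\<close>, where \<open>g\<close> is the empirical Stieltjes transform at
  \<open>z\<close>. With both signs of \<open>t\<close> this forces the quadratic to be small (\<open>loop_bound\<close>). Its discriminant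
  is \<open>(z - e\<^sub>+)(z - e\<^sub>-)\<close> with edges equal to the squares of \<open>sqrt (\<kappa> + \<alpha>) \<plusminus> sqrt \<alpha>\<close>, which are
  the two claimed limits. Between the edges the quadratic has no real zero, so the particles cannot
  all lie on one side of such a \<open>z\<close> (\<open>bulk_bound\<close>): the largest particle reaches the upper edge and the
  smallest one reaches the lower edge.

  It remains to exclude outliers. Suppose that the extreme particle lies beyond its edge, at
  distance of order \<open>h\<close> from \<open>z\<close>, where \<open>h\<close> is a small negative power of \<open>n\<close>. Comparing the quadratic at
  \<open>z\<close> and at distance \<open>h\<^sup>2\<close> from it shows that \<open>g\<close> is near the smaller of the two zeros and that the
  second moment of \<open>1/(z - x\<^sub>i)\<close> is bounded (\<open>upper_branch\<close>, \<open>lower_branch\<close>). The first fact says that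
  the particles near \<open>z\<close> are pushed towards the bulk by a force of order \<open>n\<close>; the second one says that
  only \<open>O(n h\<^sup>2)\<close> particles are near \<open>z\<close>, which makes their mutual repulsion negligible
  (\<open>crowd_cost\<close>). A map \<open>T\<close> that moves just these particles towards the bulk therefore has \<open>ln J\<close> of order
  at least \<open>n h\<^sup>2\<close> (\<open>edge_move\<close>), and a union bound over polynomially many positions of \<open>z\<close> finishes the
  argument (\<open>upper_tail\<close>, \<open>lower_tail\<close>).
\<close>

section \<open>Substitution in every coordinate\<close>

lemma nn_integral_substitution_le:
  fixes T T' :: "real \<Rightarrow> real" and h :: "real \<Rightarrow> ennreal"
  assumes [measurable]: "h \<in> borel_measurable borel"
    and deriv: "\<And>x. x \<in> {a..b} \<Longrightarrow> (T has_real_derivative T' x) (at x)"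
    and cont: "continuous_on {a..b} T'"
    and nonneg: "\<And>x. x \<in> {a..b} \<Longrightarrow> 0 \<le> T' x"
  shows "(\<integral>\<^sup>+x. h (T x) * (ennreal (T' x) * indicator {a..b} x) \<partial>lborel) \<le> (\<integral>\<^sup>+x. h x \<partial>lborel)"
proof (cases "a < b")
  case True
  have "(\<integral>\<^sup>+x. h (T x) * (ennreal (T' x) * indicator {a..b} x) \<partial>lborel)
      = (\<integral>\<^sup>+x. h x * indicator {T a..T b} x \<partial>lborel)"
    by (subst nn_integral_substitution_aux[OF _ _ deriv cont nonneg True]) (simp_all add: mult.assoc)
  also have "\<dots> \<le> (\<integral>\<^sup>+x. h x \<partial>lborel)"
    by (intro nn_integral_mono) (simp split: split_indicator)
  finally show ?thesis .
next
  case False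
  then have "AE x in lborel. (indicator {a..b} x :: ennreal) = 0"
    using AE_lborel_singleton[of a] by (auto elim!: eventually_mono simp: indicator_def)
  then have "(\<integral>\<^sup>+x. h (T x) * (ennreal (T' x) * indicator {a..b} x) \<partial>lborel) = (\<integral>\<^sup>+(x::real). 0 \<partial>lborel)"
    by (intro nn_integral_cong_AE) (auto elim!: eventually_mono)
  then show ?thesis by simp
qed

text \<open>
  Induction over the coordinates by Fubini. There is only an inequality because the image of the box
  \<open>{a..b}\<close> under \<open>T\<close> in every coordinate need not be the whole space.
\<close>

lemma nn_integral_PiM_substitution_le:
  fixes T T' :: "real \<Rightarrow> real"
  assumes T[measurable]: "T \<in> borel_measurable borel" and T'[measurable]: "T' \<in> borel_measurable borel"
    and deriv: "\<And>x. x \<in> {a..b} \<Longrightarrow> (T has_real_derivative T' x) (at x)"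
    and cont: "continuous_on {a..b} T'"
    and nonneg: "\<And>x. x \<in> {a..b} \<Longrightarrow> 0 \<le> T' x"
    and "finite I" and "h \<in> borel_measurable (\<Pi>\<^sub>M i\<in>I. lborel)"
  shows "(\<integral>\<^sup>+x. h (\<lambda>i\<in>I. T (x i)) * (\<Prod>i\<in>I. ennreal (T' (x i)) * indicator {a..b} (x i))
            \<partial>(\<Pi>\<^sub>M i\<in>I. lborel)) \<le> (\<integral>\<^sup>+x. h x \<partial>(\<Pi>\<^sub>M i\<in>I. lborel))"
  using assms(6,7)
proof (induction I arbitrary: h rule: finite_induct)
  case empty
  interpret product_sigma_finite "\<lambda>_::'b. lborel :: real measure" by standard
  show ?case by (simp add: PiM_empty nn_integral_count_space_finite)
next
  case (insert i I)
  interpret product_sigma_finite "\<lambda>_::'b. lborel :: real measure" by standard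
  note [measurable] = insert.prems
  define w where "w = (\<lambda>x. ennreal (T' x) * indicator {a..b} x)"
  have w[measurable]: "w \<in> borel_measurable borel" by (simp add: w_def)
  have "(\<integral>\<^sup>+x. h (\<lambda>j\<in>insert i I. T (x j)) * (\<Prod>j\<in>insert i I. w (x j)) \<partial>(\<Pi>\<^sub>M i\<in>insert i I. lborel))
      = (\<integral>\<^sup>+x. (\<integral>\<^sup>+y. h (\<lambda>j\<in>insert i I. T ((x(i:=y)) j)) * (\<Prod>j\<in>insert i I. w ((x(i:=y)) j)) \<partial>lborel)
            \<partial>(\<Pi>\<^sub>M i\<in>I. lborel))"
    using insert.hyps by (intro product_nn_integral_insert) measurable
  also have "\<dots> \<le> (\<integral>\<^sup>+x. (\<integral>\<^sup>+y. h ((\<lambda>j\<in>I. T (x j))(i:=y)) \<partial>lborel) * (\<Prod>j\<in>I. w (x j))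
            \<partial>(\<Pi>\<^sub>M i\<in>I. lborel))"
  proof (rule nn_integral_mono)
    fix x assume x: "x \<in> space (\<Pi>\<^sub>M i\<in>I. (lborel::real measure))"
    have T_x: "(\<lambda>j\<in>I. T (x j)) \<in> space (\<Pi>\<^sub>M i\<in>I. (lborel::real measure))"
      by (simp add: space_PiM)
    have meas: "(\<lambda>y. h ((\<lambda>j\<in>I. T (x j))(i:=y))) \<in> borel_measurable borel"
      by (rule measurable_compose[OF _ insert.prems], rule measurable_fun_upd[where J=I])
         (use T_x in auto)
    have eq: "(\<lambda>j\<in>insert i I. T ((x(i:=y)) j)) = (\<lambda>j\<in>I. T (x j))(i := T y)" for y
      by (auto simp: fun_eq_iff)
    have prod: "(\<Prod>j\<in>insert i I. w ((x(i:=y)) j)) = w y * (\<Prod>j\<in>I. w (x j))" for y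
    proof -
      have "(\<Prod>j\<in>I. w ((x(i:=y)) j)) = (\<Prod>j\<in>I. w (x j))"
        by (rule prod.cong) (use insert.hyps in auto)
      then show ?thesis using insert.hyps by simp
    qed
    have "(\<integral>\<^sup>+y. h (\<lambda>j\<in>insert i I. T ((x(i:=y)) j)) * (\<Prod>j\<in>insert i I. w ((x(i:=y)) j)) \<partial>lborel)
        = (\<integral>\<^sup>+y. (h ((\<lambda>j\<in>I. T (x j))(i := T y)) * w y) * (\<Prod>j\<in>I. w (x j)) \<partial>lborel)"
      unfolding eq prod by (simp add: mult.assoc)
    also have "\<dots> = (\<integral>\<^sup>+y. h ((\<lambda>j\<in>I. T (x j))(i := T y)) * w y \<partial>lborel) * (\<Prod>j\<in>I. w (x j))"
      using measurable_compose[OF T meas] by (intro nn_integral_multc) simp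
    also have "\<dots> \<le> (\<integral>\<^sup>+y. h ((\<lambda>j\<in>I. T (x j))(i := y)) \<partial>lborel) * (\<Prod>j\<in>I. w (x j))"
      unfolding w_def
      by (intro mult_right_mono nn_integral_substitution_le[OF meas deriv cont nonneg]) auto
    finally show "(\<integral>\<^sup>+y. h (\<lambda>j\<in>insert i I. T ((x(i:=y)) j)) * (\<Prod>j\<in>insert i I. w ((x(i:=y)) j)) \<partial>lborel)
       \<le> (\<integral>\<^sup>+y. h ((\<lambda>j\<in>I. T (x j))(i := y)) \<partial>lborel) * (\<Prod>j\<in>I. w (x j))" .
  qed
  also have "\<dots> \<le> (\<integral>\<^sup>+x. (\<integral>\<^sup>+y. h (x(i:=y)) \<partial>lborel) \<partial>(\<Pi>\<^sub>M i\<in>I. lborel))"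
    unfolding w_def by (rule insert.IH) measurable
  also have "\<dots> = (\<integral>\<^sup>+x. h x \<partial>(\<Pi>\<^sub>M i\<in>insert i I. lborel))"
    using insert.hyps by (intro product_nn_integral_insert[symmetric]) auto
  finally show ?case unfolding w_def .
qed

section \<open>The density under a coordinatewise flow\<close>

text \<open>
  The logarithm of \<open>J\<close> in the rescaled coordinate \<open>x = c \<lambda> / n\<close>. In the first sum the terms come from
  the derivative of \<open>T\<close>, from the exponents \<open>b - 1\<close> and \<open>c\<close>, and the double sum from the interaction.
\<close>

definition log_jacobian ::
  "nat \<Rightarrow> real \<Rightarrow> real \<Rightarrow> real \<Rightarrow> (real \<Rightarrow> real) \<Rightarrow> (real \<Rightarrow> real) \<Rightarrow> (nat \<Rightarrow> real) \<Rightarrow> real" where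
  "log_jacobian n \<alpha> b c T T' x =
     (\<Sum>i=1..n. ln (T' (x i)) + (b - 1) * ln (T (x i) / x i)
        + c * ln ((1 - n / c * T (x i)) / (1 - n / c * x i)))
     + 2 * \<alpha> * (\<Sum>i=1..n. \<Sum>j\<in>{i<..n}. ln ((T (x i) - T (x j)) / (x i - x j)))"

lemma abs_powr_eq_exp_ln_ratio:
  fixes y z :: real
  assumes "y / z > 0"
  shows "\<bar>y\<bar> powr a = \<bar>z\<bar> powr a * exp (a * ln (y / z))"
proof -
  have "\<bar>y\<bar> = \<bar>z\<bar> * (y / z)"
    using assms by (auto simp: zero_less_divide_iff abs_if)
  then have "\<bar>y\<bar> powr a = \<bar>z\<bar> powr a * (y / z) powr a"
    using assms by (metis abs_ge_zero less_imp_le powr_mult)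
  then show ?thesis using assms by (cases "y = 0 \<or> z = 0") (auto simp: powr_def)
qed

text \<open>
  With these parameters the exponents of \<open>\<lambda>\<^sub>i\<close> and \<open>1 - \<lambda>\<^sub>i\<close> in the density become \<open>b - 1\<close> and \<open>c\<close>. The
  particles are studied after division by \<open>r = n/c\<close>, so that the external field \<open>c ln (1 - r x)\<close> is about \<open>- n x\<close>.
\<close>

locale jacobi_particles = prob_space M for M :: "'a measure" +
  fixes X :: "nat \<Rightarrow> 'a \<Rightarrow> real" and n :: nat and \<alpha> b c :: real
  assumes n_pos: "0 < n" and \<alpha>_pos: "0 < \<alpha>" and c_pos: "0 < c"
    and ensemble: "jacobi_ensemble n (2 * \<alpha>) (b + \<alpha> * (real n - 1)) (c + 1 + \<alpha> * (real n - 1)) M X"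
begin

definition r :: real where "r = n / c"

definition Y :: "nat \<Rightarrow> 'a \<Rightarrow> real" where "Y i \<omega> = X i \<omega> / r"

lemma r_pos: "0 < r"
  using n_pos c_pos by (simp add: r_def)

lemma c_r: "c * r = n"
  using c_pos by (simp add: r_def)

lemma X_measurable: "(\<lambda>\<omega>. \<lambda>i\<in>{1..n}. X i \<omega>) \<in> measurable M (\<Pi>\<^sub>M i\<in>{1..n}. lborel)"
  using ensemble unfolding jacobi_ensemble_def by (auto dest: distributed_measurable)

lemma Y_borel: "i \<in> {1..n} \<Longrightarrow> Y i \<in> borel_measurable M"
proof -
  assume i: "i \<in> {1..n}"
  have "(\<lambda>\<omega>. (\<lambda>i\<in>{1..n}. X i \<omega>) i) \<in> borel_measurable M"
    using measurable_compose[OF X_measurable measurable_component_singleton[OF i]] by simp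
  then have "X i \<in> borel_measurable M" using i by simp
  then show ?thesis unfolding Y_def by simp
qed

lemma Y_measurable: "(\<lambda>\<omega>. \<lambda>i\<in>{1..n}. Y i \<omega>) \<in> measurable M (\<Pi>\<^sub>M i\<in>{1..n}. borel)"
  by (intro measurable_restrict Y_borel) auto

lemma Y_event:
  assumes "Measurable.pred (\<Pi>\<^sub>M i\<in>{1..n}. borel) P"
  shows "{\<omega>\<in>space M. P (\<lambda>i\<in>{1..n}. Y i \<omega>)} \<in> events"
  using measurable_compose[OF Y_measurable assms] by (rule predE)

lemma Y_event_box:
  assumes P[measurable]: "Measurable.pred (\<Pi>\<^sub>M i\<in>{1..n}. borel) P"
  shows "{\<omega>\<in>space M. P (\<lambda>i\<in>{1..n}. Y i \<omega>) \<and> (\<forall>i\<in>{1..n}. Y i \<omega> \<in> {l..u})} \<in> events"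
proof -
  have "Measurable.pred (\<Pi>\<^sub>M i\<in>{1..n}. borel) (\<lambda>x. \<forall>i\<in>{1..n}. x i \<in> {l..u::real})"
    by (rule pred_intros_finite) (auto intro!: measurable_compose[OF measurable_component_singleton])
  then have "Measurable.pred (\<Pi>\<^sub>M i\<in>{1..n}. borel) (\<lambda>x. P x \<and> (\<forall>i\<in>{1..n}. x i \<in> {l..u}))"
    using P by (rule pred_intros_logic(3)[rotated])
  from Y_event[OF this] show ?thesis by simp
qed

definition weight :: "(nat \<Rightarrow> real) \<Rightarrow> real" where
  "weight x = (\<Prod>i=1..n. \<Prod>j\<in>{i<..n}. \<bar>x i - x j\<bar> powr (2 * \<alpha>))
     * (\<Prod>i=1..n. x i powr (b - 1) * (1 - x i) powr c) * (\<Prod>i=1..n. indicator {0..1} (x i))"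

lemma density_eq_weight:
  "jacobi_density n (2 * \<alpha>) (b + \<alpha> * (real n - 1)) (c + 1 + \<alpha> * (real n - 1)) x
   = jacobi_const n (2 * \<alpha>) (b + \<alpha> * (real n - 1)) (c + 1 + \<alpha> * (real n - 1)) * weight x"
  by (simp add: weight_def jacobi_density_def Let_def mult.assoc)

lemma weight_nonneg: "0 \<le> weight x"
  unfolding weight_def by (intro mult_nonneg_nonneg prod_nonneg) auto

lemma weight_nonzeroD:
  assumes "weight x \<noteq> 0" and i: "i \<in> {1..n}"
  shows "0 < x i \<and> x i < 1" and "j \<in> {i<..n} \<Longrightarrow> x i \<noteq> x j"
proof -
  have factors: "(\<Prod>i=1..n. \<Prod>j\<in>{i<..n}. \<bar>x i - x j\<bar> powr (2 * \<alpha>)) \<noteq> 0"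
      "(\<Prod>i=1..n. x i powr (b - 1) * (1 - x i) powr c) \<noteq> 0"
      "(\<Prod>i=1..n. indicator {0..1} (x i)) \<noteq> (0::real)"
    using assms(1) unfolding weight_def
    by (simp_all only: mult_eq_0_iff de_Morgan_disj not_False_eq_True simp_thms)
  have "x i powr (b - 1) * (1 - x i) powr c \<noteq> 0" "indicator {0..1} (x i) \<noteq> (0::real)"
    using factors(2,3) i by (simp_all only: prod_zero_iff finite_atLeastAtMost) blast+
  then have "x i \<noteq> 0" "1 - x i \<noteq> 0" "x i \<in> {0..1}"
    by (auto simp: indicator_def split: if_splits)
  then show "0 < x i \<and> x i < 1" by auto
  assume j: "j \<in> {i<..n}"
  have "\<bar>x i - x j\<bar> powr (2 * \<alpha>) \<noteq> 0"
    using factors(1) i j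
    by (simp only: prod_zero_iff finite_atLeastAtMost finite_greaterThanAtMost) blast
  then show "x i \<noteq> x j" by auto
qed

text \<open>
  The probability of the event times \<open>exp K\<close> is at most the integral of the density over the image of the
  event, hence at most one. Points with a coordinate outside \<open>(0, 1)\<close> or with two equal coordinates have
  density zero, so \<open>gain\<close> may assume that they do not occur.
\<close>

lemma flow_bound:
  fixes T T' :: "real \<Rightarrow> real"
  assumes T[measurable]: "T \<in> borel_measurable borel" and T'[measurable]: "T' \<in> borel_measurable borel"
    and deriv: "\<And>x. x \<in> {l..u} \<Longrightarrow> (T has_real_derivative T' x) (at x)"
    and cont: "continuous_on {l..u} T'"
    and pos: "\<And>x. x \<in> {l..u} \<Longrightarrow> 0 < T' x"
    and P[measurable]: "Measurable.pred (\<Pi>\<^sub>M i\<in>{1..n}. borel) P"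
    and gain: "\<And>x. P x \<Longrightarrow> (\<And>i. i \<in> {1..n} \<Longrightarrow> x i \<in> {l..u} \<and> 0 < x i \<and> r * x i < 1) \<Longrightarrow>
       inj_on x {1..n} \<Longrightarrow>
       (\<forall>i\<in>{1..n}. 0 < T (x i) \<and> r * T (x i) < 1) \<and> K \<le> log_jacobian n \<alpha> b c T T' x"
  shows "prob {\<omega>\<in>space M. P (\<lambda>i\<in>{1..n}. Y i \<omega>) \<and> (\<forall>i\<in>{1..n}. Y i \<omega> \<in> {l..u})} \<le> exp (- K)"
proof -
  let ?L = "\<Pi>\<^sub>M i\<in>{1..n}. (lborel :: real measure)"
  define f where "f = jacobi_density n (2 * \<alpha>) (b + \<alpha> * (real n - 1)) (c + 1 + \<alpha> * (real n - 1))"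
  define C where "C = jacobi_const n (2 * \<alpha>) (b + \<alpha> * (real n - 1)) (c + 1 + \<alpha> * (real n - 1))"
  note f_eq = density_eq_weight[folded f_def C_def]
  have dist: "distributed M ?L (\<lambda>\<omega>. \<lambda>i\<in>{1..n}. X i \<omega>) (\<lambda>x. ennreal (f x))"
    using ensemble by (simp add: jacobi_ensemble_def f_def)
  note f_meas[measurable] = distributed_borel_measurable[OF dist]
  define S where "S x \<longleftrightarrow> P (\<lambda>i\<in>{1..n}. x i / r) \<and> (\<forall>i\<in>{1..n}. x i / r \<in> {l..u})"
    for x :: "nat \<Rightarrow> real"
  have rescale: "(\<lambda>x. \<lambda>i\<in>{1..n}. x i / r) \<in> measurable ?L (\<Pi>\<^sub>M i\<in>{1..n}. borel)"
  proof (rule measurable_restrict)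
    fix i assume "i \<in> {1..n}"
    then have "(\<lambda>x. x i) \<in> measurable ?L borel"
      using measurable_component_singleton[of i "{1..n}" "\<lambda>_. lborel :: real measure"] by simp
    then show "(\<lambda>x. x i / r) \<in> measurable ?L borel" by simp
  qed
  have comp: "(\<lambda>x. x i) \<in> borel_measurable ?L" if "i \<in> {1..n}" for i
    using measurable_component_singleton[OF that, of "\<lambda>_. lborel :: real measure"] by simp
  have S_set: "{x \<in> space ?L. S x} \<in> sets ?L"
  proof -
    have [measurable]: "Measurable.pred ?L (\<lambda>x. P (\<lambda>i\<in>{1..n}. x i / r))"
      by (rule measurable_compose[OF rescale P])
    have [measurable]: "Measurable.pred ?L (\<lambda>x. \<forall>i\<in>{1..n}. x i / r \<in> {l..u})"
      by (rule pred_intros_finite) (use comp in \<open>auto intro!: measurable_compose[OF comp]\<close>)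
    show ?thesis unfolding S_def by measurable
  qed
  define Tr where "Tr x = r * T (x / r)" for x
  define Tr' where "Tr' x = T' (x / r)" for x
  have [measurable]: "Tr \<in> borel_measurable borel" "Tr' \<in> borel_measurable borel"
    unfolding Tr_def Tr'_def by measurable
  have in_lu: "x / r \<in> {l..u}" if "x \<in> {r*l..r*u}" for x
    using that r_pos by (auto simp: field_simps)
  have deriv_r: "(Tr has_real_derivative Tr' x) (at x)" if "x \<in> {r*l..r*u}" for x
  proof -
    have "((\<lambda>x. r * T (x / r)) has_real_derivative r * (T' (x / r) * (1 / r))) (at x)"
      by (intro DERIV_cmult DERIV_chain2[where g="\<lambda>x. x / r", OF deriv[OF in_lu[OF that]]])
         (use r_pos in \<open>auto intro!: derivative_eq_intros\<close>)
    then show ?thesis using r_pos by (simp add: Tr_def[abs_def] Tr'_def)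
  qed
  have cont_r: "continuous_on {r*l..r*u} Tr'"
    unfolding Tr'_def[abs_def]
    by (rule continuous_on_compose2[OF cont]) (use in_lu r_pos in \<open>auto intro!: continuous_intros\<close>)
  have mono: "T x < T y" if "x \<in> {l..u}" "y \<in> {l..u}" "x < y" for x y
  proof (rule DERIV_pos_imp_increasing[OF that(3)])
    fix z assume "x \<le> z" "z \<le> y"
    then have "z \<in> {l..u}" using that by auto
    then show "\<exists>d. DERIV T z :> d \<and> 0 < d" using deriv pos by blast
  qed
  have pointwise: "ennreal (exp K) * ennreal (f x) * indicator {x \<in> space ?L. S x} x
     \<le> ennreal (f (\<lambda>i\<in>{1..n}. Tr (x i))) * (\<Prod>i\<in>{1..n}. ennreal (Tr' (x i)) * indicator {r*l..r*u} (x i))"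
    for x
  proof (cases "S x \<and> 0 < f x")
    case False
    then have "ennreal (exp K) * ennreal (f x) * indicator {x \<in> space ?L. S x} x = 0"
      by (auto simp: indicator_def ennreal_neg)
    then show ?thesis by (rule order_trans[OF eq_refl zero_le])
  next
    case True
    then have vx: "weight x \<noteq> 0" and C_pos: "0 < C"
      using weight_nonneg[of x] by (auto simp: f_eq zero_less_mult_iff)
    define y where "y = (\<lambda>i\<in>{1..n}. x i / r)"
    have y: "y i = x i / r" "x i = r * y i" if "i \<in> {1..n}" for i
      using that r_pos by (auto simp: y_def)
    note x01 = weight_nonzeroD(1)[OF vx] and ne = weight_nonzeroD(2)[OF vx]
    have inj: "inj_on y {1..n}"
    proof (rule inj_onI)
      fix i j assume ij: "i \<in> {1..n}" "j \<in> {1..n}" "y i = y j"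
      have eq: "x i = x j" using y(2)[OF ij(1)] y(2)[OF ij(2)] ij(3) by simp
      show "i = j"
      proof (rule ccontr)
        assume "i \<noteq> j"
        then have "j \<in> {i<..n} \<or> i \<in> {j<..n}" using ij(1,2) by auto
        then show False using ne[OF ij(1)] ne[OF ij(2)] eq by metis
      qed
    qed
    have yi: "y i \<in> {l..u} \<and> 0 < y i \<and> r * y i < 1" if i: "i \<in> {1..n}" for i
    proof -
      have "x i / r \<in> {l..u}" using True i unfolding S_def by blast
      moreover have "0 < x i / r" using x01[OF i] r_pos by simp
      moreover have "r * (x i / r) < 1" using x01[OF i] r_pos by simp
      ultimately show ?thesis unfolding y(1)[OF i] by blast
    qed
    have "P y" using True by (simp add: S_def y_def)
    from gain[OF this yi inj]
    have Ty: "\<And>i. i \<in> {1..n} \<Longrightarrow> 0 < T (y i) \<and> r * T (y i) < 1"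
      and K: "K \<le> log_jacobian n \<alpha> b c T T' y" by auto
    have pair: "\<bar>Tr (x i) - Tr (x j)\<bar> powr (2*\<alpha>)
        = \<bar>x i - x j\<bar> powr (2*\<alpha>) * exp (2*\<alpha> * ln ((T (y i) - T (y j)) / (y i - y j)))"
      if i: "i \<in> {1..n}" and j: "j \<in> {i<..n}" for i j
    proof -
      have j': "j \<in> {1..n}" using i j by auto
      have "y i \<noteq> y j" using ne[OF i j] y(2)[OF i] y(2)[OF j'] by metis
      then have "y i < y j \<or> y j < y i" by linarith
      then have q: "(T (y i) - T (y j)) / (y i - y j) > 0"
        using mono[of "y i" "y j"] mono[of "y j" "y i"] yi[OF i] yi[OF j']
        by (metis diff_gt_0_iff_gt diff_less_0_iff_less divide_neg_neg divide_pos_pos)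
      have e: "(Tr (x i) - Tr (x j)) / (x i - x j) = (T (y i) - T (y j)) / (y i - y j)"
        unfolding Tr_def y(1)[OF i] y(1)[OF j'] using r_pos
        by (simp flip: right_diff_distrib diff_divide_distrib)
      show ?thesis using abs_powr_eq_exp_ln_ratio[of "Tr (x i) - Tr (x j)" "x i - x j" "2*\<alpha>"] q
        unfolding e by simp
    qed
    have single: "Tr (x i) powr (b-1) * (1 - Tr (x i)) powr c
        = x i powr (b-1) * (1 - x i) powr c *
          exp ((b-1) * ln (T (y i) / y i) + c * ln ((1 - r * T (y i)) / (1 - r * y i)))"
      if i: "i \<in> {1..n}" for i
    proof -
      have e2: "Tr (x i) = r * T (y i)" by (simp add: Tr_def y(1)[OF i])
      have e1: "Tr (x i) / x i = T (y i) / y i" unfolding e2 using r_pos by (simp add: y(1)[OF i])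
      have e3: "(1 - Tr (x i)) / (1 - x i) = (1 - r * T (y i)) / (1 - r * y i)"
        unfolding e2 using r_pos by (simp add: y(1)[OF i])
      have p: "Tr (x i) / x i > 0" "(1 - Tr (x i)) / (1 - x i) > 0"
        using Ty[OF i] x01[OF i] r_pos unfolding e2 by auto
      have a: "\<bar>Tr (x i)\<bar> = Tr (x i)" "\<bar>1 - Tr (x i)\<bar> = 1 - Tr (x i)" "\<bar>x i\<bar> = x i" "\<bar>1 - x i\<bar> = 1 - x i"
        using Ty[OF i] x01[OF i] r_pos unfolding e2 by auto
      show ?thesis
        using abs_powr_eq_exp_ln_ratio[OF p(1), of "b-1"] abs_powr_eq_exp_ln_ratio[OF p(2), of c]
        unfolding a e1 e3 by (simp add: exp_add)
    qed
    have ind: "(\<Prod>i=1..n. indicator {0..1} (Tr (x i))) = (1::real)" "(\<Prod>i=1..n. indicator {0..1} (x i)) = (1::real)"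
    proof -
      show "(\<Prod>i=1..n. indicator {0..1} (Tr (x i))) = (1::real)"
      proof (rule prod.neutral, rule ballI)
        fix i assume i: "i \<in> {1..n}"
        show "indicator {0..1} (Tr (x i)) = (1::real)"
          using Ty[OF i] r_pos by (simp add: Tr_def y(1)[OF i] indicator_def less_imp_le)
      qed
      show "(\<Prod>i=1..n. indicator {0..1} (x i)) = (1::real)"
        by (rule prod.neutral) (use x01 in \<open>auto simp: indicator_def less_imp_le\<close>)
    qed
    have T'_eq: "(\<Prod>i=1..n. Tr' (x i)) = exp (\<Sum>i=1..n. ln (T' (y i)))"
    proof -
      have "exp (ln (T' (y i))) = Tr' (x i)" if "i \<in> {1..n}" for i
        using pos[of "y i"] yi[OF that] by (simp add: Tr'_def y(1)[OF that])
      then show ?thesis by (simp add: exp_sum)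
    qed
    have LJ: "log_jacobian n \<alpha> b c T T' y = (\<Sum>i=1..n. ln (T' (y i)))
         + (2*\<alpha> * (\<Sum>i=1..n. \<Sum>j\<in>{i<..n}. ln ((T (y i) - T (y j)) / (y i - y j)))
         + (\<Sum>i=1..n. (b-1) * ln (T (y i) / y i) + c * ln ((1 - r * T (y i)) / (1 - r * y i))))"
      unfolding log_jacobian_def r_def by (simp add: sum.distrib)
    have "weight (\<lambda>i\<in>{1..n}. Tr (x i)) = (\<Prod>i=1..n. \<Prod>j\<in>{i<..n}. \<bar>Tr (x i) - Tr (x j)\<bar> powr (2 * \<alpha>))
        * (\<Prod>i=1..n. Tr (x i) powr (b - 1) * (1 - Tr (x i)) powr c) * (\<Prod>i=1..n. indicator {0..1} (Tr (x i)))"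
      unfolding weight_def by (intro arg_cong2[where f="(*)"] prod.cong) auto
    also have "\<dots> = weight x * exp (2*\<alpha> * (\<Sum>i=1..n. \<Sum>j\<in>{i<..n}. ln ((T (y i) - T (y j)) / (y i - y j)))
         + (\<Sum>i=1..n. (b-1) * ln (T (y i) / y i) + c * ln ((1 - r * T (y i)) / (1 - r * y i))))"
      unfolding weight_def ind
      by (simp add: pair single prod.distrib exp_add exp_sum sum_distrib_left)
    finally have "weight (\<lambda>i\<in>{1..n}. Tr (x i)) * (\<Prod>i=1..n. Tr' (x i))
        = weight x * exp (log_jacobian n \<alpha> b c T T' y)"
      unfolding T'_eq LJ exp_add by (simp only: mult_ac)
    then have eq: "f (\<lambda>i\<in>{1..n}. Tr (x i)) * (\<Prod>i=1..n. Tr' (x i))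
        = exp (log_jacobian n \<alpha> b c T T' y) * f x"
      unfolding f_eq by (metis mult.assoc mult.commute)
    have "exp K * f x \<le> f (\<lambda>i\<in>{1..n}. Tr (x i)) * (\<Prod>i=1..n. Tr' (x i))"
      unfolding eq using K True by (intro mult_right_mono) auto
    moreover have "(\<Prod>i\<in>{1..n}. ennreal (Tr' (x i)) * indicator {r*l..r*u} (x i)) = ennreal (\<Prod>i=1..n. Tr' (x i))"
    proof -
      have "0 \<le> Tr' (x i) \<and> x i \<in> {r*l..r*u}" if i: "i \<in> {1..n}" for i
      proof
        show "0 \<le> Tr' (x i)" using pos[of "y i"] yi[OF i] by (simp add: Tr'_def y(1)[OF i])
        have "r * l \<le> r * y i" "r * y i \<le> r * u" using yi[OF i] r_pos by auto
        then show "x i \<in> {r*l..r*u}" unfolding y(2)[OF i, symmetric] by simp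
      qed
      then show ?thesis by (subst prod_ennreal[symmetric]) (auto intro!: prod.cong)
    qed
    moreover have "0 \<le> f (\<lambda>i\<in>{1..n}. Tr (x i))" using C_pos weight_nonneg by (simp add: f_eq)
    moreover have "0 \<le> (\<Prod>i=1..n. Tr' (x i))" unfolding T'_eq by simp
    ultimately show ?thesis
      using True by (auto simp: indicator_def ennreal_mult'[symmetric] intro!: ennreal_leI)
  qed
  let ?E = "{\<omega>\<in>space M. P (\<lambda>i\<in>{1..n}. Y i \<omega>) \<and> (\<forall>i\<in>{1..n}. Y i \<omega> \<in> {l..u})}"
  have "(\<lambda>i\<in>{1..n}. (\<lambda>i\<in>{1..n}. X i \<omega>) i / r) = (\<lambda>i\<in>{1..n}. Y i \<omega>)" for \<omega>
    by (auto simp: fun_eq_iff Y_def)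
  then have E_eq: "?E = (\<lambda>\<omega>. \<lambda>i\<in>{1..n}. X i \<omega>) -` {x \<in> space ?L. S x} \<inter> space M"
    using measurable_space[OF X_measurable] by (auto simp: S_def Y_def)
  have m: "(\<lambda>x. ennreal (f x) * indicator {x \<in> space ?L. S x} x) \<in> borel_measurable ?L"
    by (intro borel_measurable_times_ennreal borel_measurable_indicator f_meas S_set)
  have "emeasure M ?E = emeasure (distr M ?L (\<lambda>\<omega>. \<lambda>i\<in>{1..n}. X i \<omega>)) {x \<in> space ?L. S x}"
    unfolding E_eq by (rule emeasure_distr[OF X_measurable S_set, symmetric])
  also have "\<dots> = (\<integral>\<^sup>+x. ennreal (f x) * indicator {x \<in> space ?L. S x} x \<partial>?L)"
    unfolding distributed_distr_eq_density[OF dist] by (rule emeasure_density[OF f_meas S_set])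
  finally have "ennreal (exp K) * emeasure M ?E
      = (\<integral>\<^sup>+x. ennreal (exp K) * ennreal (f x) * indicator {x \<in> space ?L. S x} x \<partial>?L)"
    using nn_integral_cmult[OF m, of "ennreal (exp K)"] by (simp only: mult.assoc)
  also have "\<dots> \<le> (\<integral>\<^sup>+x. ennreal (f (\<lambda>i\<in>{1..n}. Tr (x i))) *
      (\<Prod>i\<in>{1..n}. ennreal (Tr' (x i)) * indicator {r*l..r*u} (x i)) \<partial>?L)"
    by (intro nn_integral_mono pointwise)
  also have "\<dots> \<le> (\<integral>\<^sup>+x. ennreal (f x) \<partial>?L)"
    by (rule nn_integral_PiM_substitution_le[OF _ _ deriv_r cont_r _ _ f_meas])
       (use pos in_lu in \<open>auto simp: Tr'_def intro: less_imp_le\<close>)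
  also have "\<dots> = emeasure M (space M)"
  proof -
    have "(\<integral>\<^sup>+x. ennreal (f x) \<partial>?L) = emeasure (density ?L (\<lambda>x. ennreal (f x))) (space ?L)"
      unfolding emeasure_density[OF f_meas sets.top]
      by (rule nn_integral_cong) (simp only: indicator_simps mult_1_right)
    also have "\<dots> = emeasure (distr M ?L (\<lambda>\<omega>. \<lambda>i\<in>{1..n}. X i \<omega>)) (space ?L)"
      unfolding distributed_distr_eq_density[OF dist] ..
    also have "\<dots> = emeasure M (space M)"
    proof (subst emeasure_distr[OF X_measurable])
      show "emeasure M ((\<lambda>\<omega>. \<lambda>i\<in>{1..n}. X i \<omega>) -` space ?L \<inter> space M) = emeasure M (space M)"
        using measurable_space[OF X_measurable] by (intro arg_cong2[where f=emeasure]) auto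
    qed auto
    finally show ?thesis .
  qed
  finally have "ennreal (exp K) * ennreal (prob ?E) \<le> ennreal 1"
    by (simp add: emeasure_eq_measure prob_space)
  then have "exp K * prob ?E \<le> 1"
    by (subst (asm) ennreal_mult'[symmetric]) (auto simp: ennreal_le_iff)
  then show ?thesis by (simp add: exp_minus field_simps)
qed

end

section \<open>The loop equation\<close>

lemma ln_one_plus_ge:
  fixes v :: real
  assumes "\<bar>v\<bar> \<le> B" "B \<le> 1/2"
  shows "v - 2 * B\<^sup>2 \<le> ln (1 + v)"
proof -
  have "\<bar>ln (1 + v) - v\<bar> \<le> 2 * v\<^sup>2"
    using assms by (intro abs_ln_one_plus_x_minus_x_bound) auto
  moreover have "v\<^sup>2 \<le> B\<^sup>2" using assms by (metis abs_ge_zero power2_abs power_mono)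
  ultimately show ?thesis by linarith
qed

lemma sum_pairs_symmetric:
  fixes q :: "nat \<Rightarrow> nat \<Rightarrow> real"
  assumes "\<And>i j. q i j = q j i"
  shows "2 * (\<Sum>i=1..n. \<Sum>j\<in>{i<..n}. q i j) = (\<Sum>i=1..n. \<Sum>j=1..n. q i j) - (\<Sum>i=1..n. q i i)"
proof (induction n)
  case (Suc n)
  have "{i<..Suc n} = insert (Suc n) {i<..n}" if "i \<in> {1..n}" for i using that by auto
  then have "(\<Sum>i=1..n. \<Sum>j\<in>{i<..Suc n}. q i j) = (\<Sum>i=1..n. q i (Suc n) + (\<Sum>j\<in>{i<..n}. q i j))"
    by (intro sum.cong) auto
  moreover have "(\<Sum>j=1..n. q (Suc n) j) = (\<Sum>i=1..n. q i (Suc n))"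
    by (intro sum.cong assms) simp
  ultimately show ?case using Suc.IH by (simp add: sum.distrib algebra_simps)
qed simp

lemma sum_pairs_ge:
  fixes q :: "nat \<Rightarrow> nat \<Rightarrow> real"
  assumes "\<And>i j. i \<in> {1..n} \<Longrightarrow> j \<in> {i<..n} \<Longrightarrow> p i j - B \<le> q i j" "0 \<le> B"
  shows "(\<Sum>i=1..n. \<Sum>j\<in>{i<..n}. p i j) - B * (real n)\<^sup>2 \<le> (\<Sum>i=1..n. \<Sum>j\<in>{i<..n}. q i j)"
proof -
  have "(\<Sum>i=1..n. (\<Sum>j\<in>{i<..n}. p i j) - B * real n) \<le> (\<Sum>i=1..n. \<Sum>j\<in>{i<..n}. q i j)"
  proof (rule sum_mono)
    fix i assume i: "i \<in> {1..n}"
    have "(\<Sum>j\<in>{i<..n}. p i j - B) \<le> (\<Sum>j\<in>{i<..n}. q i j)"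
      using assms(1)[OF i] by (intro sum_mono) auto
    moreover have "B * real (card {i<..n}) \<le> B * real n"
      using assms(2) by (intro mult_left_mono) auto
    ultimately show "(\<Sum>j\<in>{i<..n}. p i j) - B * real n \<le> (\<Sum>j\<in>{i<..n}. q i j)"
      by (simp add: sum_subtractf mult.commute)
  qed
  then show ?thesis by (simp add: sum_subtractf power2_eq_square algebra_simps)
qed

definition stieltjes :: "nat \<Rightarrow> real \<Rightarrow> (nat \<Rightarrow> real) \<Rightarrow> real" where
  "stieltjes n z x = (\<Sum>i=1..n. 1 / (z - x i)) / n"

text \<open>
  In the large \<open>n\<close> limit the Stieltjes transform \<open>g\<close> at \<open>z\<close> is a zero of this polynomial, which is the equation
  of the Marchenko--Pastur law.
\<close>

definition loop_poly :: "real \<Rightarrow> real \<Rightarrow> real \<Rightarrow> real \<Rightarrow> real" where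
  "loop_poly \<alpha> \<kappa> z g = \<alpha> * z * g\<^sup>2 + (\<kappa> - z) * g + 1"

lemma stieltjes_restrict: "stieltjes n z (\<lambda>i\<in>{1..n}. x i) = stieltjes n z x"
  by (simp add: stieltjes_def)

lemma stieltjes_borel[measurable]:
  "stieltjes n z \<in> borel_measurable (\<Pi>\<^sub>M i\<in>{1..n}. borel)"
  unfolding stieltjes_def[abs_def] by measurable

context jacobi_particles
begin

lemma Y_bounds: "AE \<omega> in M. \<forall>i\<in>{1..n}. 0 < Y i \<omega> \<and> r * Y i \<omega> < 1"
proof -
  let ?L = "\<Pi>\<^sub>M i\<in>{1..n}. (lborel :: real measure)"
  let ?f = "jacobi_density n (2 * \<alpha>) (b + \<alpha> * (real n - 1)) (c + 1 + \<alpha> * (real n - 1))"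
  have dist: "distributed M ?L (\<lambda>\<omega>. \<lambda>i\<in>{1..n}. X i \<omega>) (\<lambda>x. ennreal (?f x))"
    using ensemble by (simp add: jacobi_ensemble_def)
  have comp: "(\<lambda>x. x i) \<in> borel_measurable ?L" if "i \<in> {1..n}" for i
    using measurable_component_singleton[OF that, of "\<lambda>_. lborel :: real measure"] by simp
  have pred: "Measurable.pred ?L (\<lambda>x. \<forall>i\<in>{1..n}. 0 < x i \<and> x i < 1)"
    by (rule pred_intros_finite) (use comp in \<open>auto intro!: measurable_compose[OF comp]\<close>)
  have "0 < x i \<and> x i < 1" if "0 < ennreal (?f x)" and i: "i \<in> {1..n}" for x i
  proof -
    have "weight x \<noteq> 0" using that(1) unfolding density_eq_weight by auto
    from weight_nonzeroD(1)[OF this i] show ?thesis .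
  qed
  then have "AE \<omega> in M. \<forall>i\<in>{1..n}. 0 < (\<lambda>i\<in>{1..n}. X i \<omega>) i \<and> (\<lambda>i\<in>{1..n}. X i \<omega>) i < 1"
    by (subst distributed_AE2[OF dist pred]) auto
  then show ?thesis
    by eventually_elim (use r_pos in \<open>auto simp: Y_def\<close>)
qed

text \<open>
  Under \<open>T x = x/2\<close> the interaction and the factor \<open>x\<^sup>b\<close> lose a factor exponential in \<open>n\<^sup>2\<close>, while the factor
  \<open>(1 - r x)\<^sup>c\<close> gains at least \<open>exp (n/2 \<Sum> x\<^sub>i)\<close>.
\<close>

lemma sum_tail:
  assumes b: "0 \<le> b" and C0: "2 * (b / n + 2 * \<alpha>) + 2 \<le> C0"
  shows "prob {\<omega>\<in>space M. C0 * n \<le> (\<Sum>i=1..n. Y i \<omega>)} \<le> exp (- (real n)\<^sup>2)"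
proof -
  let ?P = "\<lambda>x::nat \<Rightarrow> real. C0 * n \<le> (\<Sum>i=1..n. x i)"
  have P: "Measurable.pred (\<Pi>\<^sub>M i\<in>{1..n}. borel) ?P" by measurable
  have "prob {\<omega>\<in>space M. ?P (\<lambda>i\<in>{1..n}. Y i \<omega>) \<and> (\<forall>i\<in>{1..n}. Y i \<omega> \<in> {0..1/r})} \<le> exp (- (real n)\<^sup>2)"
  proof (rule flow_bound[where T = "\<lambda>x. x / 2" and T' = "\<lambda>_. 1 / 2", OF _ _ _ _ _ P])
    fix x :: "nat \<Rightarrow> real"
    assume Px: "?P x" and x: "\<And>i. i \<in> {1..n} \<Longrightarrow> x i \<in> {0..1/r} \<and> 0 < x i \<and> r * x i < 1"
      and inj: "inj_on x {1..n}"
    have ln2: "ln (1 / 2) = - ln (2::real)" by (simp add: ln_div)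
    have ln2_le: "ln 2 \<le> (1::real)" using ln_le_minus_one[of "2::real"] by simp
    have single: "- b + n * x i / 2 \<le> ln (1 / 2) + (b - 1) * ln (x i / 2 / x i)
        + c * ln ((1 - n / c * (x i / 2)) / (1 - n / c * x i))" if i: "i \<in> {1..n}" for i
    proof -
      define v where "v = r * x i / 2"
      have v: "0 < v" "2 * v < 1" using x[OF i] r_pos by (auto simp: v_def)
      have "ln ((1 - v) / (1 - 2 * v)) = - ln ((1 - 2 * v) / (1 - v))"
        using v by (simp add: ln_div)
      moreover have "(1 - 2 * v) / (1 - v) = 1 + (- v / (1 - v))" using v by (simp add: field_simps)
      moreover have "ln (1 + (- v / (1 - v))) \<le> - v / (1 - v)"
        using v by (intro ln_add_one_self_le_self2) (simp add: field_simps)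
      moreover have "v \<le> v / (1 - v)" using v by (simp add: field_simps)
      ultimately have "v \<le> ln ((1 - v) / (1 - 2 * v))" by simp
      then have "c * v \<le> c * ln ((1 - v) / (1 - 2 * v))" using c_pos by simp
      moreover have "c * v = n * x i / 2" using c_r by (simp add: v_def flip: mult.assoc)
      moreover have e: "n / c * (x i / 2) = v" "n / c * x i = 2 * v" "x i / 2 / x i = 1 / 2"
        using x[OF i] by (simp_all add: v_def r_def)
      moreover have "b * ln 2 \<le> b" using b ln2_le by (simp add: mult_left_le)
      ultimately show ?thesis unfolding e ln2 by (simp add: algebra_simps)
    qed
    have pairs: "0 - 1 \<le> ln ((x i / 2 - x j / 2) / (x i - x j))" if i: "i \<in> {1..n}" "j \<in> {i<..n}" for i j
    proof -
      have "x i - x j \<noteq> 0" using inj_onD[OF inj, of i j] i by auto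
      then have e: "(x i / 2 - x j / 2) / (x i - x j) = 1 / 2" by (simp add: field_simps)
      show ?thesis unfolding e using ln2 ln2_le by simp
    qed
    have "(\<Sum>i=1..n. - b + n * x i / 2) + 2 * \<alpha> * ((\<Sum>i=1..n. \<Sum>j\<in>{i<..n}. 0) - 1 * (real n)\<^sup>2)
        \<le> log_jacobian n \<alpha> b c (\<lambda>x. x / 2) (\<lambda>_. 1 / 2) x"
      unfolding log_jacobian_def
      by (intro add_mono sum_mono single mult_left_mono sum_pairs_ge pairs) (use \<alpha>_pos in auto)
    moreover have "(\<Sum>i=1..n. - b + n * x i / 2) = - b * n + n / 2 * (\<Sum>i=1..n. x i)"
      by (simp add: sum.distrib sum_distrib_left sum_negf sum_subtractf)
    moreover have "n / 2 * (C0 * n) \<le> n / 2 * (\<Sum>i=1..n. x i)"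
      using Px by (intro mult_left_mono) auto
    moreover have "(real n)\<^sup>2 \<le> - b * n + n / 2 * (C0 * n) - 2 * \<alpha> * (real n)\<^sup>2"
    proof -
      have "(2 * (b / n + 2 * \<alpha>) + 2) * (real n)\<^sup>2 \<le> C0 * (real n)\<^sup>2"
        using C0 by (rule mult_right_mono) simp
      moreover have "b / n * (real n)\<^sup>2 = b * n" using n_pos by (simp add: power2_eq_square)
      ultimately show ?thesis using n_pos by (simp add: algebra_simps power2_eq_square)
    qed
    ultimately have "(real n)\<^sup>2 \<le> log_jacobian n \<alpha> b c (\<lambda>x. x / 2) (\<lambda>_. 1 / 2) x" by simp
    moreover have "\<forall>i\<in>{1..n}. 0 < x i / 2 \<and> r * (x i / 2) < 1"
      using x r_pos by force
    ultimately show "(\<forall>i\<in>{1..n}. 0 < x i / 2 \<and> r * (x i / 2) < 1) \<and>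
      (real n)\<^sup>2 \<le> log_jacobian n \<alpha> b c (\<lambda>x. x / 2) (\<lambda>_. 1 / 2) x" by blast
  qed (auto intro!: derivative_eq_intros)
  moreover have "prob {\<omega>\<in>space M. C0 * n \<le> (\<Sum>i=1..n. Y i \<omega>)}
      = prob {\<omega>\<in>space M. ?P (\<lambda>i\<in>{1..n}. Y i \<omega>) \<and> (\<forall>i\<in>{1..n}. Y i \<omega> \<in> {0..1/r})}"
  proof (rule finite_measure_eq_AE)
    show "AE \<omega> in M. (\<omega> \<in> {\<omega>\<in>space M. C0 * n \<le> (\<Sum>i=1..n. Y i \<omega>)}) =
       (\<omega> \<in> {\<omega>\<in>space M. ?P (\<lambda>i\<in>{1..n}. Y i \<omega>) \<and> (\<forall>i\<in>{1..n}. Y i \<omega> \<in> {0..1/r})})"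
      using Y_bounds
    proof eventually_elim
      case (elim \<omega>)
      then have "\<forall>i\<in>{1..n}. Y i \<omega> \<in> {0..1/r}" using r_pos by (auto simp: field_simps less_imp_le)
      then show ?case by simp
    qed
    show "{\<omega>\<in>space M. C0 * n \<le> (\<Sum>i=1..n. Y i \<omega>)} \<in> events"
      using Y_event[OF P] by simp
    show "{\<omega>\<in>space M. ?P (\<lambda>i\<in>{1..n}. Y i \<omega>) \<and> (\<forall>i\<in>{1..n}. Y i \<omega> \<in> {0..1/r})} \<in> events"
      by (rule Y_event_box[OF P])
  qed
  ultimately show ?thesis by simp
qed

text \<open>
  Let \<open>T x = x + t \<phi> x\<close> with \<open>\<phi> x = w x/(z - x)\<close>. For this \<open>\<phi>\<close> the difference quotient
  \<open>(\<phi> x - \<phi> y)/(x - y)\<close> is the product \<open>w z/((z - x)(z - y))\<close>, so the sum over pairs is the square of the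
  Stieltjes transform up to its diagonal, and the linear part of \<open>ln J\<close> becomes \<open>t n\<^sup>2 w\<close> times
  \<open>loop_poly\<close>. The diagonal, the derivative of \<open>T\<close> and the deviation of \<open>(1 - r x)\<^sup>c\<close> from an exponential
  contribute \<open>O(t n L)\<close>, the quadratic part is \<open>O(t\<^sup>2 n\<^sup>2 L\<^sup>2)\<close>, and \<open>t\<close> is chosen to balance it against
  the gain. The weight \<open>w\<close> keeps \<open>\<phi>\<close> bounded for large \<open>z\<close>.
\<close>

lemma loop_bound:
  fixes z h w W L \<kappa>m C0 C1 C2 s \<epsilon> l u :: real
  assumes h: "0 < h" "h \<le> 1" and w: "0 < w" "w \<le> W" "w * \<bar>z\<bar> \<le> W" and L: "L = 2 * W / h\<^sup>2"
    and side: "(\<forall>x\<in>{l..u}. x \<le> z - h) \<or> (\<forall>x\<in>{l..u}. z + h \<le> x)"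
    and b: "0 \<le> b" "b / n \<le> \<kappa>m" and r_small: "r * n \<le> 1" "r * (C0 * n) \<le> 1/2" and C0: "0 \<le> C0"
    and C1: "C1 = 2 + \<alpha> + 2 * C0" and C2: "C2 = 10 + 2 * \<kappa>m + 4 * \<alpha>"
    and s: "2 * C1 * L / n \<le> s" "s \<le> C2 * L" and \<epsilon>: "\<epsilon> = 1 \<or> \<epsilon> = - 1"
  shows "prob {\<omega>\<in>space M. (\<Sum>i=1..n. Y i \<omega>) \<le> C0 * n
      \<and> s \<le> \<epsilon> * (w * loop_poly \<alpha> (b / n) z (stieltjes n z (\<lambda>i. Y i \<omega>))) \<and> (\<forall>i\<in>{1..n}. Y i \<omega> \<in> {l..u})}
     \<le> exp (- ((real n)\<^sup>2 * s\<^sup>2 / (16 * C2 * L\<^sup>2)))" (is "_ \<le> exp (- ?K)")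
proof -
  \<comment> \<open>the maximizer of \<open>t n\<^sup>2 s/2 - t\<^sup>2 n\<^sup>2 L\<^sup>2 C2\<close>\<close>
  define t0 where "t0 = s / (4 * C2 * L\<^sup>2)"
  define t where "t = \<epsilon> * t0"
  define \<phi>' where "\<phi>' x = w * z / (z - x)\<^sup>2" for x
  define \<psi> where "\<psi> x = w / (z - x)" for x
  define \<Delta> where "\<Delta> x y = w * z / ((z - x) * (z - y))" for x y
  define T where "T x = x + t * (x * \<psi> x)" for x
  define T' where "T' x = 1 + t * \<phi>' x" for x
  have W: "0 < W" using w by linarith
  have L_pos: "0 < L" using W h by (simp add: L)
  have h2: "h\<^sup>2 \<le> h" using h by (simp add: power2_eq_square mult_left_le)
  have C1_pos: "0 < C1" using \<alpha>_pos C0 by (simp add: C1)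
  have \<kappa>m: "0 \<le> \<kappa>m" using b n_pos by (meson divide_nonneg_nonneg of_nat_0_le_iff order_trans)
  have C2_pos: "10 \<le> C2" using \<alpha>_pos \<kappa>m by (simp add: C2)
  have "0 < 2 * C1 * L / n" using C1_pos L_pos n_pos by simp
  then have s_pos: "0 < s" using s(1) by linarith
  have t0_pos: "0 < t0" using s_pos C2_pos L_pos by (simp add: t0_def)
  have abs_t: "\<bar>t\<bar> = t0" using \<epsilon> t0_pos by (auto simp: t_def abs_mult)
  have tL: "\<bar>t\<bar> * L \<le> 1/4"
  proof -
    have "t0 * L = s / (4 * (C2 * L))" using L_pos by (simp add: t0_def power2_eq_square)
    also have "\<dots> \<le> 1/4" using s(2) C2_pos L_pos by (simp add: divide_le_eq)
    finally show ?thesis by (simp add: abs_t)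
  qed
  have t_bound: "\<bar>t * y\<bar> \<le> \<bar>t\<bar> * L" if "\<bar>y\<bar> \<le> L" for y
    using that by (simp add: abs_mult mult_left_mono)
  have dist: "h \<le> \<bar>z - x\<bar>" if "x \<in> {l..u}" for x
    using side that by force
  have W_h: "W / h \<le> L / 2" "W / h\<^sup>2 \<le> L / 2"
    using W h h2 by (auto simp: L frac_le)
  have W_hh: "W \<le> L / 2"
    using W h h2 by (simp add: L le_divide_eq)
  have \<psi>_bound: "\<bar>\<psi> x\<bar> \<le> L" if "x \<in> {l..u}" for x
  proof -
    have "\<bar>\<psi> x\<bar> \<le> W / h" unfolding \<psi>_def abs_divide
      using dist[OF that] w h W by (intro frac_le) auto
    then show ?thesis using W_h L_pos by linarith
  qed
  have \<Delta>_bound: "\<bar>\<Delta> x y\<bar> \<le> L" if "x \<in> {l..u}" "y \<in> {l..u}" for x y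
  proof -
    have "h\<^sup>2 \<le> \<bar>(z - x) * (z - y)\<bar>"
      unfolding power2_eq_square abs_mult using dist[OF that(1)] dist[OF that(2)] h
      by (intro mult_mono) auto
    then have "\<bar>\<Delta> x y\<bar> \<le> W / h\<^sup>2" unfolding \<Delta>_def abs_divide
      using w h W by (intro frac_le) (auto simp: abs_mult)
    then show ?thesis using W_h L_pos by linarith
  qed
  have \<phi>'_\<Delta>: "\<phi>' x = \<Delta> x x" for x by (simp add: \<phi>'_def \<Delta>_def power2_eq_square)
  have \<phi>_eq: "x * \<psi> x = - w + w * z / (z - x)" if "x \<in> {l..u}" for x
    using dist[OF that] h by (simp add: \<psi>_def field_simps)
  have \<phi>_bound: "\<bar>x * \<psi> x\<bar> \<le> L" if "x \<in> {l..u}" for x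
  proof -
    have "\<bar>w * z / (z - x)\<bar> \<le> W / h" unfolding abs_divide
      using dist[OF that] w h W by (intro frac_le) (auto simp: abs_mult)
    then show ?thesis unfolding \<phi>_eq[OF that] using W_h W_hh w by linarith
  qed
  have \<Delta>_eq: "x * \<psi> x - y * \<psi> y = \<Delta> x y * (x - y)" if "x \<in> {l..u}" "y \<in> {l..u}" for x y
    using dist[OF that(1)] dist[OF that(2)] h by (simp add: \<psi>_def \<Delta>_def field_simps)
  have r1: "r \<le> 1"
  proof -
    have "r * 1 \<le> r * n" using r_pos n_pos by (intro mult_left_mono) auto
    then show ?thesis using r_small(1) by linarith
  qed
  let ?P = "\<lambda>x. (\<Sum>i=1..n. x i) \<le> C0 * n \<and> s \<le> \<epsilon> * (w * loop_poly \<alpha> (b / n) z (stieltjes n z x))"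
  have P: "Measurable.pred (\<Pi>\<^sub>M i\<in>{1..n}. borel) ?P"
    unfolding loop_poly_def by measurable
  have "prob {\<omega>\<in>space M. ?P (\<lambda>i\<in>{1..n}. Y i \<omega>) \<and> (\<forall>i\<in>{1..n}. Y i \<omega> \<in> {l..u})} \<le> exp (- ?K)"
  proof (rule flow_bound[where T = T and T' = T', OF _ _ _ _ _ P])
    show "T \<in> borel_measurable borel" "T' \<in> borel_measurable borel"
      unfolding T_def[abs_def] T'_def[abs_def] \<psi>_def \<phi>'_def by measurable
    show "continuous_on {l..u} T'"
      unfolding T'_def[abs_def] \<phi>'_def using dist h by (force intro!: continuous_intros)
    show "(T has_real_derivative T' x) (at x)" if x: "x \<in> {l..u}" for x
    proof -
      have "z - x \<noteq> 0" using dist[OF x] h by auto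
      then show ?thesis unfolding T_def[abs_def] T'_def \<psi>_def \<phi>'_def
        by (auto intro!: derivative_eq_intros simp: power2_eq_square field_simps)
    qed
    show "0 < T' x" if "x \<in> {l..u}" for x
      using t_bound[OF \<Delta>_bound[OF that that]] tL by (simp add: T'_def \<phi>'_\<Delta>)
    fix x :: "nat \<Rightarrow> real"
    assume Px: "?P x" and x: "\<And>i. i \<in> {1..n} \<Longrightarrow> x i \<in> {l..u} \<and> 0 < x i \<and> r * x i < 1"
      and inj: "inj_on x {1..n}"
    \<comment> \<open>the quadratic error of each logarithm in \<open>ln J\<close>\<close>
    define B where "B = 2 * (\<bar>t\<bar> * L)\<^sup>2"
    have B: "0 \<le> B" by (simp add: B_def)
    have rx: "r * x i \<le> 1/2" if i: "i \<in> {1..n}" for i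
    proof -
      have "x i \<le> (\<Sum>i=1..n. x i)" using x i by (intro member_le_sum) (auto intro: less_imp_le)
      then have "r * x i \<le> r * (C0 * n)" using Px r_pos by (intro mult_left_mono) auto
      then show ?thesis using r_small by linarith
    qed
    have T_pos: "0 < T (x i)" if i: "i \<in> {1..n}" for i
    proof -
      have "T (x i) = x i * (1 + t * \<psi> (x i))" by (simp add: T_def algebra_simps)
      moreover have "\<bar>t * \<psi> (x i)\<bar> \<le> 1/4" using t_bound[OF \<psi>_bound] x[OF i] tL by fastforce
      ultimately show ?thesis using x[OF i] by simp
    qed
    define v where "v i = r * (t * (x i * \<psi> (x i))) / (1 - r * x i)" for i
    have v_bound: "\<bar>v i\<bar> \<le> 2 * r * (\<bar>t\<bar> * L)" if i: "i \<in> {1..n}" for i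
    proof -
      have "\<bar>v i\<bar> = r * \<bar>t * (x i * \<psi> (x i))\<bar> / (1 - r * x i)"
        using r_pos rx[OF i] by (simp add: v_def abs_mult)
      also have "\<dots> \<le> r * (\<bar>t\<bar> * L) / (1/2)"
        using r_pos rx[OF i] t_bound[OF \<phi>_bound] x[OF i] tL L_pos
        by (intro frac_le mult_left_mono) auto
      finally show ?thesis by simp
    qed
    have rtL: "2 * r * (\<bar>t\<bar> * L) \<le> 1/2"
    proof -
      have "r * (\<bar>t\<bar> * L) \<le> 1 * (1/4)" using r1 tL r_pos L_pos by (intro mult_mono) auto
      then show ?thesis by simp
    qed
    have T_eq: "1 - r * T (x i) = (1 - r * x i) * (1 + - v i)" if i: "i \<in> {1..n}" for i
      using rx[OF i] by (simp add: T_def v_def field_simps)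
    have T_lt: "r * T (x i) < 1" if i: "i \<in> {1..n}" for i
    proof -
      have "0 < (1 - r * x i) * (1 + - v i)" using rx[OF i] v_bound[OF i] rtL by (intro mult_pos_pos) auto
      then show ?thesis using T_eq[OF i] by simp
    qed
    have single: "t * (\<phi>' (x i) + (b - 1) * \<psi> (x i) - n * (x i * \<psi> (x i))) - 2 * (\<bar>t\<bar> * L) * x i - (5 + b) * B
        \<le> ln (T' (x i)) + (b - 1) * ln (T (x i) / x i) + c * ln ((1 - n / c * T (x i)) / (1 - n / c * x i))"
      if i: "i \<in> {1..n}" for i
    proof -
      have xi: "x i \<in> {l..u}" "0 < x i" using x[OF i] by auto
      have 1: "t * \<phi>' (x i) - B \<le> ln (T' (x i))"
        unfolding B_def T'_def \<phi>'_\<Delta>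
        using t_bound[OF \<Delta>_bound[OF xi(1) xi(1)]] tL by (intro ln_one_plus_ge) auto
      have eq: "T (x i) / x i = 1 + t * \<psi> (x i)" using xi by (simp add: T_def field_simps)
      have tp: "\<bar>t * \<psi> (x i)\<bar> \<le> \<bar>t\<bar> * L" by (rule t_bound[OF \<psi>_bound[OF xi(1)]])
      have "t * \<psi> (x i) - B \<le> ln (1 + t * \<psi> (x i))"
        unfolding B_def using tp tL by (intro ln_one_plus_ge) auto
      then have "b * (t * \<psi> (x i) - B) \<le> b * ln (1 + t * \<psi> (x i))" using b by (intro mult_left_mono)
      moreover have "ln (1 + t * \<psi> (x i)) \<le> t * \<psi> (x i)"
        using tp tL by (intro ln_add_one_self_le_self2) linarith
      ultimately have 2: "(b - 1) * (t * \<psi> (x i)) - b * B \<le> (b - 1) * ln (T (x i) / x i)"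
        unfolding eq by (simp add: algebra_simps)
      have quot: "(1 - n / c * T (x i)) / (1 - n / c * x i) = 1 + - v i"
        using T_eq[OF i] rx[OF i] by (simp flip: r_def)
      have "- v i - 2 * (2 * r * (\<bar>t\<bar> * L))\<^sup>2 \<le> ln (1 + - v i)"
        using v_bound[OF i] rtL by (intro ln_one_plus_ge) auto
      then have 3: "c * (- v i - 2 * (2 * r * (\<bar>t\<bar> * L))\<^sup>2) \<le> c * ln (1 + - v i)"
        using c_pos by (intro mult_left_mono) auto
      have "c * (2 * (2 * r * (\<bar>t\<bar> * L))\<^sup>2) = 4 * (c * r * r) * B"
        by (simp add: B_def power2_eq_square)
      also have "\<dots> \<le> 4 * 1 * B" using c_r r_small(1) B by (intro mult_right_mono mult_left_mono) (auto simp: mult.commute)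
      finally have 4: "c * (2 * (2 * r * (\<bar>t\<bar> * L))\<^sup>2) \<le> 4 * B" by simp
      have cv: "c * v i = n * (t * (x i * \<psi> (x i))) + n * r * (t * (x i * \<psi> (x i))) * x i / (1 - r * x i)"
      proof -
        have "c * v i = n * (t * (x i * \<psi> (x i))) / (1 - r * x i)"
          using c_r by (simp add: v_def flip: mult.assoc)
        also have "\<dots> = n * (t * (x i * \<psi> (x i))) * (1 + r * x i / (1 - r * x i))"
          using rx[OF i] by (simp add: field_simps)
        finally show ?thesis by (simp add: algebra_simps)
      qed
      have "n * r * (t * (x i * \<psi> (x i))) * x i / (1 - r * x i) \<le> 1 * (\<bar>t\<bar> * L) * x i / (1/2)"
      proof (rule frac_le)
        have "n * r * (t * (x i * \<psi> (x i))) \<le> n * r * (\<bar>t\<bar> * L)"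
          using t_bound[OF \<phi>_bound[OF xi(1)]] r_pos by (intro mult_left_mono) auto
        also have "\<dots> \<le> 1 * (\<bar>t\<bar> * L)"
          using r_small(1) L_pos by (intro mult_right_mono) (auto simp: mult.commute)
        finally show "n * r * (t * (x i * \<psi> (x i))) * x i \<le> 1 * (\<bar>t\<bar> * L) * x i"
          using xi by (intro mult_right_mono) auto
      qed (use rx[OF i] L_pos xi in auto)
      then have 5: "c * v i \<le> n * (t * (x i * \<psi> (x i))) + 2 * (\<bar>t\<bar> * L) * x i"
        unfolding cv by simp
      show ?thesis unfolding quot
        using 1 2 3 4 5 by (simp add: algebra_simps)
    qed
    have pairs: "t * \<Delta> (x i) (x j) - B \<le> ln ((T (x i) - T (x j)) / (x i - x j))"
      if i: "i \<in> {1..n}" and j: "j \<in> {i<..n}" for i j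
    proof -
      have ne: "x i - x j \<noteq> 0" using inj_onD[OF inj, of i j] i j by auto
      have xx: "x i \<in> {l..u}" "x j \<in> {l..u}" using x i j by auto
      have "T (x i) - T (x j) = (x i - x j) + t * (x i * \<psi> (x i) - x j * \<psi> (x j))"
        by (simp add: T_def algebra_simps)
      also have "\<dots> = (1 + t * \<Delta> (x i) (x j)) * (x i - x j)"
        unfolding \<Delta>_eq[OF xx] by (simp add: algebra_simps)
      finally have "(T (x i) - T (x j)) / (x i - x j) = 1 + t * \<Delta> (x i) (x j)" using ne by simp
      moreover have "t * \<Delta> (x i) (x j) - B \<le> ln (1 + t * \<Delta> (x i) (x j))"
        unfolding B_def using t_bound[OF \<Delta>_bound[OF xx]] tL by (intro ln_one_plus_ge) auto
      ultimately show ?thesis by simp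
    qed
    define g where "g = stieltjes n z x"
    define F where "F = loop_poly \<alpha> (b / n) z g"
    have sum_inv: "(\<Sum>i=1..n. 1 / (z - x i)) = n * g" using n_pos by (simp add: g_def stieltjes_def)
    have sum_\<psi>: "(\<Sum>i=1..n. \<psi> (x i)) = w * n * g"
      unfolding mult.assoc sum_inv[symmetric] by (simp add: \<psi>_def sum_distrib_left)
    have sum_\<phi>: "(\<Sum>i=1..n. x i * \<psi> (x i)) = - w * n + w * z * n * g"
    proof -
      have "(\<Sum>i=1..n. x i * \<psi> (x i)) = (\<Sum>i=1..n. - w + w * z * (1 / (z - x i)))"
        using x \<phi>_eq by (intro sum.cong) auto
      also have "\<dots> = - w * n + w * z * (n * g)"
        unfolding sum.distrib sum_distrib_left[symmetric] sum_inv by simp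
      finally show ?thesis by simp
    qed
    have sum_\<Delta>: "2 * (\<Sum>i=1..n. \<Sum>j\<in>{i<..n}. t * \<Delta> (x i) (x j)) = t * (w * z * n\<^sup>2 * g\<^sup>2) - t * (\<Sum>i=1..n. \<phi>' (x i))"
    proof -
      have "(\<Sum>i=1..n. \<Sum>j=1..n. t * \<Delta> (x i) (x j)) = t * w * z * ((\<Sum>i=1..n. 1 / (z - x i)) * (\<Sum>i=1..n. 1 / (z - x i)))"
      proof -
        have "(\<Sum>i=1..n. \<Sum>j=1..n. t * \<Delta> (x i) (x j))
            = (\<Sum>i=1..n. \<Sum>j=1..n. t * w * z * (1 / (z - x i) * (1 / (z - x j))))"
          by (intro sum.cong refl) (simp add: \<Delta>_def)
        then show ?thesis unfolding sum_product by (simp only: sum_distrib_left)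
      qed
      then have double: "(\<Sum>i=1..n. \<Sum>j=1..n. t * \<Delta> (x i) (x j)) = t * w * z * ((n * g) * (n * g))"
        unfolding sum_inv .
      have "2 * (\<Sum>i=1..n. \<Sum>j\<in>{i<..n}. t * \<Delta> (x i) (x j))
          = (\<Sum>i=1..n. \<Sum>j=1..n. t * \<Delta> (x i) (x j)) - (\<Sum>i=1..n. t * \<Delta> (x i) (x i))"
        by (rule sum_pairs_symmetric) (simp add: \<Delta>_def mult.commute)
      moreover have "(\<Sum>i=1..n. t * \<Delta> (x i) (x i)) = t * (\<Sum>i=1..n. \<phi>' (x i))"
        by (simp only: \<phi>'_\<Delta> sum_distrib_left)
      moreover have "t * w * z * ((n * g) * (n * g)) = t * (w * z * n\<^sup>2 * g\<^sup>2)"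
        by (simp add: power2_eq_square)
      ultimately show ?thesis unfolding double by linarith
    qed
    have "(\<Sum>i=1..n. t * (\<phi>' (x i) + (b - 1) * \<psi> (x i) - n * (x i * \<psi> (x i))) - 2 * (\<bar>t\<bar> * L) * x i - (5 + b) * B)
        + 2 * \<alpha> * ((\<Sum>i=1..n. \<Sum>j\<in>{i<..n}. t * \<Delta> (x i) (x j)) - B * (real n)\<^sup>2) \<le> log_jacobian n \<alpha> b c T T' x"
      unfolding log_jacobian_def
      by (intro add_mono sum_mono single mult_left_mono sum_pairs_ge pairs B) (use \<alpha>_pos in auto)
    moreover have "(\<Sum>i=1..n. t * (\<phi>' (x i) + (b - 1) * \<psi> (x i) - n * (x i * \<psi> (x i))) - 2 * (\<bar>t\<bar> * L) * x i - (5 + b) * B)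
        = t * ((\<Sum>i=1..n. \<phi>' (x i)) + (b - 1) * (w * n * g) - n * (- w * n + w * z * n * g))
          - 2 * (\<bar>t\<bar> * L) * (\<Sum>i=1..n. x i) - n * ((5 + b) * B)"
      unfolding sum_\<psi>[symmetric] sum_\<phi>[symmetric]
      by (simp add: sum.distrib sum_subtractf sum_distrib_left right_diff_distrib distrib_left)
    moreover have "2 * \<alpha> * ((\<Sum>i=1..n. \<Sum>j\<in>{i<..n}. t * \<Delta> (x i) (x j)) - B * (real n)\<^sup>2)
        = \<alpha> * (t * (w * z * n\<^sup>2 * g\<^sup>2) - t * (\<Sum>i=1..n. \<phi>' (x i))) - 2 * \<alpha> * B * (real n)\<^sup>2"
      unfolding sum_\<Delta>[symmetric] by (simp add: algebra_simps)
    moreover have "t * ((\<Sum>i=1..n. \<phi>' (x i)) + (b - 1) * (w * n * g) - n * (- w * n + w * z * n * g))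
        + \<alpha> * (t * (w * z * n\<^sup>2 * g\<^sup>2) - t * (\<Sum>i=1..n. \<phi>' (x i)))
        = t * (n\<^sup>2 * (w * F)) + t * ((1 - \<alpha>) * (\<Sum>i=1..n. \<phi>' (x i)) - (\<Sum>i=1..n. \<psi> (x i)))"
    proof -
      have "real n * (real n * (b / real n)) = n * b" using n_pos by simp
      then have "n\<^sup>2 * (w * F) = w * (\<alpha> * z * n\<^sup>2 * g\<^sup>2 + n * b * g - z * n\<^sup>2 * g + n\<^sup>2)"
        using n_pos by (simp add: F_def loop_poly_def power2_eq_square algebra_simps)
      then show ?thesis unfolding sum_\<psi> by (simp only:) (simp add: algebra_simps power2_eq_square)
    qed
    moreover have "- (t0 * (n * L * (2 + \<alpha>))) \<le> t * ((1 - \<alpha>) * (\<Sum>i=1..n. \<phi>' (x i)) - (\<Sum>i=1..n. \<psi> (x i)))"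
    proof -
      have "\<bar>\<Sum>i=1..n. \<phi>' (x i)\<bar> \<le> n * L"
        using order_trans[OF sum_abs sum_bounded_above[of "{1..n}" "\<lambda>i. \<bar>\<phi>' (x i)\<bar>" L]] \<Delta>_bound x
        by (simp add: \<phi>'_\<Delta>)
      moreover have "\<bar>\<Sum>i=1..n. \<psi> (x i)\<bar> \<le> n * L"
        using order_trans[OF sum_abs sum_bounded_above[of "{1..n}" "\<lambda>i. \<bar>\<psi> (x i)\<bar>" L]] \<psi>_bound x
        by simp
      moreover have "\<bar>(1 - \<alpha>) * (\<Sum>i=1..n. \<phi>' (x i))\<bar> \<le> (1 + \<alpha>) * \<bar>\<Sum>i=1..n. \<phi>' (x i)\<bar>"
        unfolding abs_mult using \<alpha>_pos by (intro mult_right_mono) auto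
      moreover have "(1 + \<alpha>) * \<bar>\<Sum>i=1..n. \<phi>' (x i)\<bar> \<le> (1 + \<alpha>) * (n * L)"
        using calculation(1) \<alpha>_pos by (intro mult_left_mono) auto
      ultimately have "\<bar>(1 - \<alpha>) * (\<Sum>i=1..n. \<phi>' (x i)) - (\<Sum>i=1..n. \<psi> (x i))\<bar> \<le> n * L * (2 + \<alpha>)"
        by (simp add: algebra_simps)
      then have "\<bar>t * ((1 - \<alpha>) * (\<Sum>i=1..n. \<phi>' (x i)) - (\<Sum>i=1..n. \<psi> (x i)))\<bar> \<le> t0 * (n * L * (2 + \<alpha>))"
        unfolding abs_mult abs_t using t0_pos by (intro mult_left_mono) auto
      then show ?thesis by linarith
    qed
    moreover have "2 * (\<bar>t\<bar> * L) * (\<Sum>i=1..n. x i) \<le> 2 * (t0 * L) * (C0 * n)"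
      unfolding abs_t using Px t0_pos L_pos by (intro mult_left_mono) auto
    moreover have "n * ((5 + b) * B) + 2 * \<alpha> * B * (real n)\<^sup>2 \<le> t0\<^sup>2 * (real n)\<^sup>2 * L\<^sup>2 * C2"
    proof -
      have "b \<le> \<kappa>m * n" using b(2) n_pos by (simp add: divide_le_eq)
      then have "n * b \<le> n * (\<kappa>m * n)" by (intro mult_left_mono) auto
      moreover have "real n * 5 \<le> real n * (5 * n)" using n_pos by (intro mult_left_mono) auto
      ultimately have "n * (5 + b) + 2 * \<alpha> * (real n)\<^sup>2 \<le> (real n)\<^sup>2 * (C2 / 2)"
        by (simp add: C2 algebra_simps power2_eq_square)
      then have "(n * (5 + b) + 2 * \<alpha> * (real n)\<^sup>2) * B \<le> (real n)\<^sup>2 * (C2 / 2) * B"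
        using B by (rule mult_right_mono)
      then show ?thesis by (simp add: B_def abs_t power_mult_distrib algebra_simps)
    qed
    ultimately have lower: "t * (n\<^sup>2 * (w * F)) - t0 * (n * L * C1) - t0\<^sup>2 * (real n)\<^sup>2 * L\<^sup>2 * C2
        \<le> log_jacobian n \<alpha> b c T T' x"
      by (simp add: C1 algebra_simps)
    have "t0 * (n\<^sup>2 * s) \<le> t0 * (n\<^sup>2 * (\<epsilon> * (w * F)))"
      using Px t0_pos by (intro mult_left_mono) (auto simp: F_def g_def)
    then have 6: "t0 * (n\<^sup>2 * s) \<le> t * (n\<^sup>2 * (w * F))" by (simp add: t_def mult_ac)
    have 7: "t0 * (n * L * C1) \<le> t0 * (n\<^sup>2 * s / 2)"
    proof -
      have "2 * C1 * L \<le> s * n" using s(1) n_pos by (simp add: divide_le_eq)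
      then have "n * (2 * C1 * L) \<le> n * (s * n)" by (intro mult_left_mono) auto
      then show ?thesis using t0_pos by (intro mult_left_mono) (auto simp: power2_eq_square mult_ac)
    qed
    have "t0 * (n\<^sup>2 * s) - t0 * (n\<^sup>2 * s / 2) - t0\<^sup>2 * (real n)\<^sup>2 * L\<^sup>2 * C2 = ?K"
      using L_pos C2_pos by (simp add: t0_def field_simps power2_eq_square)
    then have "?K \<le> log_jacobian n \<alpha> b c T T' x" using lower 6 7 by linarith
    then show "(\<forall>i\<in>{1..n}. 0 < T (x i) \<and> r * T (x i) < 1) \<and> ?K \<le> log_jacobian n \<alpha> b c T T' x"
      using T_pos T_lt by blast
  qed
  then show ?thesis unfolding stieltjes_restrict conj_assoc by simp
qed

end

section \<open>Moving the particles near an edge\<close>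

lemma has_real_derivative_max_power:
  fixes y :: real
  shows "((\<lambda>y. max 0 y ^ Suc (Suc k)) has_real_derivative real (Suc (Suc k)) * max 0 y ^ Suc k) (at y)"
proof -
  consider "y > 0" | "y < 0" | "y = 0" by linarith
  then show ?thesis
  proof cases
    case 1
    have "((\<lambda>y. y ^ Suc (Suc k)) has_real_derivative real (Suc (Suc k)) * max 0 y ^ Suc k) (at y)"
      using DERIV_pow[of "Suc (Suc k)" y UNIV] 1 by simp
    then show ?thesis
      by (rule has_field_derivative_transform_within_open[of _ _ _ "{0<..}"]) (use 1 in auto)
  next
    case 2
    have "((\<lambda>y. 0) has_real_derivative real (Suc (Suc k)) * max 0 y ^ Suc k) (at y)"
      using 2 by (simp add: max_def)
    then show ?thesis
      by (rule has_field_derivative_transform_within_open[of _ _ _ "{..<0}"]) (use 2 in auto)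
  next
    case 3
    have "(\<lambda>h. max 0 h ^ Suc (Suc k) / h) \<midarrow>0\<rightarrow> (0::real)"
    proof (rule Lim_null_comparison[where g = "\<lambda>h. \<bar>h\<bar> ^ Suc k"])
      show "\<forall>\<^sub>F h in at 0. norm (max 0 h ^ Suc (Suc k) / h :: real) \<le> \<bar>h\<bar> ^ Suc k"
        by (rule always_eventually) (auto simp: max_def abs_mult mult_nonpos_nonneg)
      have "(\<lambda>h::real. \<bar>h\<bar> ^ Suc k) \<midarrow>0\<rightarrow> \<bar>0\<bar> ^ Suc k" by (intro tendsto_intros)
      then show "(\<lambda>h::real. \<bar>h\<bar> ^ Suc k) \<midarrow>0\<rightarrow> 0" by simp
    qed
    then show ?thesis using 3 by (simp add: DERIV_def)
  qed
qed

lemma power_Suc_diff_le: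
  fixes x y :: real
  assumes "0 \<le> y" "y \<le> x"
  shows "x ^ Suc k - y ^ Suc k \<le> real (Suc k) * x ^ k * (x - y)"
proof (induction k)
  case (Suc k)
  have "x ^ Suc (Suc k) - y ^ Suc (Suc k) = x * (x ^ Suc k - y ^ Suc k) + y ^ Suc k * (x - y)"
    by (simp add: algebra_simps)
  also have "\<dots> \<le> x * (real (Suc k) * x ^ k * (x - y)) + x ^ Suc k * (x - y)"
    using assms Suc.IH by (intro add_mono mult_left_mono mult_right_mono power_mono) auto
  finally show ?case by (simp add: algebra_simps)
qed simp

lemma ln_one_minus_ge:
  fixes v :: real
  assumes "0 \<le> v" "v \<le> B" "B \<le> 1/2"
  shows "- (1 + 2 * B) * v \<le> ln (1 - v)"
proof -
  have "- v - 2 * v\<^sup>2 \<le> ln (1 - v)" using assms by (intro ln_one_minus_pos_lower_bound) auto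
  moreover have "v * v \<le> B * v" using assms by (intro mult_right_mono)
  ultimately show ?thesis by (simp add: power2_eq_square algebra_simps)
qed

text \<open>
  The displacement of a particle at distance \<open>d\<close> from \<open>z\<close> is a power of this function. It vanishes for \<open>d \<ge> 3 h\<close>
  and lies in \<open>[1, 2]\<close> for the particles with \<open>h \<le> d \<le> 2 h\<close>.
\<close>

definition ramp :: "real \<Rightarrow> real \<Rightarrow> real" where
  "ramp h d = max 0 ((3 * h - d) / h)"

text \<open>
  The factor of the error term in \<open>crowd_cost\<close>.
\<close>

definition crowd_const :: "real \<Rightarrow> real \<Rightarrow> real" where
  "crowd_const \<alpha> M = 12 * \<alpha> * M + (1 + 2 * \<alpha>) * (612 * M * (1 + 36 * M))"

lemma ramp_bounds:
  assumes "0 < h" "h \<le> d" shows "0 \<le> ramp h d" "ramp h d \<le> 2"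
  using assms by (auto simp: ramp_def field_simps)

lemma ramp_slope_bounds:
  assumes h: "0 < h" and d: "h \<le> d1" "h \<le> d2"
  defines "q \<equiv> (ramp h d1 ^ 17 - ramp h d2 ^ 17) / (d2 - d1)"
  shows "0 \<le> q" and "q \<le> 17 / h * max (ramp h d1) (ramp h d2) ^ 16"
proof -
  have *: "0 \<le> (ramp h x ^ 17 - ramp h y ^ 17) / (y - x) \<and>
      (ramp h x ^ 17 - ramp h y ^ 17) / (y - x) \<le> 17 / h * ramp h x ^ 16"
    if xy: "h \<le> x" "x < y" for x y
  proof -
    have le: "ramp h y \<le> ramp h x" "0 \<le> ramp h y"
      using xy h by (auto simp: ramp_def field_simps max_def)
    have "ramp h x - ramp h y \<le> (y - x) / h"
      using xy h by (auto simp: ramp_def max_def field_simps)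
    then have "17 * ramp h x ^ 16 * (ramp h x - ramp h y) \<le> 17 * ramp h x ^ 16 * ((y - x) / h)"
      using le by (intro mult_left_mono) auto
    moreover have "ramp h x ^ 17 - ramp h y ^ 17 \<le> 17 * ramp h x ^ 16 * (ramp h x - ramp h y)"
      using power_Suc_diff_le[OF le(2,1), of 16] by simp
    ultimately have "ramp h x ^ 17 - ramp h y ^ 17 \<le> 17 / h * ramp h x ^ 16 * (y - x)"
      by (simp add: field_simps)
    moreover have "0 \<le> ramp h x ^ 17 - ramp h y ^ 17" using le by (simp add: power_mono)
    ultimately show ?thesis using xy by (simp add: divide_le_eq)
  qed
  have mono: "d1 \<le> d2 \<Longrightarrow> ramp h d2 \<le> ramp h d1" "d2 \<le> d1 \<Longrightarrow> ramp h d1 \<le> ramp h d2"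
    using h by (auto simp: ramp_def divide_right_mono max.coboundedI2)
  have r0: "0 \<le> ramp h d1" "0 \<le> ramp h d2" using ramp_bounds h d by auto
  consider "d1 < d2" | "d2 < d1" | "d1 = d2" by linarith
  then have "0 \<le> q \<and> q \<le> 17 / h * max (ramp h d1) (ramp h d2) ^ 16"
  proof cases
    case 1
    then show ?thesis using *[OF d(1) 1] mono(1) by (simp add: q_def max_absorb1)
  next
    case 2
    have "q = (ramp h d2 ^ 17 - ramp h d1 ^ 17) / (d1 - d2)"
      unfolding q_def by (metis minus_diff_eq minus_divide_divide)
    then show ?thesis using *[OF d(2) 2] mono(2) 2 by (simp add: max_absorb2)
  next
    case 3
    then show ?thesis using h r0 by (simp add: q_def)
  qed
  then show "0 \<le> q" "q \<le> 17 / h * max (ramp h d1) (ramp h d2) ^ 16" by auto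
qed

text \<open>
  The displacement \<open>v\<^sup>1\<^sup>7\<close> of particle \<open>i\<close> brings it closer to every particle behind it. For a particle \<open>j\<close> with
  \<open>d j \<ge> 6 h\<close> the cost is the displacement divided by about \<open>d j\<close>, and these add up to \<open>n G\<close>. The nearer
  particles are handled by the slope \<open>17 v\<^sup>1\<^sup>6 / h\<close> of the displacement; there are at most \<open>36 h\<^sup>2 n M\<close> of them
  because each contributes at least \<open>1/(36 h\<^sup>2)\<close> to the second moment. The slope is not bounded by the
  displacement when \<open>v\<close> is small, hence the split \<open>v\<^sup>1\<^sup>6 \<le> v\<^sup>1\<^sup>7/e + e\<^sup>1\<^sup>6\<close>. The exponent 17 makes the last
  term, summed over all near pairs, at most \<open>O(n h)\<close> for \<open>n e\<^sup>2\<^sup>0 = 1\<close>.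
\<close>

lemma crowd_cost:
  fixes d :: "nat \<Rightarrow> real"
  assumes e: "0 < e" "e \<le> 1" "real n * e ^ 20 = 1" and h: "h = e\<^sup>2" and \<alpha>: "0 < \<alpha>"
    and d: "\<And>i. i \<in> {1..n} \<Longrightarrow> h \<le> d i"
    and near: "\<exists>i\<in>{1..n}. d i \<le> 2 * h"
    and M: "(\<Sum>i=1..n. 1 / (d i)\<^sup>2) \<le> M * n" and G: "(\<Sum>i=1..n. 1 / d i) \<le> G * n"
  defines "\<Phi> \<equiv> (\<Sum>i=1..n. ramp h (d i) ^ 17)"
  shows "1 \<le> \<Phi>"
    and "(\<Sum>i=1..n. 17 / h * ramp h (d i) ^ 16)
       + 2 * \<alpha> * (\<Sum>i=1..n. \<Sum>j\<in>{i<..n}. (ramp h (d i) ^ 17 - ramp h (d j) ^ 17) / (d j - d i))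
       \<le> n * \<Phi> * (2 * \<alpha> * G + crowd_const \<alpha> M * e)"
proof -
  define v where "v i = ramp h (d i)" for i
  have h_pos: "0 < h" and h_e: "h \<le> e" using e by (auto simp: h power2_eq_square mult_left_le)
  have v: "0 \<le> v i" "v i \<le> 2" if "i \<in> {1..n}" for i using ramp_bounds[OF h_pos d[OF that]] by (auto simp: v_def)
  define N where "N = {j\<in>{1..n}. d j < 6 * h}"
  have N: "finite N" "N \<subseteq> {1..n}" by (auto simp: N_def)
  have v_far: "v i = 0" if "d i \<ge> 3 * h" for i
    using that h_pos by (auto simp: v_def ramp_def field_simps max_def)
  obtain i0 where i0: "i0 \<in> {1..n}" "d i0 \<le> 2 * h" using near by blast
  have n_pos: "0 < n" using i0 by auto
  have "1 \<le> v i0" using i0 h_pos by (auto simp: v_def ramp_def field_simps max_def)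
  then have "1 \<le> v i0 ^ 17" by (rule one_le_power)
  also have "\<dots> \<le> (\<Sum>i=1..n. v i ^ 17)" using i0 v by (intro member_le_sum) auto
  finally show \<Phi>1: "1 \<le> \<Phi>" by (simp add: \<Phi>_def v_def)
  have M_nonneg: "0 \<le> M"
  proof -
    have "0 \<le> (\<Sum>i=1..n. 1 / (d i)\<^sup>2)" by (intro sum_nonneg) auto
    then have "0 \<le> M * n" using M by linarith
    then show ?thesis using n_pos by (simp add: zero_le_mult_iff)
  qed
  have "i0 \<in> N" using i0 h_pos by (auto simp: N_def)
  then have "0 < card N" using N(1) by (auto simp: card_gt_0_iff)
  then have N1: "1 \<le> real (card N)" by simp
  have N_le: "real (card N) \<le> 36 * h\<^sup>2 * n * M"
  proof -
    have "(\<Sum>i\<in>N. 1 / (36 * h\<^sup>2)) \<le> (\<Sum>i\<in>N. 1 / (d i)\<^sup>2)"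
    proof (rule sum_mono)
      fix i assume i: "i \<in> N"
      then have di: "d i \<le> 6 * h" "0 < d i" using d[of i] h_pos by (auto simp: N_def)
      then have "(d i)\<^sup>2 \<le> (6 * h)\<^sup>2" by (intro power_mono) auto
      then show "1 / (36 * h\<^sup>2) \<le> 1 / (d i)\<^sup>2"
        using di h_pos by (intro divide_left_mono) (auto simp: power_mult_distrib)
    qed
    also have "\<dots> \<le> (\<Sum>i=1..n. 1 / (d i)\<^sup>2)" using N by (intro sum_mono2) auto
    also have "\<dots> \<le> M * n" by (rule M)
    finally show ?thesis using h_pos by (simp add: field_simps)
  qed
  define V where "V = (\<Sum>i=1..n. v i ^ 16)"
  have V_le: "V \<le> \<Phi> / e + 36 * h\<^sup>2 * n * M * e ^ 16"
  proof -
    have "V \<le> (\<Sum>i=1..n. v i ^ 17 / e + (if i \<in> N then e ^ 16 else 0))"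
      unfolding V_def
    proof (rule sum_mono)
      fix i assume i: "i \<in> {1..n}"
      show "v i ^ 16 \<le> v i ^ 17 / e + (if i \<in> N then e ^ 16 else 0)"
      proof (cases "i \<in> N")
        case False
        then have "v i = 0" using i h_pos by (intro v_far) (auto simp: N_def)
        then show ?thesis using False by simp
      next
        case True
        show ?thesis
        proof (cases "e \<le> v i")
          case True
          then have "e * v i ^ 16 \<le> v i * v i ^ 16" using v[OF i] by (intro mult_right_mono) auto
          then have "v i ^ 16 \<le> v i ^ 17 / e" using e by (simp add: le_divide_eq mult.commute flip: power_Suc)
          then show ?thesis using e by (simp add: add_increasing2)
        next
          case False
          then have "v i ^ 16 \<le> e ^ 16" using v[OF i] by (intro power_mono) auto
          moreover have "0 \<le> v i ^ 17 / e" using v[OF i] e by auto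
          ultimately show ?thesis using \<open>i \<in> N\<close> by simp
        qed
      qed
    qed
    also have "\<dots> = \<Phi> / e + card N * e ^ 16"
    proof -
      have "(\<Sum>i=1..n. if i \<in> N then e ^ 16 else 0) = (\<Sum>i\<in>N. e ^ 16)"
        using N by (simp add: sum.If_cases Int_absorb1)
      then show ?thesis by (simp add: sum.distrib \<Phi>_def v_def flip: sum_divide_distrib)
    qed
    also have "\<dots> \<le> \<Phi> / e + 36 * h\<^sup>2 * n * M * e ^ 16"
      using N_le e by (intro add_left_mono mult_right_mono) auto
    finally show ?thesis .
  qed
  have V_nonneg: "0 \<le> V" unfolding V_def using v by (intro sum_nonneg) auto
  have crowd: "card N * (17 / h * V) \<le> n * \<Phi> * (612 * M * (1 + 36 * M) * e)"
  proof -
    have "card N * (17 / h * V) \<le> 36 * h\<^sup>2 * n * M * (17 / h * V)"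
      using N_le h_pos V_nonneg by (intro mult_right_mono) auto
    also have "\<dots> = 612 * M * n * (h * V)" using h_pos by (simp add: power2_eq_square)
    also have "\<dots> \<le> 612 * M * n * (e * \<Phi> * (1 + 36 * M))"
    proof (intro mult_left_mono)
      have "h * V \<le> h * (\<Phi> / e + 36 * h\<^sup>2 * n * M * e ^ 16)" using V_le h_pos by (intro mult_left_mono) auto
      also have "\<dots> = e * \<Phi> + 36 * M * h * (n * e ^ 20)"
      proof -
        have "h\<^sup>2 * e ^ 16 = e ^ 20" by (simp add: h flip: power_mult power_add)
        moreover have "h * (\<Phi> / e) = e * \<Phi>" using e by (simp add: h power2_eq_square)
        moreover have "h * (\<Phi> / e + 36 * h\<^sup>2 * n * M * e ^ 16) = h * (\<Phi> / e) + 36 * M * h * (n * (h\<^sup>2 * e ^ 16))"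
          by (simp add: algebra_simps)
        ultimately show ?thesis by simp
      qed
      also have "\<dots> = e * \<Phi> + 36 * M * h" unfolding e(3) by simp
      also have "36 * M * h \<le> 36 * M * (e * \<Phi>)"
        using M_nonneg h_e \<Phi>1 e by (intro mult_left_mono) (auto intro: order_trans)
      finally show "h * V \<le> e * \<Phi> * (1 + 36 * M)" by (simp add: algebra_simps)
    qed (use M_nonneg in auto)
    finally show ?thesis by (simp add: mult_ac)
  qed
  \<comment> \<open>the cost of a pair, charged to the particle with the larger displacement\<close>
  define p where "p i j = (if j \<in> N then 17 / h * v i ^ 16 else v i ^ 17 * (1 / d j + 6 * h / (d j)\<^sup>2))" for i j
  let ?q = "\<lambda>i j. (v i ^ 17 - v j ^ 17) / (d j - d i)"
  have p_nonneg: "0 \<le> p i j" if "i \<in> {1..n}" "j \<in> {1..n}" for i j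
    using v[OF that(1)] d[OF that(2)] h_pos by (auto simp: p_def)
  have q_le: "?q i j \<le> p i j" if ij: "i \<in> {1..n}" "j \<in> {1..n}" and le: "d i \<le> d j" for i j
  proof (cases "j \<in> N")
    case True
    have "v j \<le> v i" using le h_pos by (auto simp: v_def ramp_def divide_right_mono max.coboundedI2)
    then show ?thesis
      using ramp_slope_bounds(2)[OF h_pos d[OF ij(1)] d[OF ij(2)]] True
      by (simp add: p_def v_def max_absorb1)
  next
    case False
    then have far: "6 * h \<le> d j" using ij by (auto simp: N_def)
    then have vj: "v j = 0" using h_pos by (intro v_far) simp
    show ?thesis
    proof (cases "d i < 3 * h")
      case False
      then have "v i = 0" by (intro v_far) simp
      then show ?thesis using vj \<open>j \<notin> N\<close> by (simp add: p_def)
    next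
      case True
      have pos: "0 < d j" "0 < d j - d i" "d j / 2 \<le> d j - d i" using far True h_pos by auto
      have "1 / (d j - d i) = 1 / d j + d i / (d j * (d j - d i))" using pos by (simp add: field_simps)
      also have "d i / (d j * (d j - d i)) \<le> 3 * h / (d j * (d j / 2))"
        using pos True d[OF ij(1)] h_pos by (intro frac_le mult_left_mono) auto
      finally have "1 / (d j - d i) \<le> 1 / d j + 6 * h / (d j)\<^sup>2" by (simp add: power2_eq_square)
      then have "v i ^ 17 * (1 / (d j - d i)) \<le> v i ^ 17 * (1 / d j + 6 * h / (d j)\<^sup>2)"
        using v[OF ij(1)] by (intro mult_left_mono) auto
      then show ?thesis using vj \<open>j \<notin> N\<close> by (simp add: p_def)
    qed
  qed
  have q_le_sym: "?q i j \<le> p i j + p j i" if ij: "i \<in> {1..n}" "j \<in> {1..n}" for i j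
  proof (cases "d i \<le> d j")
    case True
    then show ?thesis using q_le[OF ij] p_nonneg[OF ij(2,1)] by linarith
  next
    case False
    moreover have "?q i j = ?q j i" by (metis minus_diff_eq minus_divide_divide)
    ultimately show ?thesis using q_le[OF ij(2,1)] p_nonneg[OF ij] by linarith
  qed
  have pairs: "(\<Sum>i=1..n. \<Sum>j\<in>{i<..n}. ?q i j) \<le> (\<Sum>i=1..n. \<Sum>j=1..n. p i j)"
  proof -
    have "(\<Sum>i=1..n. \<Sum>j\<in>{i<..n}. ?q i j) \<le> (\<Sum>i=1..n. \<Sum>j\<in>{i<..n}. p i j + p j i)"
      by (intro sum_mono q_le_sym) auto
    moreover have "2 * (\<Sum>i=1..n. \<Sum>j\<in>{i<..n}. p i j + p j i)
        = (\<Sum>i=1..n. \<Sum>j=1..n. p i j + p j i) - (\<Sum>i=1..n. p i i + p i i)"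
      by (rule sum_pairs_symmetric) simp
    moreover have "(\<Sum>i=1..n. \<Sum>j=1..n. p i j + p j i) = 2 * (\<Sum>i=1..n. \<Sum>j=1..n. p i j)"
      unfolding sum.distrib using sum.swap[of p "{1..n}" "{1..n}"] by simp
    moreover have "0 \<le> (\<Sum>i=1..n. p i i + p i i)" using p_nonneg by (intro sum_nonneg) auto
    ultimately show ?thesis by linarith
  qed
  have inner: "(\<Sum>j=1..n. p i j) \<le> card N * (17 / h * v i ^ 16) + v i ^ 17 * (n * (G + 6 * h * M))"
    if i: "i \<in> {1..n}" for i
  proof -
    have "(\<Sum>j=1..n. p i j) \<le> (\<Sum>j=1..n. (if j \<in> N then 17 / h * v i ^ 16 else 0)
        + v i ^ 17 * (1 / d j + 6 * h * (1 / (d j)\<^sup>2)))"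
    proof (rule sum_mono)
      fix j assume "j \<in> {1..n}"
      then have "0 \<le> v i ^ 17 * (1 / d j + 6 * h * (1 / (d j)\<^sup>2))" using d[of j] h_pos v[OF i] by auto
      then show "p i j \<le> (if j \<in> N then 17 / h * v i ^ 16 else 0) + v i ^ 17 * (1 / d j + 6 * h * (1 / (d j)\<^sup>2))"
        by (simp add: p_def)
    qed
    also have "\<dots> = card N * (17 / h * v i ^ 16)
        + v i ^ 17 * ((\<Sum>j=1..n. 1 / d j) + 6 * h * (\<Sum>j=1..n. 1 / (d j)\<^sup>2))"
    proof -
      have "(\<Sum>j=1..n. if j \<in> N then 17 / h * v i ^ 16 else 0) = card N * (17 / h * v i ^ 16)"
        using N by (simp add: sum.If_cases Int_absorb1)
      then show ?thesis by (simp only: sum.distrib sum_distrib_left[symmetric])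
    qed
    also have "\<dots> \<le> card N * (17 / h * v i ^ 16) + v i ^ 17 * (G * n + 6 * h * (M * n))"
      using M G h_pos v[OF i] by (intro add_left_mono mult_left_mono add_mono) auto
    finally show ?thesis by (simp add: algebra_simps)
  qed
  have "(\<Sum>i=1..n. \<Sum>j=1..n. p i j)
      \<le> (\<Sum>i=1..n. card N * (17 / h * v i ^ 16) + v i ^ 17 * (n * (G + 6 * h * M)))"
    by (rule sum_mono[OF inner])
  also have "\<dots> = card N * (17 / h * V) + \<Phi> * (n * (G + 6 * h * M))"
    by (simp only: sum.distrib sum_distrib_left[symmetric] sum_distrib_right[symmetric] V_def \<Phi>_def v_def)
  finally have "(\<Sum>i=1..n. \<Sum>j=1..n. p i j) \<le> card N * (17 / h * V) + \<Phi> * (n * (G + 6 * h * M))" .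
  with pairs have "2 * \<alpha> * (\<Sum>i=1..n. \<Sum>j\<in>{i<..n}. ?q i j)
      \<le> 2 * \<alpha> * (card N * (17 / h * V) + \<Phi> * (n * (G + 6 * h * M)))"
    using \<alpha> by (intro mult_left_mono) auto
  moreover have "(\<Sum>i=1..n. 17 / h * v i ^ 16) \<le> card N * (17 / h * V)"
  proof -
    have "1 * (17 / h * V) \<le> card N * (17 / h * V)" using N1 h_pos V_nonneg by (intro mult_right_mono) auto
    then show ?thesis by (simp add: V_def sum_distrib_left)
  qed
  moreover have "(1 + 2 * \<alpha>) * (card N * (17 / h * V)) \<le> (1 + 2 * \<alpha>) * (n * \<Phi> * (612 * M * (1 + 36 * M) * e))"
    using crowd \<alpha> by (intro mult_left_mono) auto
  moreover have "2 * \<alpha> * (\<Phi> * (n * (G + 6 * h * M))) \<le> 2 * \<alpha> * (\<Phi> * (n * (G + 6 * e * M)))"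
    using h_e M_nonneg \<alpha> \<Phi>1 by (intro mult_left_mono add_left_mono mult_right_mono) auto
  moreover have "S1 + 2 * \<alpha> * S2 \<le> n * \<Phi> * (2 * \<alpha> * G + crowd_const \<alpha> M * e)"
    if "2 * \<alpha> * S2 \<le> 2 * \<alpha> * (W + \<Phi> * (n * (G + 6 * h * M)))" "S1 \<le> W"
      "(1 + 2 * \<alpha>) * W \<le> (1 + 2 * \<alpha>) * (n * \<Phi> * (612 * M * (1 + 36 * M) * e))"
      "2 * \<alpha> * (\<Phi> * (n * (G + 6 * h * M))) \<le> 2 * \<alpha> * (\<Phi> * (n * (G + 6 * e * M)))" for S1 S2 W :: real
    using that by (simp add: crowd_const_def algebra_simps)
  ultimately show "(\<Sum>i=1..n. 17 / h * ramp h (d i) ^ 16)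
       + 2 * \<alpha> * (\<Sum>i=1..n. \<Sum>j\<in>{i<..n}. (ramp h (d i) ^ 17 - ramp h (d j) ^ 17) / (d j - d i))
       \<le> n * \<Phi> * (2 * \<alpha> * G + crowd_const \<alpha> M * e)"
    unfolding v_def[symmetric] by blast
qed

context jacobi_particles
begin

lemma exists_near_pred:
  fixes \<sigma> z k :: real
  shows "Measurable.pred (\<Pi>\<^sub>M i\<in>{1..n}. borel) (\<lambda>x. \<exists>i\<in>{1..n}. \<sigma> * (z - x i) \<le> k)"
  by (rule pred_intros_finite) (auto intro!: borel_measurable_le[THEN iffD1[OF refl]] simp: pred_def)

text \<open>
  The two edges are treated together: \<open>\<sigma> = 1\<close> means that the particles lie below \<open>z\<close>, \<open>\<sigma> = - 1\<close> that they lie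
  above \<open>z\<close>. The displacement has size \<open>h\<^sup>2\<close>, so that its slope is \<open>O(h)\<close> and all logarithms are linear up to
  a factor \<open>1 + O(h)\<close>. The number \<open>\<theta>\<close> is a lower bound for the external force towards the bulk per
  particle, in units of \<open>n\<close>; it has to exceed the repulsion \<open>2 \<alpha> G\<close> from the bulk by a margin.
\<close>

lemma edge_move:
  fixes z h e \<sigma> l u \<theta> Q G \<eta> :: real
  assumes e: "0 < e" "e \<le> 1" "real n * e ^ 20 = 1" and h: "h = e\<^sup>2" and h_small: "17 * 2 ^ 17 * h \<le> 1"
    and \<sigma>: "\<sigma> = 1 \<or> \<sigma> = - 1" and side: "\<And>x. x \<in> {l..u} \<Longrightarrow> h \<le> \<sigma> * (z - x)"
  defines "T \<equiv> \<lambda>x. x - \<sigma> * (h\<^sup>2 * ramp h (\<sigma> * (z - x)) ^ 17)"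
  assumes force: "\<And>x. x \<in> {l..u} \<Longrightarrow> 0 < x \<Longrightarrow> r * x < 1 \<Longrightarrow> \<sigma> * (z - x) < 3 * h \<Longrightarrow>
      0 < T x \<and> r * T x < 1 \<and>
      n * h\<^sup>2 * ramp h (\<sigma> * (z - x)) ^ 17 * \<theta> \<le> (b - 1) * ln (T x / x) + c * ln ((1 - r * T x) / (1 - r * x))"
    and margin: "(1 + 17 * 2 ^ 17 * h) * (2 * \<alpha> * G + crowd_const \<alpha> Q * e) + \<eta> \<le> \<theta>" and \<eta>: "0 \<le> \<eta>"
  shows "prob {\<omega>\<in>space M. ((\<exists>i\<in>{1..n}. \<sigma> * (z - Y i \<omega>) \<le> 2 * h) \<and> (\<Sum>i=1..n. 1 / (z - Y i \<omega>)\<^sup>2) \<le> Q * n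
      \<and> \<sigma> * stieltjes n z (\<lambda>i. Y i \<omega>) \<le> G) \<and> (\<forall>i\<in>{1..n}. Y i \<omega> \<in> {l..u})} \<le> exp (- (n * h\<^sup>2 * \<eta>))"
proof -
  define v where "v x = ramp h (\<sigma> * (z - x))" for x
  define T' where "T' x = 1 - h\<^sup>2 * (17 / h * v x ^ 16)" for x
  define B where "B = 17 * 2 ^ 16 * h"
  have h_pos: "0 < h" using e by (simp add: h)
  have B: "0 \<le> B" "B \<le> 1/2" using h_pos h_small by (auto simp: B_def)
  have \<sigma>2: "\<sigma> * \<sigma> = 1" using \<sigma> by auto
  have v: "0 \<le> v x" "v x \<le> 2" if "x \<in> {l..u}" for x
    using ramp_bounds[OF h_pos side[OF that]] by (auto simp: v_def)
  have small: "h\<^sup>2 * (17 / h * y ^ 16) \<le> B" if "0 \<le> y" "y \<le> 2" for y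
  proof -
    have "y ^ 16 \<le> 2 ^ 16" using that by (rule power_mono[rotated])
    then have "17 * h * y ^ 16 \<le> 17 * h * 2 ^ 16" using h_pos by (intro mult_left_mono) auto
    then show ?thesis using h_pos by (simp add: B_def power2_eq_square mult_ac)
  qed
  let ?P = "\<lambda>x. (\<exists>i\<in>{1..n}. \<sigma> * (z - x i) \<le> 2 * h) \<and> (\<Sum>i=1..n. 1 / (z - x i)\<^sup>2) \<le> Q * n
      \<and> \<sigma> * stieltjes n z x \<le> G"
  note [measurable] = exists_near_pred[where \<sigma> = \<sigma> and z = z and k = "2 * h"]
  have P: "Measurable.pred (\<Pi>\<^sub>M i\<in>{1..n}. borel) ?P" by measurable
  have "prob {\<omega>\<in>space M. ?P (\<lambda>i\<in>{1..n}. Y i \<omega>) \<and> (\<forall>i\<in>{1..n}. Y i \<omega> \<in> {l..u})} \<le> exp (- (n * h\<^sup>2 * \<eta>))"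
  proof (rule flow_bound[where T = T and T' = T', OF _ _ _ _ _ P])
    show "T \<in> borel_measurable borel" "T' \<in> borel_measurable borel"
      unfolding T_def T'_def[abs_def] v_def ramp_def by measurable
    show "continuous_on {l..u} T'"
      unfolding T'_def[abs_def] v_def ramp_def by (intro continuous_intros) (use h_pos in auto)
    show "(T has_real_derivative T' x) (at x)" for x
    proof -
      have "((\<lambda>x. (3 * h - \<sigma> * (z - x)) / h) has_real_derivative \<sigma> / h) (at x)"
        by (rule derivative_eq_intros refl | use h_pos in simp)+
      from DERIV_chain2[OF has_real_derivative_max_power[of 15] this]
      have "((\<lambda>x. ramp h (\<sigma> * (z - x)) ^ 17) has_real_derivative 17 * v x ^ 16 * (\<sigma> / h)) (at x)"
        by (simp add: ramp_def v_def)
      then have "(T has_real_derivative 1 - \<sigma> * (h\<^sup>2 * (17 * v x ^ 16 * (\<sigma> / h)))) (at x)"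
        unfolding T_def by (intro DERIV_diff DERIV_ident DERIV_cmult)
      moreover have "\<sigma> * (h\<^sup>2 * (17 * v x ^ 16 * (\<sigma> / h))) = (\<sigma> * \<sigma>) * (h\<^sup>2 * (17 / h * v x ^ 16))" by simp
      ultimately show ?thesis unfolding T'_def by (simp only: \<sigma>2 mult_1_left)
    qed
    show "0 < T' x" if "x \<in> {l..u}" for x
      using small[OF v[OF that]] B by (simp add: T'_def)
    fix x :: "nat \<Rightarrow> real"
    assume Px: "?P x" and x: "\<And>i. i \<in> {1..n} \<Longrightarrow> x i \<in> {l..u} \<and> 0 < x i \<and> r * x i < 1"
      and inj: "inj_on x {1..n}"
    define d where "d i = \<sigma> * (z - x i)" for i
    have vd: "v (x i) = ramp h (d i)" for i by (simp add: v_def d_def)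
    have d_ge: "h \<le> d i" if "i \<in> {1..n}" for i using side x that by (simp add: d_def)
    define \<Phi> where "\<Phi> = (\<Sum>i=1..n. v (x i) ^ 17)"
    define A where "A = (\<Sum>i=1..n. 17 / h * v (x i) ^ 16)"
    define q where "q i j = (v (x i) ^ 17 - v (x j) ^ 17) / (d j - d i)" for i j
    have "(d i)\<^sup>2 = (z - x i)\<^sup>2" for i using \<sigma> by (auto simp: d_def power2_eq_square algebra_simps)
    then have Q: "(\<Sum>i=1..n. 1 / (d i)\<^sup>2) \<le> Q * n" using Px by simp
    have "1 / d i = \<sigma> * (1 / (z - x i))" for i using \<sigma> by (auto simp: d_def divide_simps)
    then have "(\<Sum>i=1..n. 1 / d i) = \<sigma> * (\<Sum>i=1..n. 1 / (z - x i))" by (simp add: sum_distrib_left)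
    also have "\<dots> = \<sigma> * stieltjes n z x * n" using n_pos by (simp add: stieltjes_def)
    also have "\<dots> \<le> G * n" using Px by (intro mult_right_mono) auto
    finally have G: "(\<Sum>i=1..n. 1 / d i) \<le> G * n" .
    have near: "\<exists>i\<in>{1..n}. d i \<le> 2 * h" using Px by (simp add: d_def)
    note crowd = crowd_cost[OF e h \<alpha>_pos d_ge near Q G]
    have \<Phi>1: "1 \<le> \<Phi>" using crowd(1) by (simp add: \<Phi>_def vd)
    have cost: "A + 2 * \<alpha> * (\<Sum>i=1..n. \<Sum>j\<in>{i<..n}. q i j) \<le> n * \<Phi> * (2 * \<alpha> * G + crowd_const \<alpha> Q * e)"
      using crowd(2) by (simp add: A_def \<Phi>_def q_def vd)
    have single: "- ((1 + 2 * B) * (h\<^sup>2 * (17 / h * v (x i) ^ 16))) + n * h\<^sup>2 * v (x i) ^ 17 * \<theta>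
        \<le> ln (T' (x i)) + (b - 1) * ln (T (x i) / x i) + c * ln ((1 - n / c * T (x i)) / (1 - n / c * x i))"
      and T_in: "0 < T (x i) \<and> r * T (x i) < 1" if i: "i \<in> {1..n}" for i
    proof -
      have xi: "x i \<in> {l..u}" "0 < x i" "r * x i < 1" using x[OF i] by auto
      have *: "0 < T (x i) \<and> r * T (x i) < 1 \<and> n * h\<^sup>2 * v (x i) ^ 17 * \<theta>
           \<le> (b - 1) * ln (T (x i) / x i) + c * ln ((1 - r * T (x i)) / (1 - r * x i))"
      proof (cases "\<sigma> * (z - x i) < 3 * h")
        case True
        then show ?thesis using force[OF xi] by (simp add: v_def)
      next
        case False
        then have "v (x i) = 0" using h_pos by (simp add: v_def ramp_def max_def field_simps)
        then have "T (x i) = x i" by (simp add: T_def v_def)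
        then show ?thesis using xi \<open>v (x i) = 0\<close> by simp
      qed
      then show "0 < T (x i) \<and> r * T (x i) < 1" by blast
      have "- (1 + 2 * B) * (h\<^sup>2 * (17 / h * v (x i) ^ 16)) \<le> ln (T' (x i))"
        unfolding T'_def using small[OF v[OF xi(1)]] v[OF xi(1)] B h_pos by (intro ln_one_minus_ge) auto
      then show "- ((1 + 2 * B) * (h\<^sup>2 * (17 / h * v (x i) ^ 16))) + n * h\<^sup>2 * v (x i) ^ 17 * \<theta>
        \<le> ln (T' (x i)) + (b - 1) * ln (T (x i) / x i) + c * ln ((1 - n / c * T (x i)) / (1 - n / c * x i))"
        using * unfolding r_def minus_mult_left by linarith
    qed
    have pairs: "- ((1 + 2 * B) * (h\<^sup>2 * q i j)) - 0 \<le> ln ((T (x i) - T (x j)) / (x i - x j))"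
      if i: "i \<in> {1..n}" and j: "j \<in> {i<..n}" for i j
    proof -
      have j': "j \<in> {1..n}" using i j by auto
      have ne: "x i \<noteq> x j" using inj_onD[OF inj, of i j] i j j' by auto
      have dd: "d j - d i = \<sigma> * (x i - x j)" by (simp add: d_def algebra_simps)
      have "d j - d i \<noteq> 0" using ne \<sigma> unfolding dd by auto
      then have "v (x i) ^ 17 - v (x j) ^ 17 = q i j * (d j - d i)" by (simp add: q_def)
      then have eq: "\<sigma> * (v (x i) ^ 17 - v (x j) ^ 17) = q i j * (x i - x j)"
        unfolding dd using \<sigma> by auto
      have "T (x i) - T (x j) = (x i - x j) - h\<^sup>2 * (\<sigma> * (v (x i) ^ 17 - v (x j) ^ 17))"
        by (simp add: T_def v_def algebra_simps)
      then have "(T (x i) - T (x j)) / (x i - x j) = 1 - h\<^sup>2 * q i j"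
        unfolding eq using ne by (simp add: field_simps)
      moreover have "- (1 + 2 * B) * (h\<^sup>2 * q i j) \<le> ln (1 - h\<^sup>2 * q i j)"
      proof (rule ln_one_minus_ge)
        note sl = ramp_slope_bounds[OF h_pos d_ge[OF i] d_ge[OF j'], folded vd, folded q_def]
        show "0 \<le> h\<^sup>2 * q i j" using sl(1) by simp
        have "h\<^sup>2 * q i j \<le> h\<^sup>2 * (17 / h * max (v (x i)) (v (x j)) ^ 16)" using sl(2) by (intro mult_left_mono) auto
        also have "\<dots> \<le> B" using v x i j' by (intro small) (auto simp: le_max_iff_disj)
        finally show "h\<^sup>2 * q i j \<le> B" .
      qed (rule B(2))
      ultimately show ?thesis by (simp only: minus_mult_left diff_zero)
    qed
    have lower: "(\<Sum>i=1..n. - ((1 + 2 * B) * (h\<^sup>2 * (17 / h * v (x i) ^ 16))) + n * h\<^sup>2 * v (x i) ^ 17 * \<theta>)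
        + 2 * \<alpha> * ((\<Sum>i=1..n. \<Sum>j\<in>{i<..n}. - ((1 + 2 * B) * (h\<^sup>2 * q i j))) - 0 * (real n)\<^sup>2)
        \<le> log_jacobian n \<alpha> b c T T' x"
      unfolding log_jacobian_def
      by (intro add_mono sum_mono single mult_left_mono sum_pairs_ge pairs) (use \<alpha>_pos in auto)
    have sum_single: "(\<Sum>i=1..n. - ((1 + 2 * B) * (h\<^sup>2 * (17 / h * v (x i) ^ 16))) + n * h\<^sup>2 * v (x i) ^ 17 * \<theta>)
        = - ((1 + 2 * B) * h\<^sup>2 * A) + n * h\<^sup>2 * \<theta> * \<Phi>"
      unfolding A_def \<Phi>_def sum_distrib_left by (simp add: sum.distrib sum_negf sum_subtractf mult_ac)
    have sum_pair: "(\<Sum>i=1..n. \<Sum>j\<in>{i<..n}. - ((1 + 2 * B) * (h\<^sup>2 * q i j)))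
        = - ((1 + 2 * B) * h\<^sup>2 * (\<Sum>i=1..n. \<Sum>j\<in>{i<..n}. q i j))"
      unfolding sum_distrib_left by (simp add: sum_negf mult_ac)
    have "n * h\<^sup>2 * \<theta> * \<Phi> - (1 + 2 * B) * h\<^sup>2 * (A + 2 * \<alpha> * (\<Sum>i=1..n. \<Sum>j\<in>{i<..n}. q i j))
        \<le> log_jacobian n \<alpha> b c T T' x"
      using lower unfolding sum_single sum_pair by (simp add: algebra_simps)
    moreover have "(1 + 2 * B) * h\<^sup>2 * (A + 2 * \<alpha> * (\<Sum>i=1..n. \<Sum>j\<in>{i<..n}. q i j))
        \<le> (1 + 2 * B) * h\<^sup>2 * (n * \<Phi> * (2 * \<alpha> * G + crowd_const \<alpha> Q * e))"
      using cost B by (intro mult_left_mono) auto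
    moreover have "n * h\<^sup>2 * \<Phi> * ((1 + 2 * B) * (2 * \<alpha> * G + crowd_const \<alpha> Q * e) + \<eta>) \<le> n * h\<^sup>2 * \<Phi> * \<theta>"
      using margin \<Phi>1 by (intro mult_left_mono) (auto simp: B_def)
    moreover have "n * h\<^sup>2 * \<eta> * 1 \<le> n * h\<^sup>2 * \<eta> * \<Phi>" using \<Phi>1 \<eta> by (intro mult_left_mono) auto
    ultimately have "n * h\<^sup>2 * \<eta> \<le> log_jacobian n \<alpha> b c T T' x"
      by (simp add: algebra_simps)
    then show "(\<forall>i\<in>{1..n}. 0 < T (x i) \<and> r * T (x i) < 1) \<and> n * h\<^sup>2 * \<eta> \<le> log_jacobian n \<alpha> b c T T' x"
      using T_in by blast
  qed
  then show ?thesis unfolding stieltjes_restrict by simp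
qed

end

section \<open>The branch of the quadratic beyond an edge\<close>

text \<open>
  This turns a bound for the difference of two values of the Stieltjes transform, which the loop equation
  provides, into a bound for the second moment.
\<close>

lemma reciprocal_sum_step:
  fixes d :: "nat \<Rightarrow> real"
  assumes n: "0 < n" and h: "0 < h" "h \<le> 1" and d: "\<And>i. i \<in> {1..n} \<Longrightarrow> h \<le> d i"
  defines "g \<equiv> (\<Sum>i=1..n. 1 / d i) / n" and "g' \<equiv> (\<Sum>i=1..n. 1 / (d i + h\<^sup>2)) / n"
    and "m \<equiv> (\<Sum>i=1..n. 1 / (d i)\<^sup>2) / n"
  shows "h\<^sup>2 * m / 2 \<le> g - g'" "g - g' \<le> h\<^sup>2 * m" "h * m \<le> g" "0 \<le> m" "0 < g'"
proof -
  have pos: "0 < d i" if "i \<in> {1..n}" for i using d[OF that] h by linarith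
  have diff: "1 / d i - 1 / (d i + h\<^sup>2) = h\<^sup>2 * (1 / (d i * (d i + h\<^sup>2)))" if "i \<in> {1..n}" for i
    using pos[OF that] by (simp add: field_simps add_nonneg_eq_0_iff)
  have sum_diff: "g - g' = (\<Sum>i=1..n. h\<^sup>2 * (1 / (d i * (d i + h\<^sup>2)))) / n"
    unfolding g_def g'_def diff_divide_distrib[symmetric] sum_subtractf[symmetric]
    by (intro arg_cong2[where f="(/)"] sum.cong refl diff)
  have "h\<^sup>2 * m / 2 = (\<Sum>i=1..n. h\<^sup>2 * (1 / (d i * (2 * d i)))) / n"
    by (simp add: m_def sum_distrib_left sum_divide_distrib power2_eq_square mult_ac)
  also have "\<dots> \<le> g - g'" unfolding sum_diff
  proof (rule divide_right_mono[OF sum_mono])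
    fix i assume i: "i \<in> {1..n}"
    have "h\<^sup>2 \<le> h" using h by (simp add: power2_eq_square mult_left_le)
    then have "d i * (d i + h\<^sup>2) \<le> d i * (2 * d i)" using d[OF i] pos[OF i] by (intro mult_left_mono) auto
    then have "1 / (d i * (2 * d i)) \<le> 1 / (d i * (d i + h\<^sup>2))"
      using pos[OF i] by (intro divide_left_mono) (auto simp: add_pos_nonneg)
    then show "h\<^sup>2 * (1 / (d i * (2 * d i))) \<le> h\<^sup>2 * (1 / (d i * (d i + h\<^sup>2)))" by (intro mult_left_mono) auto
  qed simp
  finally show "h\<^sup>2 * m / 2 \<le> g - g'" .
  have "g - g' \<le> (\<Sum>i=1..n. h\<^sup>2 * (1 / (d i)\<^sup>2)) / n" unfolding sum_diff
  proof (rule divide_right_mono[OF sum_mono])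
    fix i assume i: "i \<in> {1..n}"
    have "(d i)\<^sup>2 \<le> d i * (d i + h\<^sup>2)" using pos[OF i] by (simp add: power2_eq_square)
    then have "1 / (d i * (d i + h\<^sup>2)) \<le> 1 / (d i)\<^sup>2"
      using pos[OF i] by (intro divide_left_mono) (auto simp: add_pos_nonneg)
    then show "h\<^sup>2 * (1 / (d i * (d i + h\<^sup>2))) \<le> h\<^sup>2 * (1 / (d i)\<^sup>2)" by (intro mult_left_mono) auto
  qed simp
  then show "g - g' \<le> h\<^sup>2 * m" by (simp add: m_def sum_distrib_left)
  have "h * m = (\<Sum>i=1..n. h * (1 / (d i)\<^sup>2)) / n" by (simp add: m_def sum_distrib_left)
  also have "\<dots> \<le> g" unfolding g_def
  proof (rule divide_right_mono[OF sum_mono])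
    fix i assume i: "i \<in> {1..n}"
    show "h * (1 / (d i)\<^sup>2) \<le> 1 / d i" using d[OF i] pos[OF i] by (simp add: power2_eq_square field_simps)
  qed simp
  finally show "h * m \<le> g" .
  show "0 \<le> m" unfolding m_def by (intro divide_nonneg_nonneg sum_nonneg) auto
  have "0 < (\<Sum>i=1..n. 1 / (d i + h\<^sup>2))" using n pos by (intro sum_pos) (auto simp: add_pos_nonneg)
  then show "0 < g'" using n by (simp add: g'_def)
qed

text \<open>
  Subtract the two approximate quadratic equations. The result is \<open>(g - g') (q - \<alpha> (g + g'))\<close> for
  \<open>q = 1 - \<kappa>/z\<close>, and it is positive because the remaining terms increase with \<open>1/z\<close>. Hence \<open>\<alpha> (g + g') < q\<close>,
  whereas the larger zero would give \<open>2 \<alpha> g > q\<close> by a margin that the small step cannot bridge. So \<open>g\<close> is near the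
  smaller zero, the factor \<open>q - \<alpha> (g + g')\<close> is bounded below, and the same identity bounds \<open>(g - g')/h\<^sup>2\<close>
  and thus the second moment.
\<close>

lemma upper_branch:
  fixes \<alpha> \<kappa> z h s \<delta> g g' m \<zeta> :: real
  assumes \<alpha>: "0 < \<alpha>" and \<kappa>: "0 \<le> \<kappa>" and h: "0 < h" "h \<le> 1" and \<delta>: "0 < \<delta>" and \<zeta>: "0 < \<zeta>" "\<zeta> \<le> z"
    and disc: "\<delta>\<^sup>2 \<le> (1 - \<kappa> / z)\<^sup>2 - 4 * \<alpha> / z"
    and step: "h\<^sup>2 * m / 2 \<le> g - g'" "g - g' \<le> h\<^sup>2 * m" "h * m \<le> g" "0 \<le> m" "0 < g'"
    and loop: "\<bar>\<alpha> * g\<^sup>2 - (1 - \<kappa> / z) * g + 1 / z\<bar> \<le> s"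
      "\<bar>\<alpha> * g'\<^sup>2 - (1 - \<kappa> / (z + h\<^sup>2)) * g' + 1 / (z + h\<^sup>2)\<bar> \<le> s"
    and s: "8 * s * (z * (z + h\<^sup>2)) \<le> h\<^sup>2" "s \<le> \<alpha>" "16 * \<alpha> * s \<le> \<delta>\<^sup>2" and h_small: "2 * (1 + \<alpha>) * h \<le> \<delta>"
  shows "2 * \<alpha> * g \<le> 1 - \<kappa> / z - \<delta> / 2" and "m \<le> 4 / \<delta> * ((\<kappa> * (1 / \<alpha> + 1) + 2) / \<zeta>\<^sup>2)"
proof -
  define q where "q = 1 - \<kappa> / z"
  define q' where "q' = 1 - \<kappa> / (z + h\<^sup>2)"
  define D where "D = h\<^sup>2 / (z * (z + h\<^sup>2))"
  have z: "0 < z" "0 < z + h\<^sup>2" using \<zeta> by (auto simp: add_pos_nonneg)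
  have D: "1 / z - 1 / (z + h\<^sup>2) = D" using z by (simp add: D_def field_simps)
  have D_pos: "0 < D" using z h by (simp add: D_def)
  have sD: "8 * s \<le> D" using s(1) z by (simp add: D_def le_divide_eq)
  have "\<kappa> / z - \<kappa> / (z + h\<^sup>2) = \<kappa> * D" unfolding D[symmetric] by (simp add: right_diff_distrib)
  then have q': "q' - q = \<kappa> * D" by (simp add: q_def q'_def)
  have "0 \<le> h\<^sup>2 * m / 2" using step(4) by simp
  then have gg': "0 \<le> g - g'" using step(1) by linarith
  then have g_pos: "0 < g" using step(5) by linarith
  have "(g - g') * (q - \<alpha> * (g + g')) = (q' - q) * g' + (1 / z - 1 / (z + h\<^sup>2))
      - ((\<alpha> * g\<^sup>2 - q * g + 1 / z) - (\<alpha> * g'\<^sup>2 - q' * g' + 1 / (z + h\<^sup>2)))"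
    by (simp add: algebra_simps power2_eq_square)
  then have key: "(g - g') * (q - \<alpha> * (g + g')) \<ge> (\<kappa> * g' + 1) * D - 2 * s"
      "(g - g') * (q - \<alpha> * (g + g')) \<le> (\<kappa> * g' + 1) * D + 2 * s"
    using loop unfolding q' D by (auto simp: q_def q'_def abs_le_iff algebra_simps)
  have "0 \<le> \<kappa> * g' * D" using \<kappa> step D_pos by simp
  then have "0 < (g - g') * (q - \<alpha> * (g + g'))" using key(1) sD D_pos by (simp add: algebra_simps)
  then have lower_root: "0 < q - \<alpha> * (g + g')" using gg' by (simp add: zero_less_mult_iff)
  have q1: "q \<le> 1" using \<kappa> z by (simp add: q_def)
  have g_le: "g \<le> 1 / \<alpha> + 1"
  proof (rule ccontr)
    assume "\<not> g \<le> 1 / \<alpha> + 1"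
    then have big: "1 / \<alpha> + 1 < g" by simp
    then have "1 + \<alpha> < \<alpha> * g" using \<alpha> by (simp add: field_simps)
    then have "(1 + \<alpha>) * g < \<alpha> * g * g" using g_pos by (rule mult_strict_right_mono)
    moreover have "1 \<le> g" using big \<alpha> zero_less_divide_1_iff[of \<alpha>] by linarith
    then have "\<alpha> * 1 \<le> \<alpha> * g" using \<alpha> by (intro mult_left_mono) auto
    moreover have "q * g \<le> g" using q1 g_pos by (simp add: mult_left_le_one_le mult_right_le_one_le)
    moreover have "\<alpha> * g\<^sup>2 - q * g + 1 / z \<le> s" using loop(1) by (simp add: q_def)
    moreover have "0 < 1 / z" using z by simp
    ultimately show False using s(2) by (simp add: power2_eq_square algebra_simps)
  qed
  have "(q - 2 * \<alpha> * g)\<^sup>2 = q\<^sup>2 - 4 * \<alpha> / z + 4 * \<alpha> * (\<alpha> * g\<^sup>2 - q * g + 1 / z)"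
    by (simp add: power2_eq_square algebra_simps)
  moreover have "4 * \<alpha> * (- s) \<le> 4 * \<alpha> * (\<alpha> * g\<^sup>2 - q * g + 1 / z)"
    using loop(1) \<alpha> by (intro mult_left_mono) (auto simp: q_def)
  moreover have "(\<delta> / 2)\<^sup>2 = \<delta>\<^sup>2 / 4" by (simp add: power_divide)
  ultimately have "(\<delta> / 2)\<^sup>2 \<le> (q - 2 * \<alpha> * g)\<^sup>2"
    using disc s(3) zero_le_power2[of \<delta>] unfolding q_def by linarith
  then have "\<delta> / 2 \<le> \<bar>q - 2 * \<alpha> * g\<bar>" using \<delta> by (metis abs_le_square_iff abs_of_nonneg half_gt_zero less_imp_le)
  moreover have "- \<delta> / 2 < q - 2 * \<alpha> * g"
  proof -
    have "\<alpha> * (g - g') \<le> \<alpha> * (h * (h * m))" using step(2) \<alpha> by (intro mult_left_mono) (auto simp: power2_eq_square)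
    also have "\<dots> \<le> \<alpha> * (h * (1 / \<alpha> + 1))" using step(3) g_le \<alpha> h by (intro mult_left_mono) auto
    also have "\<dots> = (1 + \<alpha>) * h" using \<alpha> by (simp add: field_simps)
    finally show ?thesis using lower_root h_small by (simp add: algebra_simps)
  qed
  ultimately have q_ge: "\<delta> / 2 \<le> q - 2 * \<alpha> * g" by linarith
  then show "2 * \<alpha> * g \<le> 1 - \<kappa> / z - \<delta> / 2" unfolding q_def by linarith
  have "\<alpha> * (g + g') \<le> 2 * \<alpha> * g" using gg' \<alpha> by (simp add: algebra_simps)
  then have "\<delta> / 2 \<le> q - \<alpha> * (g + g')" using q_ge by linarith
  then have "h\<^sup>2 * m / 2 * (\<delta> / 2) \<le> (g - g') * (q - \<alpha> * (g + g'))"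
    using step(1) gg' \<delta> by (intro mult_mono) auto
  also have "\<dots> \<le> (\<kappa> * g' + 1) * D + 2 * s" by (rule key(2))
  also have "\<dots> \<le> (\<kappa> * (1 / \<alpha> + 1) + 1) * D + D"
  proof (intro add_mono mult_right_mono mult_left_mono order_refl)
    show "2 * s \<le> D" using sD D_pos by linarith
  qed (use gg' g_le \<kappa> D_pos in auto)
  also have "\<dots> \<le> (\<kappa> * (1 / \<alpha> + 1) + 2) * (h\<^sup>2 / \<zeta>\<^sup>2)"
  proof -
    have "\<zeta> * \<zeta> \<le> z * (z + h\<^sup>2)" using \<zeta> by (intro mult_mono) (auto simp: add_increasing2)
    then have "D \<le> h\<^sup>2 / \<zeta>\<^sup>2" unfolding D_def using \<zeta> z by (intro divide_left_mono) (auto simp: power2_eq_square)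
    moreover have "0 \<le> \<kappa> * (1 / \<alpha> + 1) + 2" using \<kappa> \<alpha> by auto
    ultimately have "(\<kappa> * (1 / \<alpha> + 1) + 2) * D \<le> (\<kappa> * (1 / \<alpha> + 1) + 2) * (h\<^sup>2 / \<zeta>\<^sup>2)" by (intro mult_left_mono)
    then show ?thesis by (simp add: algebra_simps)
  qed
  finally have "h\<^sup>2 * (m * \<delta> / 4) \<le> h\<^sup>2 * ((\<kappa> * (1 / \<alpha> + 1) + 2) / \<zeta>\<^sup>2)" by (simp add: mult_ac)
  then have "m * \<delta> / 4 \<le> (\<kappa> * (1 / \<alpha> + 1) + 2) / \<zeta>\<^sup>2"
    by (rule mult_left_le_imp_le) (use h in simp)
  then have "4 / \<delta> * (m * \<delta> / 4) \<le> 4 / \<delta> * ((\<kappa> * (1 / \<alpha> + 1) + 2) / \<zeta>\<^sup>2)"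
    using \<delta> by (intro mult_left_mono) auto
  moreover have "4 / \<delta> * (m * \<delta> / 4) = m" using \<delta> by simp
  ultimately show "m \<le> 4 / \<delta> * ((\<kappa> * (1 / \<alpha> + 1) + 2) / \<zeta>\<^sup>2)" by linarith
qed

text \<open>
  The same argument below the lower edge, for particles above \<open>z\<close> and \<open>g\<close> the mean of \<open>1/(x\<^sub>i - z)\<close>. Here \<open>z\<close> may be
  zero or slightly negative, so the equation is not divided by \<open>z\<close>; for \<open>z \<le> 0\<close> it has only one positive zero.
\<close>

lemma lower_branch:
  fixes \<alpha> \<kappa> z h s \<delta> g g' m \<gamma> :: real
  assumes \<alpha>: "0 < \<alpha>" and h: "0 < h" "h \<le> 1" and \<delta>: "0 < \<delta>"
    and z: "\<delta> \<le> \<kappa> - z" "\<bar>z\<bar> \<le> 1 + \<kappa>" and \<gamma>: "\<gamma> \<le> g'" "0 < \<gamma>"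
    and disc: "\<delta>\<^sup>2 \<le> (\<kappa> - z)\<^sup>2 - 4 * \<alpha> * z"
    and step: "h\<^sup>2 * m / 2 \<le> g - g'" "g - g' \<le> h\<^sup>2 * m" "h * m \<le> g" "0 \<le> m"
    and loop: "\<bar>\<alpha> * z * g\<^sup>2 - (\<kappa> - z) * g + 1\<bar> \<le> s"
      "\<bar>\<alpha> * (z - h\<^sup>2) * g'\<^sup>2 - (\<kappa> - (z - h\<^sup>2)) * g' + 1\<bar> \<le> s"
    and s: "4 * s \<le> h\<^sup>2 * \<gamma>" "2 * s \<le> h\<^sup>2" "16 * \<alpha> * (1 + \<kappa>) * s \<le> \<delta>\<^sup>2" and h_small: "2 * \<kappa> * h \<le> \<delta>"
  shows "2 * \<alpha> * z * g \<le> \<kappa> - z - \<delta> / 2" and "g \<le> 4 / \<delta>"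
    and "m \<le> 4 / \<delta> * (16 * \<alpha> / \<delta>\<^sup>2 + 4 / \<delta> + 1)"
proof -
  define k where "k = \<kappa> - z"
  have g'_pos: "0 < g'" using \<gamma> by linarith
  have "0 \<le> h\<^sup>2 * m / 2" using step(4) by simp
  then have gg': "0 \<le> g - g'" using step(1) by linarith
  have g_pos: "0 < g" using g'_pos gg' by linarith
  have h2: "h\<^sup>2 \<le> 1" using h by (simp add: power_le_one)
  have s1: "s \<le> 1" using s(2) h2 by linarith
  have s0: "0 \<le> s" using loop(1) by linarith
  have "(g - g') * (k - \<alpha> * z * (g + g')) = h\<^sup>2 * (\<alpha> * g'\<^sup>2 + g')
      - ((\<alpha> * z * g\<^sup>2 - k * g + 1) - (\<alpha> * (z - h\<^sup>2) * g'\<^sup>2 - (\<kappa> - (z - h\<^sup>2)) * g' + 1))"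
    by (simp add: k_def algebra_simps power2_eq_square)
  then have key: "(g - g') * (k - \<alpha> * z * (g + g')) \<ge> h\<^sup>2 * (\<alpha> * g'\<^sup>2 + g') - 2 * s"
      "(g - g') * (k - \<alpha> * z * (g + g')) \<le> h\<^sup>2 * (\<alpha> * g'\<^sup>2 + g') + 2 * s"
    using loop by (auto simp: k_def abs_le_iff algebra_simps)
  have "h\<^sup>2 * \<gamma> \<le> h\<^sup>2 * (\<alpha> * g'\<^sup>2 + g')" using \<gamma> \<alpha> by (intro mult_left_mono) (auto simp: add_increasing)
  moreover have "0 < h\<^sup>2 * \<gamma>" using h \<gamma> by simp
  ultimately have "0 < (g - g') * (k - \<alpha> * z * (g + g'))" using key(1) s(1) by linarith
  then have lower_root: "0 < k - \<alpha> * z * (g + g')" using gg' by (simp add: zero_less_mult_iff)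
  have \<kappa>: "0 < 1 + \<kappa>" using z \<delta> by linarith
  have q_ge: "\<delta> / 2 \<le> k - 2 * \<alpha> * z * g"
  proof (cases "z \<le> 0")
    case True
    then have "\<alpha> * z * g \<le> 0" using \<alpha> g_pos by (simp add: mult_nonneg_nonpos mult_nonpos_nonneg)
    then show ?thesis using z \<delta> by (simp add: k_def)
  next
    case False
    have "(k - 2 * \<alpha> * z * g)\<^sup>2 = k\<^sup>2 - 4 * \<alpha> * z + 4 * \<alpha> * z * (\<alpha> * z * g\<^sup>2 - k * g + 1)"
      by (simp add: power2_eq_square algebra_simps)
    moreover have "4 * \<alpha> * z * (- s) \<le> 4 * \<alpha> * z * (\<alpha> * z * g\<^sup>2 - k * g + 1)"
      using loop(1) \<alpha> False by (intro mult_left_mono) (auto simp: k_def)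
    moreover have "4 * \<alpha> * z * s \<le> 4 * \<alpha> * (1 + \<kappa>) * s"
      using z \<alpha> s0 by (intro mult_right_mono mult_left_mono) auto
    ultimately have "\<delta>\<^sup>2 - \<delta>\<^sup>2 / 4 \<le> (k - 2 * \<alpha> * z * g)\<^sup>2"
      using disc s(3) unfolding k_def by linarith
    moreover have "(\<delta> / 2)\<^sup>2 = \<delta>\<^sup>2 / 4" by (simp add: power_divide)
    ultimately have "(\<delta> / 2)\<^sup>2 \<le> (k - 2 * \<alpha> * z * g)\<^sup>2" using zero_le_power2[of \<delta>] by linarith
    then have "\<delta> / 2 \<le> \<bar>k - 2 * \<alpha> * z * g\<bar>" using \<delta> by (metis abs_le_square_iff abs_of_nonneg half_gt_zero less_imp_le)
    moreover have "- \<delta> / 2 < k - 2 * \<alpha> * z * g"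
    proof -
      have "\<alpha> * z * g * g \<le> k * g - 1 + s" using loop(1) by (simp add: k_def power2_eq_square algebra_simps)
      also have "\<dots> \<le> \<kappa> * g"
      proof -
        have "0 \<le> z * g" using False g_pos by simp
        then show ?thesis using s1 by (simp add: k_def algebra_simps)
      qed
      finally have zg: "\<alpha> * z * g \<le> \<kappa>" using g_pos by simp
      have "\<alpha> * z * (g - g') \<le> \<alpha> * z * (h * (h * m))"
        using step(2) \<alpha> False by (intro mult_left_mono) (auto simp: power2_eq_square)
      also have "\<dots> \<le> \<alpha> * z * (h * g)" using step(3) \<alpha> h False by (intro mult_left_mono) auto
      also have "\<dots> = h * (\<alpha> * z * g)" by simp
      also have "\<dots> \<le> h * \<kappa>" using zg h by (intro mult_left_mono) auto
      finally show ?thesis using lower_root h_small by (simp add: algebra_simps)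
    qed
    ultimately show ?thesis by linarith
  qed
  then show "2 * \<alpha> * z * g \<le> \<kappa> - z - \<delta> / 2" unfolding k_def by linarith
  have kz: "\<delta> / 2 \<le> k - \<alpha> * z * y" if "0 \<le> y" "y \<le> 2 * g" for y
  proof (cases "z \<le> 0")
    case True
    then have "\<alpha> * z * y \<le> 0" using \<alpha> that by (simp add: mult_nonneg_nonpos mult_nonpos_nonneg)
    then show ?thesis using z \<delta> by (simp add: k_def)
  next
    case False
    then have "\<alpha> * z * y \<le> \<alpha> * z * (2 * g)" using that \<alpha> by (intro mult_left_mono) auto
    then show ?thesis using q_ge by simp
  qed
  have "\<delta> / 2 * g \<le> (k - \<alpha> * z * g) * g" using kz[of g] g_pos by (intro mult_right_mono) auto
  also have "\<dots> = 1 - (\<alpha> * z * g\<^sup>2 - (\<kappa> - z) * g + 1)" by (simp add: k_def power2_eq_square algebra_simps)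
  also have "\<dots> \<le> 2" using loop(1) s1 by linarith
  finally show g_le: "g \<le> 4 / \<delta>" using \<delta> by (simp add: field_simps)
  have "h\<^sup>2 * m / 2 * (\<delta> / 2) \<le> (g - g') * (k - \<alpha> * z * (g + g'))"
    using step(1) gg' \<delta> g'_pos kz[of "g + g'"] by (intro mult_mono) auto
  also have "\<dots> \<le> h\<^sup>2 * (\<alpha> * g'\<^sup>2 + g') + 2 * s" by (rule key(2))
  also have "\<dots> \<le> h\<^sup>2 * (\<alpha> * (4 / \<delta>)\<^sup>2 + 4 / \<delta>) + h\<^sup>2"
    using g_le gg' g'_pos \<alpha> s(2) by (intro add_mono mult_left_mono power_mono) auto
  also have "\<dots> = h\<^sup>2 * (16 * \<alpha> / \<delta>\<^sup>2 + 4 / \<delta> + 1)" by (simp add: power_divide algebra_simps)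
  finally have "h\<^sup>2 * (m * \<delta> / 4) \<le> h\<^sup>2 * (16 * \<alpha> / \<delta>\<^sup>2 + 4 / \<delta> + 1)" by simp
  then have "m * \<delta> / 4 \<le> 16 * \<alpha> / \<delta>\<^sup>2 + 4 / \<delta> + 1"
    by (rule mult_left_le_imp_le) (use h in simp)
  then have "4 / \<delta> * (m * \<delta> / 4) \<le> 4 / \<delta> * (16 * \<alpha> / \<delta>\<^sup>2 + 4 / \<delta> + 1)"
    using \<delta> by (intro mult_left_mono) auto
  moreover have "4 / \<delta> * (m * \<delta> / 4) = m" using \<delta> by simp
  ultimately show "m \<le> 4 / \<delta> * (16 * \<alpha> / \<delta>\<^sup>2 + 4 / \<delta> + 1)" by linarith
qed

text \<open>
  For very large \<open>z\<close> the quadratic equation is too imprecise, but then Markov's inequality suffices: a particle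
  above \<open>z/2\<close> satisfies \<open>1 \<le> 2 x/z\<close>.
\<close>

lemma far_sums:
  fixes x :: "nat \<Rightarrow> real"
  assumes n: "0 < n" and h: "0 < h" and z: "0 < z"
    and x: "\<And>i. i \<in> {1..n} \<Longrightarrow> 0 \<le> x i \<and> x i \<le> z - h" and sum: "(\<Sum>i=1..n. x i) \<le> C * n"
  shows "(\<Sum>i=1..n. 1 / (z - x i)) / n \<le> 2 / z + 2 * C / (z * h)"
    and "(\<Sum>i=1..n. 1 / (z - x i)\<^sup>2) / n \<le> 4 / z\<^sup>2 + 2 * C / (z * h\<^sup>2)"
proof -
  have avg: "(\<Sum>i=1..n. A + B * x i) / n \<le> A + B * C" if "0 \<le> B" for A B :: real
  proof -
    have "(\<Sum>i=1..n. A + B * x i) = n * A + B * (\<Sum>i=1..n. x i)"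
      by (simp add: sum.distrib sum_distrib_left)
    also have "\<dots> \<le> n * A + B * (C * n)" using sum that by (intro add_left_mono mult_left_mono)
    finally show ?thesis using n by (simp add: divide_le_eq algebra_simps)
  qed
  have 1: "1 / (z - x i) \<le> 2 / z + 2 / (z * h) * x i" if i: "i \<in> {1..n}" for i
  proof (cases "x i \<le> z / 2")
    case True
    then have "1 / (z - x i) \<le> 1 / (z / 2)" using z x[OF i] by (intro divide_left_mono) auto
    moreover have "0 \<le> 2 / (z * h) * x i" using z h x[OF i] by simp
    ultimately show ?thesis by simp
  next
    case False
    have "1 / (z - x i) \<le> 1 / h" using x[OF i] h by (intro divide_left_mono) auto
    also have "\<dots> \<le> 1 / h * (2 * x i / z)" using False z h by (simp add: field_simps)
    finally have "1 / (z - x i) \<le> 2 / (z * h) * x i" by (simp add: mult.commute)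
    moreover have "0 \<le> 2 / z" using z by simp
    ultimately show ?thesis by linarith
  qed
  have 2: "1 / (z - x i)\<^sup>2 \<le> 4 / z\<^sup>2 + 2 / (z * h\<^sup>2) * x i" if i: "i \<in> {1..n}" for i
  proof (cases "x i \<le> z / 2")
    case True
    then have "(z / 2)\<^sup>2 \<le> (z - x i)\<^sup>2" using z by (intro power_mono) auto
    then have "1 / (z - x i)\<^sup>2 \<le> 1 / (z / 2)\<^sup>2" using z True by (intro divide_left_mono) auto
    moreover have "0 \<le> 2 / (z * h\<^sup>2) * x i" using z h x[OF i] by simp
    ultimately show ?thesis by (simp add: power_divide)
  next
    case False
    have "h\<^sup>2 \<le> (z - x i)\<^sup>2" using x[OF i] h by (intro power_mono) auto
    then have "1 / (z - x i)\<^sup>2 \<le> 1 / h\<^sup>2" using x[OF i] h by (intro divide_left_mono) auto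
    also have "\<dots> \<le> 1 / h\<^sup>2 * (2 * x i / z)" using False z h by (simp add: field_simps)
    finally have "1 / (z - x i)\<^sup>2 \<le> 2 / (z * h\<^sup>2) * x i" by (simp add: mult.commute)
    moreover have "0 \<le> 4 / z\<^sup>2" by simp
    ultimately show ?thesis by linarith
  qed
  have "(\<Sum>i=1..n. 1 / (z - x i)) / n \<le> (\<Sum>i=1..n. 2 / z + 2 / (z * h) * x i) / n"
    by (intro divide_right_mono sum_mono 1) auto
  also have "\<dots> \<le> 2 / z + 2 / (z * h) * C" using z h by (intro avg) auto
  finally show "(\<Sum>i=1..n. 1 / (z - x i)) / n \<le> 2 / z + 2 * C / (z * h)" by simp
  have "(\<Sum>i=1..n. 1 / (z - x i)\<^sup>2) / n \<le> (\<Sum>i=1..n. 4 / z\<^sup>2 + 2 / (z * h\<^sup>2) * x i) / n"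
    by (intro divide_right_mono sum_mono 2) auto
  also have "\<dots> \<le> 4 / z\<^sup>2 + 2 / (z * h\<^sup>2) * C" using z h by (intro avg) auto
  finally show "(\<Sum>i=1..n. 1 / (z - x i)\<^sup>2) / n \<le> 4 / z\<^sup>2 + 2 * C / (z * h\<^sup>2)" by simp
qed

section \<open>The external force beyond an edge\<close>

context jacobi_particles
begin

text \<open>
  The displacement is towards zero. The factor \<open>x\<^sup>b\<close> then costs at most \<open>b/\<zeta>\<close> per unit of displacement, and
  \<open>(1 - r x)\<^sup>c\<close> gains about \<open>n\<close>.
\<close>

lemma upper_force:
  fixes h x v T \<zeta> :: real
  assumes h: "0 < h" "2 ^ 17 * h\<^sup>2 \<le> 1/2" and b: "0 \<le> b" and r1: "r \<le> 1"
    and \<zeta>: "0 < \<zeta>" "\<zeta> \<le> x" "2 ^ 18 * h\<^sup>2 \<le> \<zeta>" and x: "0 < x" "r * x < 1"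
    and v: "0 \<le> v" "v \<le> 2" and T: "T = x - h\<^sup>2 * v ^ 17"
  shows "0 < T \<and> r * T < 1 \<and>
      n * h\<^sup>2 * v ^ 17 * (1 - 2 ^ 17 * h\<^sup>2 - (1 + 2 ^ 18 * h\<^sup>2 / \<zeta>) * (b / n / \<zeta>))
        \<le> (b - 1) * ln (T / x) + c * ln ((1 - r * T) / (1 - r * x))"
proof -
  define y where "y = h\<^sup>2 * v ^ 17"
  have "v ^ 17 \<le> 2 ^ 17" using v by (rule power_mono[rotated])
  then have y: "0 \<le> y" "y \<le> 2 ^ 17 * h\<^sup>2" using v h by (auto simp: y_def)
  have yx: "y / x \<le> 2 ^ 17 * h\<^sup>2 / \<zeta>" using y \<zeta> by (intro frac_le) auto
  have half: "2 ^ 17 * h\<^sup>2 / \<zeta> \<le> 1/2" using \<zeta> by (simp add: field_simps)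
  have yx2: "y / x \<le> 1 / 2" using yx half by linarith
  then have "y \<le> x / 2" using x by (simp add: divide_le_eq)
  moreover have "T = x - y" by (simp add: T y_def)
  ultimately have T_pos: "0 < T" using x by linarith
  have "r * T \<le> r * x" using y r_pos by (simp add: T y_def)
  then have rT: "r * T < 1" using x by linarith
  have quot: "T / x = 1 - y / x" using x by (simp add: T y_def field_simps)
  have "- (1 + 2 * (2 ^ 17 * h\<^sup>2 / \<zeta>)) * (y / x) \<le> ln (1 - y / x)"
    using y x yx half by (intro ln_one_minus_ge) auto
  then have "b * (- (1 + 2 * (2 ^ 17 * h\<^sup>2 / \<zeta>)) * (y / x)) \<le> b * ln (1 - y / x)"
    using b by (intro mult_left_mono)
  moreover have "b * ((1 + 2 * (2 ^ 17 * h\<^sup>2 / \<zeta>)) * (y / x)) \<le> b * ((1 + 2 * (2 ^ 17 * h\<^sup>2 / \<zeta>)) * (y / \<zeta>))"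
    using b y \<zeta> x h by (intro mult_left_mono divide_left_mono) auto
  moreover have "b * ln (1 - y / x) \<le> (b - 1) * ln (1 - y / x)"
  proof -
    have "0 \<le> y / x" using y x by simp
    then have "ln (1 - y / x) \<le> 0" using ln_one_minus_pos_upper_bound[of "y / x"] yx2 by linarith
    then show ?thesis by (simp add: algebra_simps)
  qed
  ultimately have first: "- (n * y * ((1 + 2 ^ 18 * h\<^sup>2 / \<zeta>) * (b / n / \<zeta>))) \<le> (b - 1) * ln (T / x)"
  proof -
    assume a: "b * (- (1 + 2 * (2 ^ 17 * h\<^sup>2 / \<zeta>)) * (y / x)) \<le> b * ln (1 - y / x)"
      "b * ((1 + 2 * (2 ^ 17 * h\<^sup>2 / \<zeta>)) * (y / x)) \<le> b * ((1 + 2 * (2 ^ 17 * h\<^sup>2 / \<zeta>)) * (y / \<zeta>))"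
      "b * ln (1 - y / x) \<le> (b - 1) * ln (1 - y / x)"
    have "n * y * ((1 + 2 ^ 18 * h\<^sup>2 / \<zeta>) * (b / n / \<zeta>)) = b * ((1 + 2 * (2 ^ 17 * h\<^sup>2 / \<zeta>)) * (y / \<zeta>))"
      using n_pos by simp
    then show ?thesis unfolding quot using a by (simp only: mult_minus_left mult_minus_right)
  qed
  have ry: "0 \<le> r * y" "r * y \<le> 2 ^ 17 * h\<^sup>2"
  proof -
    have "r * y \<le> 1 * y" using r1 y by (intro mult_right_mono) auto
    then show "r * y \<le> 2 ^ 17 * h\<^sup>2" using y by linarith
  qed (use y r_pos in auto)
  have "(1 - r * T) / (1 - r * x) = 1 + r * y / (1 - r * x)"
    using x by (simp add: T y_def field_simps)
  moreover have "r * y \<le> r * y / (1 - r * x)"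
  proof -
    have "r * y * (1 - r * x) \<le> r * y * 1" using ry x r_pos by (intro mult_left_mono) auto
    then show ?thesis using x by (simp add: le_divide_eq)
  qed
  ultimately have "ln (1 + r * y) \<le> ln ((1 - r * T) / (1 - r * x))" using ry by simp
  moreover have "r * y - (r * y)\<^sup>2 \<le> ln (1 + r * y)"
    using ry h by (intro ln_one_plus_pos_lower_bound) auto
  ultimately have "c * (r * y - (r * y)\<^sup>2) \<le> c * ln ((1 - r * T) / (1 - r * x))"
    using c_pos by (intro mult_left_mono) auto
  moreover have "c * (r * y - (r * y)\<^sup>2) = n * y * (1 - r * y)"
    using c_r by (simp add: power2_eq_square right_diff_distrib flip: mult.assoc)
  moreover have "n * y * (1 - 2 ^ 17 * h\<^sup>2) \<le> n * y * (1 - r * y)"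
    using ry y by (intro mult_left_mono) auto
  ultimately have second: "n * y * (1 - 2 ^ 17 * h\<^sup>2) \<le> c * ln ((1 - r * T) / (1 - r * x))" by linarith
  have "n * h\<^sup>2 * v ^ 17 * (1 - 2 ^ 17 * h\<^sup>2 - (1 + 2 ^ 18 * h\<^sup>2 / \<zeta>) * (b / n / \<zeta>))
      = n * y * (1 - 2 ^ 17 * h\<^sup>2) + - (n * y * ((1 + 2 ^ 18 * h\<^sup>2 / \<zeta>) * (b / n / \<zeta>)))"
    by (simp add: y_def algebra_simps)
  then show ?thesis using first second T_pos rT by linarith
qed

text \<open>
  Now the displacement is away from zero, and the particle may be arbitrarily close to zero. Then
  \<open>ln (T/x)\<close> is not linear in the displacement, but it is bounded below by its value for the rightmost affected
  position \<open>\<zeta>\<close>, where it is.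
\<close>

lemma lower_force:
  fixes h x v T \<zeta> :: real
  assumes h: "0 < h" "2 ^ 19 * h\<^sup>2 \<le> 1" "2 ^ 17 * h \<le> 1" and b: "1 \<le> b" and r1: "r \<le> 1"
    and \<zeta>: "h \<le> \<zeta>" "x \<le> \<zeta>" "r * \<zeta> \<le> 1/4" and x: "0 < x"
    and v: "0 \<le> v" "v \<le> 2" and T: "T = x + h\<^sup>2 * v ^ 17"
  shows "0 < T \<and> r * T < 1 \<and>
      n * h\<^sup>2 * v ^ 17 * ((b - 1) / n / \<zeta> * (1 - 2 ^ 17 * h) - (1 + 2 * (r * \<zeta>)) * (1 + 2 ^ 19 * h\<^sup>2))
        \<le> (b - 1) * ln (T / x) + c * ln ((1 - r * T) / (1 - r * x))"
proof -
  define y where "y = h\<^sup>2 * v ^ 17"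
  have "v ^ 17 \<le> 2 ^ 17" using v by (rule power_mono[rotated])
  then have y: "0 \<le> y" "y \<le> 2 ^ 17 * h\<^sup>2" using v h by (auto simp: y_def)
  have \<zeta>_pos: "0 < \<zeta>" using h \<zeta> by linarith
  have y\<zeta>: "y / \<zeta> \<le> 2 ^ 17 * h"
  proof -
    have "y / \<zeta> \<le> 2 ^ 17 * h\<^sup>2 / h" using y \<zeta> h by (intro frac_le) auto
    then show ?thesis using h by (simp add: power2_eq_square)
  qed
  have ry: "0 \<le> r * y" "r * y \<le> 2 ^ 17 * h\<^sup>2"
  proof -
    have "r * y \<le> 1 * y" using r1 y by (intro mult_right_mono) auto
    then show "r * y \<le> 2 ^ 17 * h\<^sup>2" using y by linarith
  qed (use y r_pos in auto)
  have rx: "r * x \<le> r * \<zeta>" "0 < r * x" using \<zeta> x r_pos by auto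
  have T_pos: "0 < T" using x y by (simp add: T y_def)
  have "r * T = r * x + r * y" by (simp add: T y_def distrib_left)
  moreover have "2 ^ 17 * h\<^sup>2 \<le> 1/4" using h(2) by simp
  ultimately have rT: "r * T < 1" using rx(1) \<zeta>(3) ry(2) by linarith
  have quot: "T / x = 1 + y / x" using x by (simp add: T y_def field_simps)
  have "y / \<zeta> - (y / \<zeta>)\<^sup>2 \<le> ln (1 + y / \<zeta>)"
  proof (rule ln_one_plus_pos_lower_bound)
    show "y / \<zeta> \<le> 1" using y\<zeta> h(3) by linarith
  qed (use y \<zeta>_pos in simp)
  also have "ln (1 + y / \<zeta>) \<le> ln (T / x)"
  proof -
    have "y / \<zeta> \<le> y / x" using y \<zeta> x by (intro divide_left_mono) auto
    moreover have "0 \<le> y / \<zeta>" using y \<zeta>_pos by simp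
    ultimately show ?thesis unfolding quot by simp
  qed
  finally have "(b - 1) * (y / \<zeta> - (y / \<zeta>)\<^sup>2) \<le> (b - 1) * ln (T / x)" using b by (intro mult_left_mono) auto
  moreover have "(b - 1) * (y / \<zeta> * (1 - 2 ^ 17 * h)) \<le> (b - 1) * (y / \<zeta> - (y / \<zeta>)\<^sup>2)"
  proof (rule mult_left_mono)
    have "y / \<zeta> * (y / \<zeta>) \<le> y / \<zeta> * (2 ^ 17 * h)" using y y\<zeta> \<zeta>_pos by (intro mult_left_mono) auto
    then show "y / \<zeta> * (1 - 2 ^ 17 * h) \<le> y / \<zeta> - (y / \<zeta>)\<^sup>2"
      by (simp only: power2_eq_square right_diff_distrib mult_1_right)
  qed (use b in auto)
  moreover have "n * y * ((b - 1) / n / \<zeta> * (1 - 2 ^ 17 * h)) = (b - 1) * (y / \<zeta> * (1 - 2 ^ 17 * h))"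
    using n_pos by simp
  ultimately have first: "n * y * ((b - 1) / n / \<zeta> * (1 - 2 ^ 17 * h)) \<le> (b - 1) * ln (T / x)" by linarith
  define V where "V = r * y / (1 - r * x)"
  have inv: "1 / (1 - r * x) \<le> 1 + 2 * (r * \<zeta>)"
  proof -
    have "(1 + 2 * (r * x)) * (1 - r * x) = 1 + r * x * (1 - 2 * (r * x))" by (simp add: algebra_simps)
    moreover have "0 \<le> r * x * (1 - 2 * (r * x))" by (rule mult_nonneg_nonneg) (use rx \<zeta> in auto)
    ultimately have "1 / (1 - r * x) \<le> 1 + 2 * (r * x)" using rx \<zeta> by (simp add: divide_le_eq)
    then show ?thesis using rx by linarith
  qed
  have V_eq: "V = r * y * (1 / (1 - r * x))" by (simp add: V_def)
  have V: "0 \<le> V" unfolding V_eq by (rule mult_nonneg_nonneg) (use ry rx \<zeta> in auto)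
  have V_le: "V \<le> r * y * (1 + 2 * (r * \<zeta>))" unfolding V_eq using inv ry(1) by (rule mult_left_mono)
  have V2: "V \<le> 2 ^ 18 * h\<^sup>2"
  proof -
    have "r * y * (1 + 2 * (r * \<zeta>)) \<le> 2 ^ 17 * h\<^sup>2 * 2" by (rule mult_mono) (use ry \<zeta> rx in auto)
    then show ?thesis using V_le by simp
  qed
  have "(1 - r * T) / (1 - r * x) = 1 - V" using rx \<zeta> by (simp add: T y_def V_def field_simps)
  moreover have "- (1 + 2 * (2 ^ 18 * h\<^sup>2)) * V \<le> ln (1 - V)"
    using V V2 h by (intro ln_one_minus_ge) auto
  ultimately have "c * (- (1 + 2 * (2 ^ 18 * h\<^sup>2)) * V) \<le> c * ln ((1 - r * T) / (1 - r * x))"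
    using c_pos by simp
  moreover have "c * ((1 + 2 ^ 19 * h\<^sup>2) * V) \<le> n * y * ((1 + 2 * (r * \<zeta>)) * (1 + 2 ^ 19 * h\<^sup>2))"
  proof -
    have "c * ((1 + 2 ^ 19 * h\<^sup>2) * V) \<le> c * ((1 + 2 ^ 19 * h\<^sup>2) * (r * y * (1 + 2 * (r * \<zeta>))))"
      using V_le c_pos by (intro mult_left_mono) auto
    also have "\<dots> = (c * r) * y * ((1 + 2 * (r * \<zeta>)) * (1 + 2 ^ 19 * h\<^sup>2))" by (simp only: mult_ac)
    finally show ?thesis unfolding c_r .
  qed
  moreover have "c * (- (1 + 2 * (2 ^ 18 * h\<^sup>2)) * V) = - (c * ((1 + 2 ^ 19 * h\<^sup>2) * V))"
  proof -
    have "1 + 2 * (2 ^ 18 * h\<^sup>2) = 1 + 2 ^ 19 * h\<^sup>2" by simp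
    then show ?thesis by (simp only: mult_minus_left mult_minus_right)
  qed
  ultimately have second: "- (n * y * ((1 + 2 * (r * \<zeta>)) * (1 + 2 ^ 19 * h\<^sup>2))) \<le> c * ln ((1 - r * T) / (1 - r * x))"
    by linarith
  have split: "n * h\<^sup>2 * v ^ 17 * (A - B) = n * y * A + - (n * y * B)" for A B :: real
    by (simp add: y_def right_diff_distrib)
  show ?thesis unfolding split using first second T_pos rT by linarith
qed

section \<open>Outliers in a window\<close>

lemma prob_subset_Un:
  assumes "A \<in> events" "B \<in> events" "C \<subseteq> A \<union> B"
  shows "prob C \<le> prob A + prob B"
  using assms finite_measure_mono[of C "A \<union> B"] measure_Un_le[of A M B] by force

lemma sum_loop_pred:
  "Measurable.pred (\<Pi>\<^sub>M i\<in>{1..n}. borel) (\<lambda>x. (\<Sum>i=1..n. x i) \<le> K \<and> s \<le> a * (w * loop_poly \<alpha> k z (stieltjes n z x)))"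
  unfolding loop_poly_def by measurable

lemma loop_bound_abs:
  fixes z h w W L \<kappa>m C0 C1 C2 s l u :: real
  assumes h: "0 < h" "h \<le> 1" and w: "0 < w" "w \<le> W" "w * \<bar>z\<bar> \<le> W" and L: "L = 2 * W / h\<^sup>2"
    and side: "(\<forall>x\<in>{l..u}. x \<le> z - h) \<or> (\<forall>x\<in>{l..u}. z + h \<le> x)"
    and b: "0 \<le> b" "b / n \<le> \<kappa>m" and r_small: "r * n \<le> 1" "r * (C0 * n) \<le> 1/2" and C0: "0 \<le> C0"
    and C1: "C1 = 2 + \<alpha> + 2 * C0" and C2: "C2 = 10 + 2 * \<kappa>m + 4 * \<alpha>"
    and s: "2 * C1 * L / n \<le> s" "s \<le> C2 * L"
  defines "E \<equiv> {\<omega>\<in>space M. ((\<Sum>i=1..n. Y i \<omega>) \<le> C0 * n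
      \<and> s \<le> \<bar>w * loop_poly \<alpha> (b / n) z (stieltjes n z (\<lambda>i. Y i \<omega>))\<bar>) \<and> (\<forall>i\<in>{1..n}. Y i \<omega> \<in> {l..u})}"
  shows "E \<in> events" and "prob E \<le> 2 * exp (- ((real n)\<^sup>2 * s\<^sup>2 / (16 * C2 * L\<^sup>2)))"
proof -
  have "Measurable.pred (\<Pi>\<^sub>M i\<in>{1..n}. borel)
      (\<lambda>x. (\<Sum>i=1..n. x i) \<le> C0 * n \<and> s \<le> \<bar>w * loop_poly \<alpha> (b / n) z (stieltjes n z x)\<bar>)"
    unfolding loop_poly_def by measurable
  from Y_event_box[OF this, of l u] show "E \<in> events"
    unfolding E_def stieltjes_restrict by simp
  define F where "F \<epsilon> = {\<omega>\<in>space M. ((\<Sum>i=1..n. Y i \<omega>) \<le> C0 * n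
      \<and> s \<le> \<epsilon> * (w * loop_poly \<alpha> (b / n) z (stieltjes n z (\<lambda>i. Y i \<omega>)))) \<and> (\<forall>i\<in>{1..n}. Y i \<omega> \<in> {l..u})}" for \<epsilon>
  have F_events: "F \<epsilon> \<in> events" for \<epsilon>
    using Y_event_box[OF sum_loop_pred[of "C0 * n" s \<epsilon> w "b / n" z], of l u] unfolding F_def stieltjes_restrict by simp
  have F_prob: "prob (F \<epsilon>) \<le> exp (- ((real n)\<^sup>2 * s\<^sup>2 / (16 * C2 * L\<^sup>2)))" if "\<epsilon> = 1 \<or> \<epsilon> = - 1" for \<epsilon>
    unfolding F_def conj_assoc by (rule loop_bound[OF h w L side b r_small C0 C1 C2 s that])
  have "prob E \<le> prob (F 1) + prob (F (- 1))"
    by (rule prob_subset_Un[OF F_events F_events]) (auto simp: E_def F_def abs_if split: if_splits)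
  then show "prob E \<le> 2 * exp (- ((real n)\<^sup>2 * s\<^sup>2 / (16 * C2 * L\<^sup>2)))"
    using F_prob[of 1] F_prob[of "- 1"] by simp
qed

text \<open>
  With \<open>n h\<^sup>1\<^sup>0 = 1\<close> the loop polynomial is accurate to order \<open>h\<^sup>7\<close>: the deterministic errors are of order
  \<open>L/n\<close>, that is \<open>h\<^sup>8\<close>, and the exponent \<open>n\<^sup>2 h\<^sup>1\<^sup>4/L\<^sup>2\<close> is of order \<open>h\<^sup>-\<^sup>2\<close>.
\<close>

lemma loop_bound_scaled:
  fixes z h w W \<kappa>m C0 l u :: real
  assumes h: "0 < h" "h \<le> 1" "real n * h ^ 10 = 1" and w: "0 < w" "w \<le> W" "w * \<bar>z\<bar> \<le> W"
    and side: "(\<forall>x\<in>{l..u}. x \<le> z - h) \<or> (\<forall>x\<in>{l..u}. z + h \<le> x)"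
    and b: "0 \<le> b" "b / n \<le> \<kappa>m" and r_small: "r * n \<le> 1" "r * (C0 * n) \<le> 1/2" and C0: "0 \<le> C0"
    and small: "4 * (2 + \<alpha> + 2 * C0) * W * h \<le> 1" and W1: "1 \<le> W"
  defines "E \<equiv> {\<omega>\<in>space M. ((\<Sum>i=1..n. Y i \<omega>) \<le> C0 * n
      \<and> h ^ 7 \<le> \<bar>w * loop_poly \<alpha> (b / n) z (stieltjes n z (\<lambda>i. Y i \<omega>))\<bar>) \<and> (\<forall>i\<in>{1..n}. Y i \<omega> \<in> {l..u})}"
  shows "E \<in> events" and "prob E \<le> 2 * exp (- (1 / (64 * (10 + 2 * \<kappa>m + 4 * \<alpha>) * W\<^sup>2 * h\<^sup>2)))"
proof -
  define C2 where "C2 = 10 + 2 * \<kappa>m + 4 * \<alpha>"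
  define L where "L = 2 * W / h\<^sup>2"
  have inv_n: "1 / n = h ^ 10" using h n_pos by (simp add: field_simps)
  have s1: "2 * (2 + \<alpha> + 2 * C0) * L / n \<le> h ^ 7"
  proof -
    have "2 * (2 + \<alpha> + 2 * C0) * L / n = 2 * (2 + \<alpha> + 2 * C0) * L * (1 / n)" by simp
    also have "\<dots> = (4 * (2 + \<alpha> + 2 * C0) * W * h) * h ^ 7"
      unfolding inv_n L_def using h by (simp add: eval_nat_numeral)
    also have "\<dots> \<le> 1 * h ^ 7" using small h by (intro mult_right_mono) auto
    finally show ?thesis by simp
  qed
  have \<kappa>m: "0 \<le> \<kappa>m" using b n_pos by (meson divide_nonneg_nonneg of_nat_0_le_iff order_trans)
  have s2: "h ^ 7 \<le> C2 * L"
  proof -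
    have "h ^ 7 \<le> 1" "h\<^sup>2 \<le> 1" using h by (auto simp: power_le_one)
    moreover have "1 \<le> L" using W1 h \<open>h\<^sup>2 \<le> 1\<close> by (simp add: L_def le_divide_eq)
    moreover have "1 * 1 \<le> C2 * L" using \<open>1 \<le> L\<close> \<alpha>_pos \<kappa>m by (intro mult_mono) (auto simp: C2_def)
    ultimately show ?thesis by linarith
  qed
  note lb = loop_bound_abs[OF h(1,2) w L_def side b r_small C0 refl C2_def s1 s2]
  show "E \<in> events" unfolding E_def by (rule lb(1))
  have "(real n)\<^sup>2 * (h ^ 7)\<^sup>2 / (16 * C2 * L\<^sup>2) = (real n * h ^ 10)\<^sup>2 / (64 * C2 * W\<^sup>2 * h\<^sup>2)"
  proof -
    have L2: "L\<^sup>2 = 4 * W\<^sup>2 / h ^ 4" by (simp add: L_def power_divide power_mult_distrib flip: power_mult)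
    have "(h ^ 7)\<^sup>2 * h ^ 4 * h\<^sup>2 = (h ^ 10)\<^sup>2" by (simp flip: power_mult power_add)
    then have hh: "(real n * h ^ 10)\<^sup>2 = (real n)\<^sup>2 * (h ^ 7)\<^sup>2 * h ^ 4 * h\<^sup>2"
      by (simp only: power_mult_distrib mult.assoc)
    have "(real n)\<^sup>2 * (h ^ 7)\<^sup>2 / (16 * C2 * (4 * W\<^sup>2 / h ^ 4))
        = (real n)\<^sup>2 * (h ^ 7)\<^sup>2 * h ^ 4 / (64 * C2 * W\<^sup>2)" by simp
    also have "\<dots> = (real n)\<^sup>2 * (h ^ 7)\<^sup>2 * h ^ 4 * h\<^sup>2 / (64 * C2 * W\<^sup>2 * h\<^sup>2)"
      by (rule nonzero_mult_divide_mult_cancel_right[symmetric]) (use h in simp)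
    finally show ?thesis unfolding L2 hh .
  qed
  then show "prob E \<le> 2 * exp (- (1 / (64 * (10 + 2 * \<kappa>m + 4 * \<alpha>) * W\<^sup>2 * h\<^sup>2)))"
    using lb(2) unfolding E_def h(3) C2_def by simp
qed

lemma edge_event:
  "{\<omega>\<in>space M. ((\<exists>i\<in>{1..n}. \<sigma> * (z - Y i \<omega>) \<le> k) \<and> (\<Sum>i=1..n. 1 / (z - Y i \<omega>)\<^sup>2) \<le> Q
      \<and> \<sigma> * stieltjes n z (\<lambda>i. Y i \<omega>) \<le> G) \<and> (\<forall>i\<in>{1..n}. Y i \<omega> \<in> {l..u})} \<in> events"
proof -
  note [measurable] = exists_near_pred[where \<sigma> = \<sigma> and z = z and k = k]
  have "Measurable.pred (\<Pi>\<^sub>M i\<in>{1..n}. borel) (\<lambda>x. (\<exists>i\<in>{1..n}. \<sigma> * (z - x i) \<le> k)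
      \<and> (\<Sum>i=1..n. 1 / (z - x i)\<^sup>2) \<le> Q \<and> \<sigma> * stieltjes n z x \<le> G)"
    by measurable
  from Y_event_box[OF this, of l u] show ?thesis unfolding stieltjes_restrict by simp
qed

text \<open>
  If the loop polynomial is small at \<open>z\<close> and at \<open>z + h\<^sup>2\<close>, the hypotheses of \<open>edge_move\<close> on \<open>G\<close> and \<open>Q\<close> hold, so
  the event is covered by two loop events and one move event. For \<open>z > 1/h\<^sup>2\<close> the first moment replaces the loop
  events. The assumptions \<open>small\<close> only say that \<open>e\<close> is small compared with the other parameters.
\<close>

lemma upper_window:
  fixes e h z \<zeta> \<delta> \<kappa>m C0 Q S W :: real
  assumes e: "0 < e" "e \<le> 1" "real n * e ^ 20 = 1" and h: "h = e\<^sup>2"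
    and b: "0 \<le> b" "b / n \<le> \<kappa>m" and r_small: "r * n \<le> 1" "r * (C0 * n) \<le> 1/2" and C0: "0 \<le> C0"
    and \<delta>: "0 < \<delta>" "\<delta> \<le> 1" and \<zeta>: "0 < \<zeta>" "\<zeta> \<le> z"
    and disc: "\<delta>\<^sup>2 \<le> (1 - b / n / z)\<^sup>2 - 4 * \<alpha> / z"
    and W: "W = 1 + 1 / \<zeta>"
    and Q: "Q = max (4 / \<delta> * ((\<kappa>m * (1 / \<alpha> + 1) + 2) / \<zeta>\<^sup>2)) (4 + 2 * C0)"
    and S: "S = 17 * 2 ^ 17 + 2 * crowd_const \<alpha> Q + 2 ^ 17 + 2 ^ 21 * \<kappa>m / \<zeta>\<^sup>2"
    and small: "2 ^ 25 * h \<le> 1" "2 ^ 20 * h \<le> \<zeta>" "4 * (2 + \<alpha> + 2 * C0) * W * h \<le> 1" "h \<le> \<alpha>"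
      "16 * \<alpha> * h \<le> \<delta>\<^sup>2" "2 * (1 + \<alpha>) * h \<le> \<delta>" "(\<kappa>m + 4 * \<alpha> + 4 * \<alpha> * C0) * h \<le> 1/2" "S * e \<le> \<delta> / 4"
  shows "prob {\<omega>\<in>space M. (\<Sum>i=1..n. Y i \<omega>) \<le> C0 * n \<and> (\<exists>i\<in>{1..n}. z - Y i \<omega> \<le> 2 * h)
      \<and> (\<forall>i\<in>{1..n}. Y i \<omega> \<in> {0..z - h})}
    \<le> 4 * exp (- (1 / (64 * (10 + 2 * \<kappa>m + 4 * \<alpha>) * W\<^sup>2 * h\<^sup>2))) + exp (- (n * h\<^sup>2 * (\<delta> / 4)))"
proof -
  define \<kappa> where "\<kappa> = b / n"
  define G where "G = (1 - \<kappa> / z - \<delta> / 2) / (2 * \<alpha>)"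
  define loop_event where "loop_event z' = {\<omega>\<in>space M. ((\<Sum>i=1..n. Y i \<omega>) \<le> C0 * n
      \<and> h ^ 7 \<le> \<bar>1 / z' * loop_poly \<alpha> (b / n) z' (stieltjes n z' (\<lambda>i. Y i \<omega>))\<bar>) \<and> (\<forall>i\<in>{1..n}. Y i \<omega> \<in> {0..z - h})}" for z'
  define move_event where "move_event = {\<omega>\<in>space M. ((\<exists>i\<in>{1..n}. 1 * (z - Y i \<omega>) \<le> 2 * h) \<and> (\<Sum>i=1..n. 1 / (z - Y i \<omega>)\<^sup>2) \<le> Q * n
      \<and> 1 * stieltjes n z (\<lambda>i. Y i \<omega>) \<le> G) \<and> (\<forall>i\<in>{1..n}. Y i \<omega> \<in> {0..z - h})}"
  define p where "p = exp (- (1 / (64 * (10 + 2 * \<kappa>m + 4 * \<alpha>) * W\<^sup>2 * h\<^sup>2)))"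
  have h_pos: "0 < h" using e by (simp add: h)
  have h_e: "h \<le> e" using e by (simp add: h power2_eq_square mult_left_le)
  have h1: "h \<le> 1" using h_e e by simp
  have h2: "h\<^sup>2 \<le> h" using h1 h_pos by (simp add: power2_eq_square mult_left_le)
  have h7: "h ^ 7 \<le> h" using power_decreasing[of 1 7 h] h1 h_pos by simp
  have nh: "real n * h ^ 10 = 1" using e(3) by (simp add: h flip: power_mult)
  have z: "0 < z" using \<zeta> by linarith
  have \<kappa>: "0 \<le> \<kappa>" "\<kappa> \<le> \<kappa>m" using b by (auto simp: \<kappa>_def)
  have \<kappa>m: "0 \<le> \<kappa>m" using \<kappa> by linarith
  have r1: "r \<le> 1"
  proof -
    have "r * 1 \<le> r * n" using r_pos n_pos by (intro mult_left_mono) auto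
    then show ?thesis using r_small(1) by linarith
  qed
  have loops: "loop_event z' \<in> events \<and> prob (loop_event z') \<le> 2 * p" if "z \<le> z'" for z'
  proof -
    have "1 / z' \<le> 1 / \<zeta>" using that \<zeta> by (intro divide_left_mono) auto
    then have w: "0 < 1 / z'" "1 / z' \<le> W" "1 / z' * \<bar>z'\<bar> \<le> W" "1 \<le> W"
      using that z \<zeta> by (auto simp: W)
    have side: "(\<forall>x\<in>{0..z - h}. x \<le> z' - h) \<or> (\<forall>x\<in>{0..z - h}. z' + h \<le> x)" using that by auto
    show ?thesis unfolding loop_event_def p_def
      using loop_bound_scaled[OF h_pos h1 nh w(1-3) side b r_small C0 small(3) w(4)] by blast
  qed
  have move: "move_event \<in> events" "prob move_event \<le> exp (- (n * h\<^sup>2 * (\<delta> / 4)))"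
  proof -
    show "move_event \<in> events" unfolding move_event_def by (rule edge_event)
    define \<zeta>' where "\<zeta>' = z - 3 * h"
    have \<zeta>': "0 < \<zeta>'" "\<zeta> / 2 \<le> \<zeta>'" using small(2) \<zeta> h_pos by (auto simp: \<zeta>'_def)
    define \<theta> where "\<theta> = 1 - 2 ^ 17 * h\<^sup>2 - (1 + 2 ^ 18 * h\<^sup>2 / \<zeta>') * (b / n / \<zeta>')"
    define U where "U = 17 * 2 ^ 17 * h"
    define Kc where "Kc = crowd_const \<alpha> Q"
    have U: "0 \<le> U" "U \<le> 1" using small(1) h_pos by (auto simp: U_def)
    have Q_pos: "0 \<le> Q" using C0 by (simp add: Q le_max_iff_disj)
    have Kc: "0 \<le> Kc" using \<alpha>_pos Q_pos by (simp add: Kc_def crowd_const_def)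
    show "prob move_event \<le> exp (- (n * h\<^sup>2 * (\<delta> / 4)))" unfolding move_event_def
    proof (rule edge_move[where \<sigma> = 1 and \<theta> = \<theta>, OF e h])
      show "17 * 2 ^ 17 * h \<le> 1" using U by (simp add: U_def)
      show "h \<le> 1 * (z - x)" if "x \<in> {0..z - h}" for x using that by simp
      show "0 \<le> \<delta> / 4" using \<delta> by simp
      fix x assume x: "x \<in> {0..z - h}" "0 < x" "r * x < 1" "1 * (z - x) < 3 * h"
      have "2 ^ 17 * h\<^sup>2 \<le> 1/2" "2 ^ 18 * h\<^sup>2 \<le> \<zeta>'" "\<zeta>' \<le> x"
        using h2 small(1,2) \<zeta>' x h_pos by (auto simp: \<zeta>'_def)
      note * = upper_force[OF h_pos this(1) b(1) r1 \<zeta>'(1) this(3,2) x(2,3) _ _ refl]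
      show "0 < x - 1 * (h\<^sup>2 * ramp h (1 * (z - x)) ^ 17) \<and> r * (x - 1 * (h\<^sup>2 * ramp h (1 * (z - x)) ^ 17)) < 1 \<and>
          n * h\<^sup>2 * ramp h (1 * (z - x)) ^ 17 * \<theta> \<le> (b - 1) * ln ((x - 1 * (h\<^sup>2 * ramp h (1 * (z - x)) ^ 17)) / x)
          + c * ln ((1 - r * (x - 1 * (h\<^sup>2 * ramp h (1 * (z - x)) ^ 17))) / (1 - r * x))"
        using *[of "ramp h (z - x)"] ramp_bounds[OF h_pos, of "z - x"] x(1) by (simp add: \<theta>_def)
    next
      have G2: "2 * \<alpha> * G = 1 - \<kappa> / z - \<delta> / 2" using \<alpha>_pos by (simp add: G_def)
      have "0 \<le> \<kappa> / z" using \<kappa> z by simp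
      then have "1 - \<kappa> / z - \<delta> / 2 \<le> 1" using \<delta> by linarith
      then have "U * (2 * \<alpha> * G) \<le> U * 1" unfolding G2 using U by (intro mult_left_mono) auto
      then have 1: "(1 + U) * (2 * \<alpha> * G) \<le> 1 - \<kappa> / z - \<delta> / 2 + U" unfolding G2 by (simp add: distrib_right)
      have "(1 + U) * (Kc * e) \<le> 2 * (Kc * e)" using U Kc e by (intro mult_right_mono) auto
      then have 2: "(1 + U) * (Kc * e) \<le> 2 * Kc * e" by simp
      have ziz: "\<kappa> / \<zeta>' \<le> \<kappa> / z + 6 * h * \<kappa>m / \<zeta>\<^sup>2"
      proof -
        have "\<kappa> / \<zeta>' = \<kappa> / z + 3 * h * \<kappa> / (z * \<zeta>')" using z \<zeta>' by (simp add: \<zeta>'_def field_simps)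
        also have "3 * h * \<kappa> / (z * \<zeta>') \<le> 3 * h * \<kappa>m / (\<zeta> * (\<zeta> / 2))"
          using h_pos \<kappa> \<zeta> \<zeta>' by (intro frac_le mult_mono mult_left_mono) auto
        finally show ?thesis by (simp add: power2_eq_square)
      qed
      have "2 ^ 18 * h\<^sup>2 / \<zeta>' * (\<kappa> / \<zeta>') \<le> 2 ^ 18 * h / (\<zeta> / 2) * (\<kappa>m / (\<zeta> / 2))"
        using h2 h_pos \<kappa> \<kappa>m \<zeta> \<zeta>' by (intro mult_mono frac_le) auto
      then have 3: "2 ^ 18 * h\<^sup>2 / \<zeta>' * (\<kappa> / \<zeta>') \<le> 2 ^ 20 * h * \<kappa>m / \<zeta>\<^sup>2" by (simp add: power2_eq_square)
      have \<theta>_ge: "1 - 2 ^ 17 * h - \<kappa> / z - (6 * h * \<kappa>m / \<zeta>\<^sup>2 + 2 ^ 20 * h * \<kappa>m / \<zeta>\<^sup>2) \<le> \<theta>"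
      proof -
        have "\<theta> = 1 - 2 ^ 17 * h\<^sup>2 - (\<kappa> / \<zeta>' + 2 ^ 18 * h\<^sup>2 / \<zeta>' * (\<kappa> / \<zeta>'))"
          unfolding \<theta>_def \<kappa>_def[symmetric] by (simp only: distrib_right mult_1_left)
        moreover have "(2::real) ^ 17 * h\<^sup>2 \<le> 2 ^ 17 * h" using h2 by simp
        ultimately show ?thesis using ziz 3 by linarith
      qed
      have "6 * h * \<kappa>m / \<zeta>\<^sup>2 + 2 ^ 20 * h * \<kappa>m / \<zeta>\<^sup>2 \<le> 2 ^ 21 * \<kappa>m / \<zeta>\<^sup>2 * h"
        using \<kappa>m h_pos \<zeta> by (simp add: field_simps)
      moreover have "U + 2 ^ 17 * h + 2 ^ 21 * \<kappa>m / \<zeta>\<^sup>2 * h + 2 * Kc * e \<le> S * e"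
      proof -
        have "(17 * 2 ^ 17 + 2 ^ 17 + 2 ^ 21 * \<kappa>m / \<zeta>\<^sup>2) * h \<le> (17 * 2 ^ 17 + 2 ^ 17 + 2 ^ 21 * \<kappa>m / \<zeta>\<^sup>2) * e"
          using h_e \<kappa>m by (intro mult_left_mono) auto
        then show ?thesis by (simp add: S U_def Kc_def distrib_right)
      qed
      ultimately show "(1 + 17 * 2 ^ 17 * h) * (2 * \<alpha> * G + crowd_const \<alpha> Q * e) + \<delta> / 4 \<le> \<theta>"
        using 1 2 \<theta>_ge small(8) \<delta> unfolding U_def[symmetric] Kc_def[symmetric] distrib_left[of "1 + U"] by linarith
    qed simp
  qed
  let ?E = "{\<omega>\<in>space M. (\<Sum>i=1..n. Y i \<omega>) \<le> C0 * n \<and> (\<exists>i\<in>{1..n}. z - Y i \<omega> \<le> 2 * h)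
      \<and> (\<forall>i\<in>{1..n}. Y i \<omega> \<in> {0..z - h})}"
  have "?E \<subseteq> (loop_event z \<union> loop_event (z + h\<^sup>2)) \<union> move_event"
  proof
    fix \<omega> assume \<omega>: "\<omega> \<in> ?E"
    define x where "x i = Y i \<omega>" for i
    have x: "0 \<le> x i \<and> x i \<le> z - h" if "i \<in> {1..n}" for i using \<omega> that by (simp add: x_def)
    have sum_x: "(\<Sum>i=1..n. x i) \<le> C0 * n" using \<omega> by (simp add: x_def)
    define g where "g = (\<Sum>i=1..n. 1 / (z - x i)) / n"
    define g' where "g' = (\<Sum>i=1..n. 1 / (z - x i + h\<^sup>2)) / n"
    define m where "m = (\<Sum>i=1..n. 1 / (z - x i)\<^sup>2) / n"
    have d: "h \<le> z - x i" if "i \<in> {1..n}" for i using x[OF that] by simp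
    note step = reciprocal_sum_step[where d = "\<lambda>i. z - x i", OF n_pos h_pos h1 d, folded g_def g'_def m_def]
    show "\<omega> \<in> (loop_event z \<union> loop_event (z + h\<^sup>2)) \<union> move_event"
    proof (rule ccontr)
      assume "\<not> ?thesis"
      then have no: "\<omega> \<notin> loop_event z" "\<omega> \<notin> loop_event (z + h\<^sup>2)" "\<omega> \<notin> move_event" by auto
      have "2 * \<alpha> * g \<le> 1 - \<kappa> / z - \<delta> / 2 \<and> m \<le> Q"
      \<comment> \<open>up to this size of \<open>z\<close> the precision \<open>h\<^sup>7\<close> resolves \<open>h\<^sup>2/(z (z + h\<^sup>2))\<close>\<close>
      proof (cases "z \<le> 1 / h\<^sup>2")
        case True
        have g: "stieltjes n z x = g" by (simp add: stieltjes_def g_def)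
        have g': "stieltjes n (z + h\<^sup>2) x = g'" by (simp add: stieltjes_def g'_def algebra_simps)
        have z': "0 < z + h\<^sup>2" using z by (simp add: add_pos_nonneg)
        have lp: "1 / y * loop_poly \<alpha> \<kappa> y f = \<alpha> * f\<^sup>2 - (1 - \<kappa> / y) * f + 1 / y" if "0 < y" for y f
          using that by (simp add: loop_poly_def field_simps)
        have "\<bar>1 / z * loop_poly \<alpha> \<kappa> z g\<bar> \<le> h ^ 7" "\<bar>1 / (z + h\<^sup>2) * loop_poly \<alpha> \<kappa> (z + h\<^sup>2) g'\<bar> \<le> h ^ 7"
          using no(1,2) \<omega> unfolding g[symmetric] g'[symmetric] loop_event_def \<kappa>_def[symmetric] x_def by auto
        then have loop: "\<bar>\<alpha> * g\<^sup>2 - (1 - \<kappa> / z) * g + 1 / z\<bar> \<le> h ^ 7"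
            "\<bar>\<alpha> * g'\<^sup>2 - (1 - \<kappa> / (z + h\<^sup>2)) * g' + 1 / (z + h\<^sup>2)\<bar> \<le> h ^ 7"
          unfolding lp[OF z] lp[OF z'] by auto
        have s1: "8 * h ^ 7 * (z * (z + h\<^sup>2)) \<le> h\<^sup>2"
        proof -
          have "h\<^sup>2 \<le> 1 / h\<^sup>2" using h1 h_pos by (simp add: le_divide_eq power_le_one flip: power_add)
          then have "z * (z + h\<^sup>2) \<le> 1 / h\<^sup>2 * (2 / h\<^sup>2)" using True z h_pos by (intro mult_mono) auto
          then have "8 * h ^ 7 * (z * (z + h\<^sup>2)) \<le> 8 * h ^ 7 * (1 / h\<^sup>2 * (2 / h\<^sup>2))" using h_pos by (intro mult_left_mono) auto
          also have "\<dots> = (16 * h) * h\<^sup>2" using h_pos by (simp add: eval_nat_numeral)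
          also have "\<dots> \<le> 1 * h\<^sup>2" using small(1) h_pos by (intro mult_right_mono) auto
          finally show ?thesis by simp
        qed
        have "16 * \<alpha> * h ^ 7 \<le> 16 * \<alpha> * h" using h7 \<alpha>_pos by (intro mult_left_mono) auto
        then have s3: "16 * \<alpha> * h ^ 7 \<le> \<delta>\<^sup>2" using small(5) by linarith
        have s2: "h ^ 7 \<le> \<alpha>" using h7 small(4) by linarith
        have ub: "2 * \<alpha> * g \<le> 1 - \<kappa> / z - \<delta> / 2" "m \<le> 4 / \<delta> * ((\<kappa> * (1 / \<alpha> + 1) + 2) / \<zeta>\<^sup>2)"
          using upper_branch[OF \<alpha>_pos \<kappa>(1) h_pos h1 \<delta>(1) \<zeta> disc[folded \<kappa>_def] step loop s1 s2 s3 small(6)] by auto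
        have "4 / \<delta> * ((\<kappa> * (1 / \<alpha> + 1) + 2) / \<zeta>\<^sup>2) \<le> 4 / \<delta> * ((\<kappa>m * (1 / \<alpha> + 1) + 2) / \<zeta>\<^sup>2)"
          using \<kappa> \<alpha>_pos \<delta> \<zeta> by (intro mult_left_mono divide_right_mono add_right_mono mult_right_mono) auto
        then show ?thesis using ub by (simp add: Q le_max_iff_disj)
      next
        case False
        then have zh: "1 / z \<le> h\<^sup>2" using h_pos z by (simp add: field_simps)
        note far = far_sums[OF n_pos h_pos z x sum_x, folded g_def m_def]
        have "2 / z + 2 * C0 / (z * h) = 2 * (1 / z) + 2 * C0 / h * (1 / z)" by simp
        also have "\<dots> \<le> 2 * h\<^sup>2 + 2 * C0 / h * h\<^sup>2" using zh C0 h_pos by (intro add_mono mult_left_mono) auto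
        also have "\<dots> \<le> 2 * h + 2 * C0 * h" using h2 h_pos by (simp add: power2_eq_square)
        finally have "g \<le> 2 * h + 2 * C0 * h" using far(1) by linarith
        then have "2 * \<alpha> * g \<le> 2 * \<alpha> * (2 * h + 2 * C0 * h)" using \<alpha>_pos by (intro mult_left_mono) auto
        moreover have "\<kappa> / z \<le> \<kappa>m * h"
        proof -
          have "\<kappa> * (1 / z) \<le> \<kappa>m * h\<^sup>2" using zh \<kappa> \<kappa>m z by (intro mult_mono) auto
          also have "\<dots> \<le> \<kappa>m * h" using h2 \<kappa>m by (intro mult_left_mono) auto
          finally show ?thesis by simp
        qed
        ultimately have "2 * \<alpha> * g \<le> 1 - \<kappa> / z - \<delta> / 2" using small(7) \<delta> by (simp add: algebra_simps)
        moreover have "m \<le> 4 + 2 * C0"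
        proof -
          have "1 / z \<le> 1" using zh h2 h1 by linarith
          then have "(1 / z)\<^sup>2 \<le> 1\<^sup>2" using z by (intro power_mono) auto
          then have "4 / z\<^sup>2 \<le> 4" by (simp add: power_divide)
          moreover have "2 * C0 / (z * h\<^sup>2) = 2 * C0 / h\<^sup>2 * (1 / z)" by simp
          moreover have "2 * C0 / h\<^sup>2 * (1 / z) \<le> 2 * C0 / h\<^sup>2 * h\<^sup>2" using zh C0 by (intro mult_left_mono) auto
          moreover have "2 * C0 / h\<^sup>2 * h\<^sup>2 = 2 * C0" using h_pos by simp
          ultimately show ?thesis using far(2) by linarith
        qed
        ultimately show ?thesis by (simp add: Q le_max_iff_disj)
      qed
      then have gm: "g \<le> G" "m \<le> Q" using \<alpha>_pos by (auto simp: G_def field_simps)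
      have "(\<Sum>i=1..n. 1 / (z - x i)\<^sup>2) = m * n" using n_pos by (simp add: m_def)
      also have "\<dots> \<le> Q * n" using gm by (intro mult_right_mono) auto
      finally have "(\<Sum>i=1..n. 1 / (z - x i)\<^sup>2) \<le> Q * n" .
      moreover have "stieltjes n z x \<le> G" using gm by (simp add: stieltjes_def g_def)
      ultimately have "\<omega> \<in> move_event" using \<omega> unfolding move_event_def x_def by simp
      then show False using no by blast
    qed
  qed
  then have "prob ?E \<le> prob (loop_event z \<union> loop_event (z + h\<^sup>2)) + prob move_event"
    using loops[of z] loops[of "z + h\<^sup>2"] move by (intro prob_subset_Un) auto
  also have "prob (loop_event z \<union> loop_event (z + h\<^sup>2)) \<le> prob (loop_event z) + prob (loop_event (z + h\<^sup>2))"
    using loops[of z] loops[of "z + h\<^sup>2"] by (intro measure_Un_le) auto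
  finally show ?thesis using loops[of z] loops[of "z + h\<^sup>2"] move(2) unfolding p_def by simp
qed

text \<open>
  The mirror image of \<open>upper_window\<close>, with the loop polynomial at \<open>z\<close> and \<open>z - h\<^sup>2\<close>. The value \<open>z \<ge> - h\<close> may be
  negative since the window of a particle near zero starts below zero.
\<close>

lemma lower_window:
  fixes e h z \<delta> \<kappa>m C0 Q S P :: real
  assumes e: "0 < e" "e \<le> 1" "real n * e ^ 20 = 1" and h: "h = e\<^sup>2"
    and b: "1 \<le> b" "b / n \<le> \<kappa>m" and r_small: "r * n \<le> 1" "r * (C0 * n) \<le> 1/2" and C0: "0 \<le> C0"
    and \<delta>: "0 < \<delta>" "\<delta> \<le> 1" and z: "- h \<le> z" "\<delta> \<le> b / n - z"
    and disc: "\<delta>\<^sup>2 \<le> (b / n - z)\<^sup>2 - 4 * \<alpha> * z"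
    and P: "P = \<kappa>m + 1"
    and Q: "Q = 4 / \<delta> * (16 * \<alpha> / \<delta>\<^sup>2 + 4 / \<delta> + 1)"
    and S: "S = 24 * \<alpha> / \<delta> + 17 * 2 ^ 17 * (P + 24 * \<alpha> / \<delta>) + 2 * crowd_const \<alpha> Q * P + 4 + 2 ^ 17 * P + 2 * P\<^sup>2 + 2 ^ 20 * P"
    and small: "2 ^ 25 * h \<le> 1" "4 * (2 + \<alpha> + 2 * C0) * (P + 1) * h \<le> 1" "4 * (C0 + 2) * h \<le> 1"
      "16 * \<alpha> * P * h \<le> \<delta>\<^sup>2" "2 * P * h \<le> \<delta>" "4 * P * h \<le> 1" "S * e \<le> \<delta> / 4"
  shows "prob {\<omega>\<in>space M. (\<Sum>i=1..n. Y i \<omega>) \<le> C0 * n \<and> (\<exists>i\<in>{1..n}. Y i \<omega> - z \<le> 2 * h)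
      \<and> (\<forall>i\<in>{1..n}. Y i \<omega> \<in> {z + h..1 / r})}
    \<le> 4 * exp (- (1 / (64 * (10 + 2 * \<kappa>m + 4 * \<alpha>) * (P + 1)\<^sup>2 * h\<^sup>2))) + exp (- (n * h\<^sup>2 * (\<delta> / (8 * P))))"
proof -
  define \<kappa> where "\<kappa> = b / n"
  define \<zeta> where "\<zeta> = z + 3 * h"
  \<comment> \<open>an upper bound for \<open>2 \<alpha> \<zeta> g\<close>: replacing \<open>z\<close> by \<open>\<zeta> = z + 3 h\<close> costs \<open>6 \<alpha> h g\<close>, and \<open>g \<le> 4/\<delta>\<close>\<close>
  define a where "a = \<kappa> - z - \<delta> / 2 + 24 * \<alpha> * h / \<delta>"
  define G where "G = a / (2 * \<alpha> * \<zeta>)"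
  define loop_event where "loop_event z' = {\<omega>\<in>space M. ((\<Sum>i=1..n. Y i \<omega>) \<le> C0 * n
      \<and> h ^ 7 \<le> \<bar>1 * loop_poly \<alpha> (b / n) z' (stieltjes n z' (\<lambda>i. Y i \<omega>))\<bar>) \<and> (\<forall>i\<in>{1..n}. Y i \<omega> \<in> {z + h..1 / r})}" for z'
  define move_event where "move_event = {\<omega>\<in>space M. ((\<exists>i\<in>{1..n}. - 1 * (z - Y i \<omega>) \<le> 2 * h) \<and> (\<Sum>i=1..n. 1 / (z - Y i \<omega>)\<^sup>2) \<le> Q * n
      \<and> - 1 * stieltjes n z (\<lambda>i. Y i \<omega>) \<le> G) \<and> (\<forall>i\<in>{1..n}. Y i \<omega> \<in> {z + h..1 / r})}"
  define p where "p = exp (- (1 / (64 * (10 + 2 * \<kappa>m + 4 * \<alpha>) * (P + 1)\<^sup>2 * h\<^sup>2)))"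
  have h_pos: "0 < h" using e by (simp add: h)
  have h_e: "h \<le> e" using e by (simp add: h power2_eq_square mult_left_le)
  have h1: "h \<le> 1" using h_e e by simp
  have h2: "h\<^sup>2 \<le> h" using h1 h_pos by (simp add: power2_eq_square mult_left_le)
  have h7: "h ^ 7 \<le> h" using power_decreasing[of 1 7 h] h1 h_pos by simp
  have h10: "h ^ 10 \<le> h" using power_decreasing[of 1 10 h] h1 h_pos by simp
  have nh: "real n * h ^ 10 = 1" using e(3) by (simp add: h flip: power_mult)
  have "1 / n = h ^ 10" using nh n_pos by (simp add: field_simps)
  then have inv_n: "1 / n \<le> h" using h10 by simp
  have \<kappa>: "0 \<le> \<kappa>" "\<kappa> \<le> \<kappa>m" using b by (auto simp: \<kappa>_def)
  have P1: "1 \<le> P" using \<kappa> by (simp add: P)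
  have z\<kappa>: "z \<le> \<kappa>" using z \<delta> by (simp add: \<kappa>_def)
  have r_le: "r \<le> 1 / n" using r_small(1) n_pos by (simp add: le_divide_eq)
  have rh: "r \<le> h" using r_le inv_n by linarith
  have r1: "r \<le> 1" using rh h1 by linarith
  have \<zeta>: "2 * h \<le> \<zeta>" "\<zeta> \<le> P"
    using z z\<kappa> \<kappa> small(1) by (auto simp: \<zeta>_def P)
  have \<zeta>_pos: "0 < \<zeta>" using \<zeta> h_pos by linarith
  have r\<zeta>: "r * \<zeta> \<le> h * P" using rh \<zeta> r_pos \<zeta>_pos h_pos by (intro mult_mono) auto
  have b0: "0 \<le> b" using b by linarith
  have loops: "loop_event z' \<in> events \<and> prob (loop_event z') \<le> 2 * p" if "z' \<le> z" "z - h\<^sup>2 \<le> z'" for z'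
  proof -
    have w: "0 < (1::real)" "1 \<le> P + 1" "1 * \<bar>z'\<bar> \<le> P + 1"
      using that z z\<kappa> \<kappa> h1 h2 P1 by (auto simp: P)
    have side: "(\<forall>x\<in>{z + h..1 / r}. x \<le> z' - h) \<or> (\<forall>x\<in>{z + h..1 / r}. z' + h \<le> x)" using that by auto
    show ?thesis unfolding loop_event_def p_def
      using loop_bound_scaled[OF h_pos h1 nh w side b0 b(2) r_small C0 small(2) w(2)] by blast
  qed
  have move: "move_event \<in> events" "prob move_event \<le> exp (- (n * h\<^sup>2 * (\<delta> / (8 * P))))"
  proof -
    show "move_event \<in> events" unfolding move_event_def by (rule edge_event)
    define \<theta> where "\<theta> = (b - 1) / n / \<zeta> * (1 - 2 ^ 17 * h) - (1 + 2 * (r * \<zeta>)) * (1 + 2 ^ 19 * h\<^sup>2)"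
    define U where "U = 17 * 2 ^ 17 * h"
    define Kc where "Kc = crowd_const \<alpha> Q"
    define A where "A = P + 24 * \<alpha> / \<delta>"
    have U: "0 \<le> U" "U \<le> 1" using small(1) h_pos by (auto simp: U_def)
    have Q_pos: "0 \<le> Q" using \<delta> \<alpha>_pos by (simp add: Q)
    have Kc: "0 \<le> Kc" using \<alpha>_pos Q_pos by (simp add: Kc_def crowd_const_def)
    show "prob move_event \<le> exp (- (n * h\<^sup>2 * (\<delta> / (8 * P))))" unfolding move_event_def
    proof (rule edge_move[where \<sigma> = "- 1" and \<theta> = \<theta>, OF e h])
      show "17 * 2 ^ 17 * h \<le> 1" using U by (simp add: U_def)
      show "h \<le> - 1 * (z - x)" if "x \<in> {z + h..1 / r}" for x using that by simp
      show "0 \<le> \<delta> / (8 * P)" using \<delta> P1 by simp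
      fix x assume x: "x \<in> {z + h..1 / r}" "0 < x" "r * x < 1" "- 1 * (z - x) < 3 * h"
      have hs: "2 ^ 19 * h\<^sup>2 \<le> 1" "2 ^ 17 * h \<le> 1" using h2 small(1) h_pos by auto
      have "4 * (h * P) \<le> 1" using small(6) by (simp add: mult_ac)
      then have zs: "h \<le> \<zeta>" "x \<le> \<zeta>" "r * \<zeta> \<le> 1/4"
        using \<zeta>(1) h_pos x(4) r\<zeta> by (auto simp: \<zeta>_def)
      note * = lower_force[OF h_pos hs b(1) r1 zs x(2) _ _ refl]
      show "0 < x - - 1 * (h\<^sup>2 * ramp h (- 1 * (z - x)) ^ 17) \<and> r * (x - - 1 * (h\<^sup>2 * ramp h (- 1 * (z - x)) ^ 17)) < 1 \<and>
          n * h\<^sup>2 * ramp h (- 1 * (z - x)) ^ 17 * \<theta> \<le> (b - 1) * ln ((x - - 1 * (h\<^sup>2 * ramp h (- 1 * (z - x)) ^ 17)) / x)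
          + c * ln ((1 - r * (x - - 1 * (h\<^sup>2 * ramp h (- 1 * (z - x)) ^ 17))) / (1 - r * x))"
        using *[of "ramp h (x - z)"] ramp_bounds[OF h_pos, of "x - z"] x(1) by (simp add: \<theta>_def)
    next
      have aG: "2 * \<alpha> * G * \<zeta> = a" using \<alpha>_pos \<zeta>_pos by (simp add: G_def)
      have a_le: "a \<le> A"
      proof -
        have "24 * \<alpha> * h / \<delta> \<le> 24 * \<alpha> * 1 / \<delta>" using h1 \<alpha>_pos \<delta> by (intro divide_right_mono mult_left_mono) auto
        then show ?thesis using z(1) \<kappa> \<delta> h1 by (simp add: a_def A_def P)
      qed
      have "U * a \<le> U * A" using a_le U by (intro mult_left_mono) auto
      then have 1: "(1 + U) * a \<le> a + U * A" by (simp add: distrib_right)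
      have "(1 + U) * (Kc * e * \<zeta>) \<le> 2 * (Kc * e * P)" using U Kc e \<zeta> \<zeta>_pos by (intro mult_mono mult_left_mono) auto
      then have 2: "(1 + U) * (Kc * e * \<zeta>) \<le> 2 * Kc * P * e" by (simp add: mult_ac)
      have 3: "\<delta> / (8 * P) * \<zeta> \<le> \<delta> / 8"
      proof -
        have "\<delta> / (8 * P) * \<zeta> \<le> \<delta> / (8 * P) * P" using \<zeta> \<delta> P1 by (intro mult_left_mono) auto
        then show ?thesis using P1 by simp
      qed
      have 4: "\<kappa> - h - 2 ^ 17 * P * h \<le> (b - 1) / n * (1 - 2 ^ 17 * h)"
      proof -
        have e1: "(b - 1) / n = \<kappa> - 1 / n" by (simp add: \<kappa>_def diff_divide_distrib)
        have "(\<kappa> - 1 / n) * (2 ^ 17 * h) \<le> P * (2 ^ 17 * h)"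
          using \<kappa> h_pos by (intro mult_right_mono) (auto simp: P intro: order_trans[of _ \<kappa>])
        moreover have "P * (2 ^ 17 * h) = 2 ^ 17 * P * h" by simp
        ultimately show ?thesis using inv_n unfolding e1 right_diff_distrib[of _ 1] mult_1_right by linarith
      qed
      have 5: "\<zeta> * ((1 + 2 * (r * \<zeta>)) * (1 + 2 ^ 19 * h\<^sup>2)) \<le> \<zeta> + 2 * P\<^sup>2 * h + 2 ^ 20 * P * h"
      proof -
        have "4 * (h * P) \<le> 1" using small(6) by (simp add: mult_ac)
        then have "2 * (r * \<zeta>) \<le> 1" using r\<zeta> by linarith
        then have "(1 + 2 * (r * \<zeta>)) * (2 ^ 19 * h\<^sup>2) \<le> 2 * (2 ^ 19 * h)"
          using h2 r_pos \<zeta>_pos by (intro mult_mono) auto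
        then have "(1 + 2 * (r * \<zeta>)) * (1 + 2 ^ 19 * h\<^sup>2) \<le> 1 + (2 * (h * P) + 2 ^ 20 * h)"
        proof -
          assume a: "(1 + 2 * (r * \<zeta>)) * (2 ^ 19 * h\<^sup>2) \<le> 2 * (2 ^ 19 * h)"
          have "2 * (2 ^ 19 * h) = 2 ^ 20 * h" by simp
          then show ?thesis
            using a r\<zeta> unfolding distrib_left[of "1 + 2 * (r * \<zeta>)"] mult_1_right by linarith
        qed
        then have "\<zeta> * ((1 + 2 * (r * \<zeta>)) * (1 + 2 ^ 19 * h\<^sup>2)) \<le> \<zeta> * (1 + (2 * (h * P) + 2 ^ 20 * h))"
          using \<zeta>_pos by (intro mult_left_mono) auto
        also have "\<dots> = \<zeta> + \<zeta> * (2 * (h * P) + 2 ^ 20 * h)" by (simp add: distrib_left)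
        also have "\<zeta> * (2 * (h * P) + 2 ^ 20 * h) \<le> P * (2 * (h * P) + 2 ^ 20 * h)"
          using \<zeta> h_pos P1 by (intro mult_right_mono) auto
        finally show ?thesis by (simp add: power2_eq_square algebra_simps)
      qed
      have "\<theta> * \<zeta> = (b - 1) / n * (1 - 2 ^ 17 * h) - \<zeta> * ((1 + 2 * (r * \<zeta>)) * (1 + 2 ^ 19 * h\<^sup>2))"
      proof -
        have "(x / \<zeta> * y - w) * \<zeta> = x * y - \<zeta> * w" for x y w
          using \<zeta>_pos by (simp add: left_diff_distrib)
        then show ?thesis unfolding \<theta>_def .
      qed
      then have 6: "\<kappa> - z - (4 + 2 ^ 17 * P + 2 * P\<^sup>2 + 2 ^ 20 * P) * h \<le> \<theta> * \<zeta>"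
        using 4 5 by (simp add: \<zeta>_def algebra_simps)
      have 7: "24 * \<alpha> * h / \<delta> + U * A + 2 * Kc * P * e + (4 + 2 ^ 17 * P + 2 * P\<^sup>2 + 2 ^ 20 * P) * h \<le> S * e"
      proof -
        have "(24 * \<alpha> / \<delta> + 17 * 2 ^ 17 * A + (4 + 2 ^ 17 * P + 2 * P\<^sup>2 + 2 ^ 20 * P)) * h
            \<le> (24 * \<alpha> / \<delta> + 17 * 2 ^ 17 * A + (4 + 2 ^ 17 * P + 2 * P\<^sup>2 + 2 ^ 20 * P)) * e"
          using h_e \<alpha>_pos \<delta> P1 by (intro mult_left_mono) (auto simp: A_def)
        then show ?thesis by (simp add: S U_def A_def Kc_def algebra_simps)
      qed
      have "(1 + U) * a + (1 + U) * (Kc * e * \<zeta>) + \<delta> / (8 * P) * \<zeta> \<le> \<theta> * \<zeta>"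
        using 1 2 3 6 7 small(7) \<delta> unfolding a_def by linarith
      moreover have "((1 + U) * (2 * \<alpha> * G + Kc * e) + \<delta> / (8 * P)) * \<zeta> = (1 + U) * a + (1 + U) * (Kc * e * \<zeta>) + \<delta> / (8 * P) * \<zeta>"
        unfolding aG[symmetric] by (simp add: algebra_simps)
      ultimately have "((1 + U) * (2 * \<alpha> * G + Kc * e) + \<delta> / (8 * P)) * \<zeta> \<le> \<theta> * \<zeta>" by linarith
      then show "(1 + 17 * 2 ^ 17 * h) * (2 * \<alpha> * G + crowd_const \<alpha> Q * e) + \<delta> / (8 * P) \<le> \<theta>"
        using \<zeta>_pos unfolding U_def Kc_def by simp
    qed simp
  qed
  let ?E = "{\<omega>\<in>space M. (\<Sum>i=1..n. Y i \<omega>) \<le> C0 * n \<and> (\<exists>i\<in>{1..n}. Y i \<omega> - z \<le> 2 * h)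
      \<and> (\<forall>i\<in>{1..n}. Y i \<omega> \<in> {z + h..1 / r})}"
  have "?E \<subseteq> (loop_event z \<union> loop_event (z - h\<^sup>2)) \<union> move_event"
  proof
    fix \<omega> assume \<omega>: "\<omega> \<in> ?E"
    define x where "x i = Y i \<omega>" for i
    have x: "z + h \<le> x i" if "i \<in> {1..n}" for i using \<omega> that by (simp add: x_def)
    have sum_x: "(\<Sum>i=1..n. x i) \<le> C0 * n" using \<omega> by (simp add: x_def)
    define g where "g = (\<Sum>i=1..n. 1 / (x i - z)) / n"
    define g' where "g' = (\<Sum>i=1..n. 1 / (x i - z + h\<^sup>2)) / n"
    define m where "m = (\<Sum>i=1..n. 1 / (x i - z)\<^sup>2) / n"
    have d: "h \<le> x i - z" if "i \<in> {1..n}" for i using x[OF that] by simp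
    note step = reciprocal_sum_step[where d = "\<lambda>i. x i - z", OF n_pos h_pos h1 d, folded g_def g'_def m_def]
    have \<gamma>: "1 / (C0 + 2) \<le> g'"
    proof -
      define B where "B = C0 + 2"
      have B: "0 < B" using C0 by (simp add: B_def)
      \<comment> \<open>\<open>1/y\<close> lies above its tangent at \<open>B\<close>; averaging gives Jensen's inequality for the mean of \<open>1/y\<close>\<close>
      have tangent: "2 / B - 2 / B\<^sup>2 - 1 / B\<^sup>2 * x i \<le> 1 / (x i - z + h\<^sup>2)" if i: "i \<in> {1..n}" for i
      proof -
        define y where "y = x i - z + h\<^sup>2"
        have y: "0 < y" "y \<le> x i + 2" using d[OF i] h_pos h2 h1 z(1) by (auto simp: y_def add_pos_nonneg)
        have "0 \<le> (y - B)\<^sup>2 / (y * B\<^sup>2)" using y B by simp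
        also have "\<dots> = 1 / y - (2 / B - y / B\<^sup>2)" using y B by (simp add: field_simps power2_eq_square)
        finally have "2 / B - y / B\<^sup>2 \<le> 1 / y" by simp
        moreover have "y / B\<^sup>2 \<le> (x i + 2) / B\<^sup>2" using y by (intro divide_right_mono) auto
        ultimately show ?thesis by (simp add: y_def add_divide_distrib)
      qed
      have C0_B: "C0 = B - 2" by (simp add: B_def)
      have "1 / B = 2 / B - 2 / B\<^sup>2 - 1 / B\<^sup>2 * C0"
        unfolding C0_B using B by (simp add: power2_eq_square field_simps)
      also have "\<dots> \<le> 2 / B - 2 / B\<^sup>2 - 1 / B\<^sup>2 * ((\<Sum>i=1..n. x i) / n)"
        using sum_x n_pos by (intro diff_left_mono mult_left_mono) (auto simp: divide_le_eq)
      also have "\<dots> = (\<Sum>i=1..n. 2 / B - 2 / B\<^sup>2 - 1 / B\<^sup>2 * x i) / n"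
        using n_pos by (simp add: sum_subtractf diff_divide_distrib flip: sum_distrib_left sum_divide_distrib)
      also have "\<dots> \<le> g'" unfolding g'_def by (intro divide_right_mono sum_mono tangent) auto
      finally show ?thesis by (simp add: B_def)
    qed
    show "\<omega> \<in> (loop_event z \<union> loop_event (z - h\<^sup>2)) \<union> move_event"
    proof (rule ccontr)
      assume "\<not> ?thesis"
      then have no: "\<omega> \<notin> loop_event z" "\<omega> \<notin> loop_event (z - h\<^sup>2)" "\<omega> \<notin> move_event" by auto
      have neg: "1 / (y - x i) = - (1 / (x i - y))" for y i by (metis minus_diff_eq minus_divide_right)
      have g: "stieltjes n z x = - g" unfolding stieltjes_def g_def neg by (simp add: sum_negf)
      have g': "stieltjes n (z - h\<^sup>2) x = - g'" unfolding stieltjes_def g'_def neg by (simp add: sum_negf algebra_simps)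
      have lp: "loop_poly \<alpha> \<kappa> y (- f) = \<alpha> * y * f\<^sup>2 - (\<kappa> - y) * f + 1" for y f
        by (simp add: loop_poly_def algebra_simps)
      have "\<bar>1 * loop_poly \<alpha> \<kappa> z (- g)\<bar> \<le> h ^ 7" "\<bar>1 * loop_poly \<alpha> \<kappa> (z - h\<^sup>2) (- g')\<bar> \<le> h ^ 7"
        using no(1,2) \<omega> unfolding g[symmetric] g'[symmetric] loop_event_def \<kappa>_def[symmetric] x_def by auto
      then have loop: "\<bar>\<alpha> * z * g\<^sup>2 - (\<kappa> - z) * g + 1\<bar> \<le> h ^ 7"
          "\<bar>\<alpha> * (z - h\<^sup>2) * g'\<^sup>2 - (\<kappa> - (z - h\<^sup>2)) * g' + 1\<bar> \<le> h ^ 7"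
        unfolding lp mult_1_left by auto
      have h73: "h ^ 7 \<le> h\<^sup>2 * h"
        using power_decreasing[of 3 7 h] h1 h_pos by (simp add: eval_nat_numeral)
      have s1: "4 * h ^ 7 \<le> h\<^sup>2 * (1 / (C0 + 2))"
      proof -
        have "4 * h \<le> 1 / (C0 + 2)" using small(3) C0 by (simp add: le_divide_eq mult_ac)
        then have "h\<^sup>2 * (4 * h) \<le> h\<^sup>2 * (1 / (C0 + 2))" by (intro mult_left_mono) auto
        then show ?thesis using h73 by linarith
      qed
      have s2: "2 * h ^ 7 \<le> h\<^sup>2"
      proof -
        have "h\<^sup>2 * (2 * h) \<le> h\<^sup>2 * 1" using small(1) h_pos by (intro mult_left_mono) auto
        then show ?thesis using h73 by linarith
      qed
      have s3: "16 * \<alpha> * (1 + \<kappa>) * h ^ 7 \<le> \<delta>\<^sup>2"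
      proof -
        have "16 * \<alpha> * (1 + \<kappa>) * h ^ 7 \<le> 16 * \<alpha> * P * h"
          using h7 \<alpha>_pos \<kappa> h_pos by (intro mult_mono) (auto simp: P)
        then show ?thesis using small(4) by linarith
      qed
      have s4: "2 * \<kappa> * h \<le> \<delta>"
      proof -
        have "2 * \<kappa> * h \<le> 2 * P * h" using \<kappa> h_pos by (intro mult_right_mono) (auto simp: P)
        then show ?thesis using small(5) by linarith
      qed
      have abs_z: "\<bar>z\<bar> \<le> 1 + \<kappa>" using z(1) z\<kappa> h1 \<kappa> by auto
      have \<gamma>_pos: "0 < 1 / (C0 + 2)" using C0 by simp
      have lb: "2 * \<alpha> * z * g \<le> \<kappa> - z - \<delta> / 2" "g \<le> 4 / \<delta>" "m \<le> Q"
        using lower_branch[OF \<alpha>_pos h_pos h1 \<delta>(1) z(2)[folded \<kappa>_def] abs_z \<gamma> \<gamma>_pos disc[folded \<kappa>_def] step(1-4) loop s1 s2 s3 s4]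
        by (auto simp: Q)
      have "6 * \<alpha> * h * g \<le> 6 * \<alpha> * h * (4 / \<delta>)" using lb(2) \<alpha>_pos h_pos by (intro mult_left_mono) auto
      then have "2 * \<alpha> * \<zeta> * g \<le> a" using lb(1) by (simp add: \<zeta>_def a_def algebra_simps)
      then have gG: "g \<le> G" using \<alpha>_pos \<zeta>_pos by (simp add: G_def le_divide_eq mult_ac)
      have "(\<Sum>i=1..n. 1 / (z - x i)\<^sup>2) = m * n" using n_pos by (simp add: m_def power2_commute)
      also have "\<dots> \<le> Q * n" using lb by (intro mult_right_mono) auto
      finally have "(\<Sum>i=1..n. 1 / (z - x i)\<^sup>2) \<le> Q * n" .
      moreover have "- stieltjes n z x \<le> G" using gG g by simp
      ultimately have "\<omega> \<in> move_event" using \<omega> unfolding move_event_def x_def by simp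
      then show False using no by blast
    qed
  qed
  then have "prob ?E \<le> prob (loop_event z \<union> loop_event (z - h\<^sup>2)) + prob move_event"
    using loops[of z] loops[of "z - h\<^sup>2"] move by (intro prob_subset_Un) auto
  also have "prob (loop_event z \<union> loop_event (z - h\<^sup>2)) \<le> prob (loop_event z) + prob (loop_event (z - h\<^sup>2))"
    using loops[of z] loops[of "z - h\<^sup>2"] by (intro measure_Un_le) auto
  finally show ?thesis using loops[of z] loops[of "z - h\<^sup>2"] move(2) unfolding p_def by simp
qed

section \<open>Tail bounds for the extreme particles\<close>

lemma window_event:
  "{\<omega>\<in>space M. ((\<Sum>i=1..n. Y i \<omega>) \<le> K \<and> (\<exists>i\<in>{1..n}. \<sigma> * (z - Y i \<omega>) \<le> k))
      \<and> (\<forall>i\<in>{1..n}. Y i \<omega> \<in> {l..u})} \<in> events"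
proof -
  note [measurable] = exists_near_pred[where \<sigma> = \<sigma> and z = z and k = k]
  have "Measurable.pred (\<Pi>\<^sub>M i\<in>{1..n}. borel) (\<lambda>x. (\<Sum>i=1..n. x i) \<le> K \<and> (\<exists>i\<in>{1..n}. \<sigma> * (z - x i) \<le> k))"
    by measurable
  from Y_event_box[OF this, of l u] show ?thesis by simp
qed

lemma sum_event: "{\<omega>\<in>space M. K \<le> (\<Sum>i=1..n. Y i \<omega>)} \<in> events"
proof -
  have "Measurable.pred (\<Pi>\<^sub>M i\<in>{1..n}. borel) (\<lambda>x. K \<le> (\<Sum>i=1..n. x i))" by measurable
  from Y_event[OF this] show ?thesis by simp
qed

lemma prob_covered:
  fixes E :: "nat \<Rightarrow> 'a set" and N :: nat and p q :: real
  assumes "AE \<omega> in M. \<omega> \<in> A \<longrightarrow> \<omega> \<in> B \<or> (\<exists>k<N. \<omega> \<in> E k)"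
    and "B \<in> events" "\<And>k. k < N \<Longrightarrow> E k \<in> events" "prob B \<le> q" "\<And>k. k < N \<Longrightarrow> prob (E k) \<le> p"
  shows "prob A \<le> q + N * p"
proof -
  have E: "(\<Union>k<N. E k) \<in> events" using assms(3) by auto
  have "prob A \<le> prob (B \<union> (\<Union>k<N. E k))"
    using assms(1,2) E by (intro finite_measure_mono_AE) (auto elim!: eventually_mono)
  also have "\<dots> \<le> prob B + prob (\<Union>k<N. E k)" using assms(2) E by (intro measure_Un_le)
  also have "prob (\<Union>k<N. E k) \<le> (\<Sum>k<N. prob (E k))"
    using assms(3) by (intro finite_measure_subadditive_finite) auto
  also have "\<dots> \<le> (\<Sum>k<N. p)" using assms(5) by (intro sum_mono) auto
  finally show ?thesis using assms(4) by simp
qed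

text \<open>
  Completing the square in \<open>g\<close> shows that \<open>loop_poly\<close> is at least \<open>s > 0\<close> for every real \<open>g\<close>, so that the whole event
  is contained in the event of \<open>loop_bound\<close>.
\<close>

lemma bulk_bound:
  fixes z h s W L \<kappa>m C0 C1 C2 l u :: real
  assumes h: "0 < h" "h \<le> 1" and z: "0 < z" "z \<le> W" "1 \<le> W" and L: "L = 2 * W / h\<^sup>2"
    and side: "(\<forall>x\<in>{l..u}. x \<le> z - h) \<or> (\<forall>x\<in>{l..u}. z + h \<le> x)"
    and b: "0 \<le> b" "b / n \<le> \<kappa>m" and r_small: "r * n \<le> 1" "r * (C0 * n) \<le> 1/2" and C0: "0 \<le> C0"
    and C1: "C1 = 2 + \<alpha> + 2 * C0" and C2: "C2 = 10 + 2 * \<kappa>m + 4 * \<alpha>"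
    and s: "2 * C1 * L / n \<le> s" "4 * \<alpha> * z * s \<le> 4 * \<alpha> * z - (b / n - z)\<^sup>2"
  shows "prob {\<omega>\<in>space M. (\<Sum>i=1..n. Y i \<omega>) \<le> C0 * n \<and> (\<forall>i\<in>{1..n}. Y i \<omega> \<in> {l..u})}
     \<le> exp (- ((real n)\<^sup>2 * s\<^sup>2 / (16 * C2 * L\<^sup>2)))"
proof -
  have "4 * \<alpha> * z * s \<le> 4 * \<alpha> * z * 1" using s(2) zero_le_power2[of "b / n - z"] by linarith
  then have s1: "s \<le> 1" using \<alpha>_pos z by simp
  have \<kappa>m: "0 \<le> \<kappa>m" using b n_pos by (meson divide_nonneg_nonneg of_nat_0_le_iff order_trans)
  have "h\<^sup>2 \<le> 1" using h by (simp add: power_le_one)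
  then have "1 \<le> L" using z h by (simp add: L le_divide_eq)
  then have "1 * 1 \<le> C2 * L" using \<alpha>_pos \<kappa>m by (intro mult_mono) (auto simp: C2)
  then have s2: "s \<le> C2 * L" using s1 by simp
  have pos: "s \<le> 1 * (1 * loop_poly \<alpha> (b / n) z g)" for g
  proof -
    have "4 * \<alpha> * z * loop_poly \<alpha> (b / n) z g = (2 * \<alpha> * z * g + (b / n - z))\<^sup>2 + (4 * \<alpha> * z - (b / n - z)\<^sup>2)"
      by (simp add: loop_poly_def power2_eq_square algebra_simps)
    moreover have "0 \<le> (2 * \<alpha> * z * g + (b / n - z))\<^sup>2" by simp
    ultimately have "4 * \<alpha> * z * s \<le> 4 * \<alpha> * z * loop_poly \<alpha> (b / n) z g" using s(2) by linarith
    then show ?thesis using \<alpha>_pos z by simp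
  qed
  have w: "0 < (1::real)" "1 \<le> W" "1 * \<bar>z\<bar> \<le> W" using z by auto
  show ?thesis
    using loop_bound[OF h w L side b r_small C0 C1 C2 s(1) s2, of 1] pos by simp
qed

text \<open>
  If the largest particle is at least \<open>z0\<close> and the sum of the particles is at most \<open>C0 n\<close>, the largest particle lies in one
  of the windows of length \<open>h\<close> that cover \<open>[z0, C0 n]\<close>, and \<open>upper_window\<close> applies with \<open>z\<close> at distance
  between \<open>h\<close> and \<open>2 h\<close> above it.
\<close>

lemma upper_tail:
  fixes e h z0 \<delta> \<kappa>m C0 Q S W :: real
  assumes e: "0 < e" "e \<le> 1" "real n * e ^ 20 = 1" and h: "h = e\<^sup>2"
    and b: "0 \<le> b" "b / n \<le> \<kappa>m" and r_small: "r * n \<le> 1" "r * (C0 * n) \<le> 1/2"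
    and C0: "2 * (b / n + 2 * \<alpha>) + 2 \<le> C0"
    and \<delta>: "0 < \<delta>" "\<delta> \<le> 1" and z0: "0 < z0"
    and disc: "\<And>z. z0 \<le> z \<Longrightarrow> \<delta>\<^sup>2 \<le> (1 - b / n / z)\<^sup>2 - 4 * \<alpha> / z"
    and W: "W = 1 + 1 / z0"
    and Q: "Q = max (4 / \<delta> * ((\<kappa>m * (1 / \<alpha> + 1) + 2) / z0\<^sup>2)) (4 + 2 * C0)"
    and S: "S = 17 * 2 ^ 17 + 2 * crowd_const \<alpha> Q + 2 ^ 17 + 2 ^ 21 * \<kappa>m / z0\<^sup>2"
    and small: "2 ^ 25 * h \<le> 1" "2 ^ 20 * h \<le> z0" "4 * (2 + \<alpha> + 2 * C0) * W * h \<le> 1" "h \<le> \<alpha>"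
      "16 * \<alpha> * h \<le> \<delta>\<^sup>2" "2 * (1 + \<alpha>) * h \<le> \<delta>" "(\<kappa>m + 4 * \<alpha> + 4 * \<alpha> * C0) * h \<le> 1/2" "S * e \<le> \<delta> / 4"
  shows "prob {\<omega>\<in>space M. \<exists>i\<in>{1..n}. z0 \<le> Y i \<omega>}
    \<le> exp (- (real n)\<^sup>2) + (C0 * n / h + 2) *
       (4 * exp (- (1 / (64 * (10 + 2 * \<kappa>m + 4 * \<alpha>) * W\<^sup>2 * h\<^sup>2))) + exp (- (n * h\<^sup>2 * (\<delta> / 4))))"
    (is "_ \<le> _ + _ * ?p")
proof -
  have C0_pos: "0 \<le> C0" 
    by (rule order_trans[OF _ C0]) (use b(1) \<alpha>_pos in \<open>simp add: add_nonneg_nonneg\<close>)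
  have h_pos: "0 < h" using e by (simp add: h)
  define N where "N = nat \<lfloor>C0 * n / h\<rfloor> + 1"
  have N: "real N \<le> C0 * n / h + 2" 
  proof -
    have "real N = of_int \<lfloor>C0 * n / h\<rfloor> + 1" using C0_pos h_pos by (simp add: N_def)
    then show ?thesis using of_int_floor_le[of "C0 * n / h"] by linarith
  qed
  define z where "z k = z0 + (real k + 2) * h" for k :: nat
  define E where "E k = {\<omega>\<in>space M. ((\<Sum>i=1..n. Y i \<omega>) \<le> C0 * n \<and> (\<exists>i\<in>{1..n}. 1 * (z k - Y i \<omega>) \<le> 2 * h))
      \<and> (\<forall>i\<in>{1..n}. Y i \<omega> \<in> {0..z k - h})}" for k
  have "prob {\<omega>\<in>space M. \<exists>i\<in>{1..n}. z0 \<le> Y i \<omega>} \<le> exp (- (real n)\<^sup>2) + N * ?p"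
  proof (rule prob_covered[where B = "{\<omega>\<in>space M. C0 * n \<le> (\<Sum>i=1..n. Y i \<omega>)}" and E = E])
    show "{\<omega>\<in>space M. C0 * n \<le> (\<Sum>i=1..n. Y i \<omega>)} \<in> events" by (rule sum_event)
    show "E k \<in> events" for k unfolding E_def by (rule window_event)
    show "prob {\<omega>\<in>space M. C0 * n \<le> (\<Sum>i=1..n. Y i \<omega>)} \<le> exp (- (real n)\<^sup>2)" by (rule sum_tail[OF b(1) C0])
    show "prob (E k) \<le> ?p" for k
    proof -
      have zk: "z0 \<le> z k" using h_pos by (simp add: z_def)
      show ?thesis
        using upper_window[OF e h b r_small C0_pos \<delta> z0 zk disc[OF zk] W Q S small]
        unfolding E_def by (simp add: conj_assoc)
    qed
    show "AE \<omega> in M. \<omega> \<in> {\<omega>\<in>space M. \<exists>i\<in>{1..n}. z0 \<le> Y i \<omega>} \<longrightarrow>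
        \<omega> \<in> {\<omega>\<in>space M. C0 * n \<le> (\<Sum>i=1..n. Y i \<omega>)} \<or> (\<exists>k<N. \<omega> \<in> E k)"
      using Y_bounds
    proof (eventually_elim, intro impI disjCI)
      fix \<omega> assume Y: "\<forall>i\<in>{1..n}. 0 < Y i \<omega> \<and> r * Y i \<omega> < 1"
        and A: "\<omega> \<in> {\<omega>\<in>space M. \<exists>i\<in>{1..n}. z0 \<le> Y i \<omega>}" and nE: "\<not> (\<exists>k<N. \<omega> \<in> E k)"
      show "\<omega> \<in> {\<omega>\<in>space M. C0 * n \<le> (\<Sum>i=1..n. Y i \<omega>)}"
      proof (rule ccontr)
        assume "\<not> ?thesis"
        then have sum: "(\<Sum>i=1..n. Y i \<omega>) \<le> C0 * n" using A by auto
        define x where "x = Max ((\<lambda>i. Y i \<omega>) ` {1..n})"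
        have x_max: "Y i \<omega> \<le> x" if "i \<in> {1..n}" for i using that by (auto simp: x_def)
        have "x \<in> (\<lambda>i. Y i \<omega>) ` {1..n}" unfolding x_def using n_pos by (intro Max_in) auto
        then obtain j where j: "j \<in> {1..n}" "x = Y j \<omega>" by auto
        have x0: "z0 \<le> x" using A x_max by force
        have "x \<le> (\<Sum>i=1..n. Y i \<omega>)" 
          unfolding j(2) by (rule member_le_sum) (use j Y in \<open>auto intro: less_imp_le\<close>)
        then have xC: "(x - z0) / h \<le> C0 * n / h" using sum z0 h_pos by (intro divide_right_mono) auto
        define k where "k = nat \<lfloor>(x - z0) / h\<rfloor>"
        have "0 \<le> (x - z0) / h" using x0 h_pos by simp
        then have "real k \<le> (x - z0) / h" "(x - z0) / h < real k + 1" unfolding k_def by linarith+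
        then have k: "z0 + k * h \<le> x" "x \<le> z0 + (k + 1) * h" using h_pos by (auto simp: field_simps)
        have "k < N" unfolding k_def N_def using xC by (simp add: floor_mono nat_mono less_Suc_eq_le)
        moreover have "\<omega> \<in> E k"
        proof -
          have "z k - Y j \<omega> \<le> 2 * h" using k j by (simp add: z_def algebra_simps)
          moreover have "Y i \<omega> \<in> {0..z k - h}" if "i \<in> {1..n}" for i
            using x_max[OF that] k Y that by (auto simp: z_def algebra_simps intro: less_imp_le)
          ultimately show ?thesis using A sum j by (auto simp: E_def)
        qed
        ultimately show False using nE by blast
      qed
    qed
  qed
  also have "N * ?p \<le> (C0 * n / h + 2) * ?p" using N by (intro mult_right_mono) auto
  finally show ?thesis by simp
qed

text \<open>
  Here the windows cover \<open>[0, z0]\<close>. A window may be unreachable, with its \<open>z\<close> above \<open>z0\<close>; it is then replaced by the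
  empty event.
\<close>

lemma lower_tail:
  fixes e h z0 \<delta> \<kappa>m C0 Q S P :: real
  assumes e: "0 < e" "e \<le> 1" "real n * e ^ 20 = 1" and h: "h = e\<^sup>2"
    and b: "1 \<le> b" "b / n \<le> \<kappa>m" and r_small: "r * n \<le> 1" "r * (C0 * n) \<le> 1/2"
    and C0: "2 * (b / n + 2 * \<alpha>) + 2 \<le> C0"
    and \<delta>: "0 < \<delta>" "\<delta> \<le> 1" and z0: "0 \<le> z0" "z0 \<le> P"
    and disc: "\<And>z. z \<le> z0 \<Longrightarrow> \<delta> \<le> b / n - z \<and> \<delta>\<^sup>2 \<le> (b / n - z)\<^sup>2 - 4 * \<alpha> * z"
    and P: "P = \<kappa>m + 1"
    and Q: "Q = 4 / \<delta> * (16 * \<alpha> / \<delta>\<^sup>2 + 4 / \<delta> + 1)"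
    and S: "S = 24 * \<alpha> / \<delta> + 17 * 2 ^ 17 * (P + 24 * \<alpha> / \<delta>) + 2 * crowd_const \<alpha> Q * P + 4 + 2 ^ 17 * P + 2 * P\<^sup>2 + 2 ^ 20 * P"
    and small: "2 ^ 25 * h \<le> 1" "4 * (2 + \<alpha> + 2 * C0) * (P + 1) * h \<le> 1" "4 * (C0 + 2) * h \<le> 1"
      "16 * \<alpha> * P * h \<le> \<delta>\<^sup>2" "2 * P * h \<le> \<delta>" "4 * P * h \<le> 1" "S * e \<le> \<delta> / 4"
  shows "prob {\<omega>\<in>space M. \<exists>i\<in>{1..n}. Y i \<omega> \<le> z0}
    \<le> exp (- (real n)\<^sup>2) + (P / h + 2) *
       (4 * exp (- (1 / (64 * (10 + 2 * \<kappa>m + 4 * \<alpha>) * (P + 1)\<^sup>2 * h\<^sup>2))) + exp (- (n * h\<^sup>2 * (\<delta> / (8 * P)))))"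
    (is "_ \<le> _ + _ * ?p")
proof -
  have b0: "0 \<le> b" using b by simp
  have C0_pos: "0 \<le> C0" 
    by (rule order_trans[OF _ C0]) (use b0 \<alpha>_pos in \<open>simp add: add_nonneg_nonneg\<close>)
  have h_pos: "0 < h" using e by (simp add: h)
  have P_pos: "0 \<le> P" using z0 by simp
  define N where "N = nat \<lfloor>P / h\<rfloor> + 1"
  have N: "real N \<le> P / h + 2" 
  proof -
    have "real N = of_int \<lfloor>P / h\<rfloor> + 1" using P_pos h_pos by (simp add: N_def)
    then show ?thesis using of_int_floor_le[of "P / h"] by linarith
  qed
  define z where "z k = (real k - 1) * h" for k :: nat
  define E where "E k = {\<omega>\<in>space M. ((\<Sum>i=1..n. Y i \<omega>) \<le> C0 * n \<and> (\<exists>i\<in>{1..n}. - 1 * (z k - Y i \<omega>) \<le> 2 * h))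
      \<and> (\<forall>i\<in>{1..n}. Y i \<omega> \<in> {z k + h..1 / r})}" for k
  define E' where "E' k = (if z k \<le> z0 then E k else {})" for k
  have "prob {\<omega>\<in>space M. \<exists>i\<in>{1..n}. Y i \<omega> \<le> z0} \<le> exp (- (real n)\<^sup>2) + N * ?p"
  proof (rule prob_covered[where B = "{\<omega>\<in>space M. C0 * n \<le> (\<Sum>i=1..n. Y i \<omega>)}" and E = E'])
    show "{\<omega>\<in>space M. C0 * n \<le> (\<Sum>i=1..n. Y i \<omega>)} \<in> events" by (rule sum_event)
    have "E k \<in> events" for k unfolding E_def by (rule window_event)
    then show "E' k \<in> events" for k by (simp add: E'_def)
    show "prob {\<omega>\<in>space M. C0 * n \<le> (\<Sum>i=1..n. Y i \<omega>)} \<le> exp (- (real n)\<^sup>2)" by (rule sum_tail[OF b0 C0])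
    show "prob (E' k) \<le> ?p" for k
    proof (cases "z k \<le> z0")
      case True
      have zk: "- h \<le> z k" using h_pos by (simp add: z_def left_diff_distrib)
      have "prob (E k) \<le> ?p"
        using lower_window[OF e h b r_small C0_pos \<delta> zk _ _ P Q S small] disc[OF True]
        unfolding E_def by (simp add: conj_assoc)
      then show ?thesis using True by (simp add: E'_def)
    qed (simp add: E'_def)
    show "AE \<omega> in M. \<omega> \<in> {\<omega>\<in>space M. \<exists>i\<in>{1..n}. Y i \<omega> \<le> z0} \<longrightarrow>
        \<omega> \<in> {\<omega>\<in>space M. C0 * n \<le> (\<Sum>i=1..n. Y i \<omega>)} \<or> (\<exists>k<N. \<omega> \<in> E' k)"
      using Y_bounds
    proof (eventually_elim, intro impI disjCI)
      fix \<omega> assume Y: "\<forall>i\<in>{1..n}. 0 < Y i \<omega> \<and> r * Y i \<omega> < 1"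
        and A: "\<omega> \<in> {\<omega>\<in>space M. \<exists>i\<in>{1..n}. Y i \<omega> \<le> z0}" and nE: "\<not> (\<exists>k<N. \<omega> \<in> E' k)"
      show "\<omega> \<in> {\<omega>\<in>space M. C0 * n \<le> (\<Sum>i=1..n. Y i \<omega>)}"
      proof (rule ccontr)
        assume "\<not> ?thesis"
        then have sum: "(\<Sum>i=1..n. Y i \<omega>) \<le> C0 * n" using A by auto
        define x where "x = Min ((\<lambda>i. Y i \<omega>) ` {1..n})"
        have x_min: "x \<le> Y i \<omega>" if "i \<in> {1..n}" for i using that by (auto simp: x_def)
        have "x \<in> (\<lambda>i. Y i \<omega>) ` {1..n}" unfolding x_def using n_pos by (intro Min_in) auto
        then obtain j where j: "j \<in> {1..n}" "x = Y j \<omega>" by auto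
        have x0: "x \<le> z0" using A x_min by force
        have x_pos: "0 < x" using j Y by auto
        have xC: "x / h \<le> P / h" using x0 z0 h_pos by (intro divide_right_mono) auto
        define k where "k = nat \<lfloor>x / h\<rfloor>"
        have "0 \<le> x / h" using x_pos h_pos by simp
        then have "real k \<le> x / h" "x / h < real k + 1" unfolding k_def by linarith+
        then have k: "k * h \<le> x" "x \<le> (k + 1) * h" using h_pos by (auto simp: field_simps)
        have "k < N" unfolding k_def N_def using xC by (simp add: floor_mono nat_mono less_Suc_eq_le)
        moreover have "\<omega> \<in> E' k"
        proof -
          have "- 1 * (z k - Y j \<omega>) \<le> 2 * h" using k j by (simp add: z_def algebra_simps)
          moreover have "Y i \<omega> \<in> {z k + h..1 / r}" if i: "i \<in> {1..n}" for i
          proof -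
            have "Y i \<omega> \<le> 1 / r" using Y i r_pos by (simp add: le_divide_eq mult.commute less_imp_le)
            then show ?thesis using x_min[OF i] k by (simp add: z_def algebra_simps)
          qed
          ultimately have "\<omega> \<in> E k" using A sum j unfolding E_def by blast
          moreover have "z k \<le> z0" using k x0 h_pos by (simp add: z_def algebra_simps)
          ultimately show ?thesis by (simp add: E'_def)
        qed
        ultimately show False using nE by blast
      qed
    qed
  qed
  also have "N * ?p \<le> (P / h + 2) * ?p" using N by (intro mult_right_mono) auto
  finally show ?thesis by simp
qed

end

lemma tail_bound_tendsto_0:
  fixes A B C :: real
  assumes "0 < A" "0 < B" "0 < C"
  shows "(\<lambda>n::nat. exp (- (real n)\<^sup>2) + (C * real n / real n powr (-1/10) + 2) *
      (4 * exp (- (1 / (A * (real n powr (-1/10))\<^sup>2))) + exp (- (real n * (real n powr (-1/10))\<^sup>2 * B)))) \<longlonglongrightarrow> 0"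
    and "(\<lambda>n::nat. exp (- (real n)\<^sup>2) + (C / real n powr (-1/10) + 2) *
      (4 * exp (- (1 / (A * (real n powr (-1/10))\<^sup>2))) + exp (- (real n * (real n powr (-1/10))\<^sup>2 * B)))) \<longlonglongrightarrow> 0"
  using assms by real_asymp+

section \<open>Convergence of the extreme particles\<close>

definition upper_edge :: "real \<Rightarrow> real \<Rightarrow> real" where
  "upper_edge \<alpha> k = (sqrt (k + \<alpha>) + sqrt \<alpha>)\<^sup>2"

definition lower_edge :: "real \<Rightarrow> real \<Rightarrow> real" where
  "lower_edge \<alpha> k = (sqrt (k + \<alpha>) - sqrt \<alpha>)\<^sup>2"

lemma edges_sum_prod:
  assumes "0 \<le> \<alpha>" "0 \<le> k"
  shows "upper_edge \<alpha> k + lower_edge \<alpha> k = 2 * (k + 2 * \<alpha>)"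
    and "upper_edge \<alpha> k * lower_edge \<alpha> k = k\<^sup>2"
proof -
  have s: "(sqrt (k + \<alpha>))\<^sup>2 = k + \<alpha>" "(sqrt \<alpha>)\<^sup>2 = \<alpha>" using assms by auto
  have "upper_edge \<alpha> k + lower_edge \<alpha> k = 2 * (sqrt (k + \<alpha>))\<^sup>2 + 2 * (sqrt \<alpha>)\<^sup>2"
    unfolding upper_edge_def lower_edge_def by (simp add: power2_sum power2_diff)
  then show "upper_edge \<alpha> k + lower_edge \<alpha> k = 2 * (k + 2 * \<alpha>)" using s by simp
  have "upper_edge \<alpha> k * lower_edge \<alpha> k = ((sqrt (k + \<alpha>))\<^sup>2 - (sqrt \<alpha>)\<^sup>2)\<^sup>2"
    unfolding upper_edge_def lower_edge_def by (simp only: power2_eq_square) (simp add: algebra_simps)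
  then show "upper_edge \<alpha> k * lower_edge \<alpha> k = k\<^sup>2" unfolding s by simp
qed

text \<open>
  This factorization identifies the limits of the extreme particles as the zeros of the discriminant of
  \<open>loop_poly\<close>.
\<close>

lemma discriminant_eq:
  assumes "0 \<le> \<alpha>" "0 \<le> k"
  shows "(k - z)\<^sup>2 - 4 * \<alpha> * z = (upper_edge \<alpha> k - z) * (lower_edge \<alpha> k - z)"
proof -
  have "(upper_edge \<alpha> k - z) * (lower_edge \<alpha> k - z)
      = upper_edge \<alpha> k * lower_edge \<alpha> k - z * (upper_edge \<alpha> k + lower_edge \<alpha> k) + z\<^sup>2"
    by (simp add: algebra_simps power2_eq_square)
  then show ?thesis unfolding edges_sum_prod[OF assms] by (simp add: algebra_simps power2_eq_square)
qed

lemma edges_order: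
  assumes "0 < \<alpha>" "0 \<le> k"
  shows "0 \<le> lower_edge \<alpha> k" "lower_edge \<alpha> k + 4 * \<alpha> \<le> upper_edge \<alpha> k" "lower_edge \<alpha> k \<le> k"
proof -
  show l0: "0 \<le> lower_edge \<alpha> k" by (simp add: lower_edge_def)
  have "sqrt \<alpha> * sqrt \<alpha> \<le> sqrt (k + \<alpha>) * sqrt \<alpha>" using assms by (intro mult_right_mono) auto
  moreover have "upper_edge \<alpha> k - lower_edge \<alpha> k = 4 * (sqrt (k + \<alpha>) * sqrt \<alpha>)"
    unfolding upper_edge_def lower_edge_def by (simp add: power2_sum power2_diff)
  ultimately show ul: "lower_edge \<alpha> k + 4 * \<alpha> \<le> upper_edge \<alpha> k" using assms by simp
  have "lower_edge \<alpha> k * lower_edge \<alpha> k \<le> upper_edge \<alpha> k * lower_edge \<alpha> k"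
    using l0 ul assms by (intro mult_right_mono) auto
  then have "(lower_edge \<alpha> k)\<^sup>2 \<le> k\<^sup>2" using edges_sum_prod(2)[of \<alpha> k] assms by (simp add: power2_eq_square)
  then show "lower_edge \<alpha> k \<le> k" by (rule power2_le_imp_le) (rule assms(2))
qed

locale jacobi_sequence =
  fixes M :: "nat \<Rightarrow> 'a measure" and X :: "nat \<Rightarrow> nat \<Rightarrow> 'a \<Rightarrow> real"
    and \<alpha> \<kappa> :: real and b c :: "nat \<Rightarrow> real"
  assumes \<alpha>_pos: "0 < \<alpha>" and \<kappa>_nonneg: "0 \<le> \<kappa>"
    and particles: "\<forall>\<^sub>F n in sequentially. jacobi_particles (M n) (X n) n \<alpha> (b n) (c n)"
    and b_nonneg: "\<forall>\<^sub>F n in sequentially. 0 \<le> b n"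
    and b_lim: "(\<lambda>n. b n / n) \<longlonglongrightarrow> \<kappa>"
    and c_lim: "(\<lambda>n. real n ^ 2 / c n) \<longlonglongrightarrow> 0"
begin

definition y :: "nat \<Rightarrow> nat \<Rightarrow> 'a \<Rightarrow> real" where
  "y n i \<omega> = X n i \<omega> / (n / c n)"

text \<open>
  The exponents satisfy \<open>n h\<^sup>1\<^sup>0 = 1\<close> and \<open>h = e\<^sup>2\<close>. The precision \<open>h\<^sup>7\<close> of the loop polynomial must be finer than
  \<open>h\<^sup>6\<close>, which is the size of the difference studied in \<open>upper_branch\<close> for \<open>z\<close> up to \<open>1/h\<^sup>2\<close>, and coarser than
  \<open>1/(n h\<^sup>2) = h\<^sup>8\<close>.
\<close>

definition h :: "nat \<Rightarrow> real" where "h n = real n powr (-1/10)"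

definition e :: "nat \<Rightarrow> real" where "e n = real n powr (-1/20)"

definition C0 :: real where "C0 = 2 * (\<kappa> + 1 + 2 * \<alpha>) + 2"

lemma C0_pos: "0 < C0"
  using \<alpha>_pos \<kappa>_nonneg by (simp add: C0_def)

lemma e_bounds: "0 < n \<Longrightarrow> 0 < e n \<and> e n \<le> 1 \<and> real n * e n ^ 20 = 1 \<and> h n = (e n)\<^sup>2"
proof -
  assume n: "0 < n"
  have pow: "(real n powr a) ^ k = real n powr (a * real k)" for a k
    using n by (simp add: powr_power mult.commute)
  have "e n ^ 20 = real n powr (- 1)" unfolding e_def pow by simp
  then have 1: "real n * e n ^ 20 = 1" using n by (simp add: powr_minus)
  have 2: "h n = (e n)\<^sup>2" unfolding e_def h_def pow by simp
  have "e n \<le> real n powr 0" unfolding e_def using n by (intro powr_mono) auto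
  then have 3: "e n \<le> 1" using n by simp
  have "0 < e n" unfolding e_def using n by simp
  with 1 2 3 show ?thesis by blast
qed

lemma h_lim: "h \<longlonglongrightarrow> 0" and e_lim: "e \<longlonglongrightarrow> 0"
  unfolding h_def[abs_def] e_def[abs_def] by real_asymp+

lemma h_small: "0 < B \<Longrightarrow> \<forall>\<^sub>F n in sequentially. A * h n \<le> B"
proof -
  assume "0 < B"
  with tendsto_mult_right_zero[OF h_lim, of A] have "\<forall>\<^sub>F n in sequentially. A * h n < B"
    by (rule order_tendstoD(2))
  then show ?thesis by eventually_elim (rule less_imp_le)
qed

lemma e_small: "0 < B \<Longrightarrow> \<forall>\<^sub>F n in sequentially. A * e n \<le> B"
proof -
  assume "0 < B"
  with tendsto_mult_right_zero[OF e_lim, of A] have "\<forall>\<^sub>F n in sequentially. A * e n < B"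
    by (rule order_tendstoD(2))
  then show ?thesis by eventually_elim (rule less_imp_le)
qed

definition regular :: "nat \<Rightarrow> bool" where
  "regular n \<longleftrightarrow> 0 < n \<and> jacobi_particles (M n) (X n) n \<alpha> (b n) (c n) \<and> 0 \<le> b n \<and> b n / n \<le> \<kappa> + 1
     \<and> n / c n * n \<le> 1 \<and> n / c n * (C0 * n) \<le> 1/2"

lemma eventually_regular: "\<forall>\<^sub>F n in sequentially. regular n"
proof -
  have 1: "\<forall>\<^sub>F n in sequentially. b n / n < \<kappa> + 1" using b_lim by (rule order_tendstoD) simp
  have 2: "\<forall>\<^sub>F n in sequentially. real n ^ 2 / c n < 1" using c_lim by (rule order_tendstoD) simp
  have 3: "\<forall>\<^sub>F n in sequentially. C0 * (real n ^ 2 / c n) < 1/2"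
    using tendsto_mult_right_zero[OF c_lim, of C0] by (rule order_tendstoD) simp
  show ?thesis using 1 2 3 eventually_gt_at_top[of 0] particles b_nonneg
    by eventually_elim (simp add: regular_def power2_eq_square mult_ac)
qed

lemma y_eq: "regular n \<Longrightarrow> y n i \<omega> = jacobi_particles.Y (X n) n (c n) i \<omega>"
proof -
  assume "regular n"
  then interpret jacobi_particles "M n" "X n" n \<alpha> "b n" "c n" by (simp add: regular_def)
  show ?thesis by (simp add: y_def Y_def r_def)
qed

lemma y_nonpos_null: "regular n \<Longrightarrow> u \<le> 0 \<Longrightarrow> measure (M n) {\<omega>\<in>space (M n). \<exists>i\<in>{1..n}. y n i \<omega> \<le> u} = 0"
proof -
  assume reg: "regular n" and u: "u \<le> 0"
  interpret jacobi_particles "M n" "X n" n \<alpha> "b n" "c n" using reg by (simp add: regular_def)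
  have "prob {\<omega>\<in>space (M n). \<exists>i\<in>{1..n}. Y i \<omega> \<le> u} \<le> prob {}"
  proof (rule finite_measure_mono_AE)
    show "AE \<omega> in M n. \<omega> \<in> {\<omega>\<in>space (M n). \<exists>i\<in>{1..n}. Y i \<omega> \<le> u} \<longrightarrow> \<omega> \<in> {}"
      using Y_bounds
    proof eventually_elim
      case (elim \<omega>)
      have "\<not> Y i \<omega> \<le> u" if "i \<in> {1..n}" for i using bspec[OF elim that] u by linarith
      then show ?case by blast
    qed
  qed simp
  then have "prob {\<omega>\<in>space (M n). \<exists>i\<in>{1..n}. Y i \<omega> \<le> u} = 0" by (simp add: measure_le_0_iff)
  then show ?thesis unfolding y_eq[OF reg] .
qed

lemma edge_lim:
  "(\<lambda>n. upper_edge \<alpha> (b n / n)) \<longlonglongrightarrow> upper_edge \<alpha> \<kappa>" "(\<lambda>n. lower_edge \<alpha> (b n / n)) \<longlonglongrightarrow> lower_edge \<alpha> \<kappa>"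
proof -
  have "(\<lambda>n. sqrt (b n / n + \<alpha>)) \<longlonglongrightarrow> sqrt (\<kappa> + \<alpha>)"
    by (rule tendsto_real_sqrt[OF tendsto_add[OF b_lim tendsto_const]])
  note root = this
  show "(\<lambda>n. upper_edge \<alpha> (b n / n)) \<longlonglongrightarrow> upper_edge \<alpha> \<kappa>"
    unfolding upper_edge_def by (rule tendsto_power[OF tendsto_add[OF root tendsto_const]])
  show "(\<lambda>n. lower_edge \<alpha> (b n / n)) \<longlonglongrightarrow> lower_edge \<alpha> \<kappa>"
    unfolding lower_edge_def by (rule tendsto_power[OF tendsto_diff[OF root tendsto_const]])
qed

lemma no_upper_outlier:
  assumes \<epsilon>: "0 < \<epsilon>"
  shows "(\<lambda>n. measure (M n) {\<omega>\<in>space (M n). \<exists>i\<in>{1..n}. upper_edge \<alpha> \<kappa> + \<epsilon> \<le> y n i \<omega>}) \<longlonglongrightarrow> 0"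
proof -
  define E where "E = upper_edge \<alpha> \<kappa>"
  define z0 where "z0 = E + \<epsilon>"
  define \<delta> where "\<delta> = (\<epsilon> / 2) / z0"
  define \<kappa>m where "\<kappa>m = \<kappa> + 1"
  define W where "W = 1 + 1 / z0"
  define Q where "Q = max (4 / \<delta> * ((\<kappa>m * (1 / \<alpha> + 1) + 2) / z0\<^sup>2)) (4 + 2 * C0)"
  define S where "S = 17 * 2 ^ 17 + 2 * crowd_const \<alpha> Q + 2 ^ 17 + 2 ^ 21 * \<kappa>m / z0\<^sup>2"
  have E: "0 \<le> E" using edges_order[OF \<alpha>_pos \<kappa>_nonneg] \<alpha>_pos by (simp add: E_def)
  have z0: "0 < z0" using E \<epsilon> by (simp add: z0_def)
  have \<delta>: "0 < \<delta>" "\<delta> \<le> 1" using \<epsilon> z0 E by (auto simp: \<delta>_def z0_def divide_le_eq)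
  have \<kappa>m: "0 \<le> \<kappa>m" using \<kappa>_nonneg by (simp add: \<kappa>m_def)
  have pos: "0 < (1::real)" "0 < (1/2::real)" "0 < \<delta>\<^sup>2" "0 < \<delta> / 4" using \<delta> by auto
  let ?bound = "\<lambda>n::nat. exp (- (real n)\<^sup>2) + (C0 * n / h n + 2) *
       (4 * exp (- (1 / (64 * (10 + 2 * \<kappa>m + 4 * \<alpha>) * W\<^sup>2 * (h n)\<^sup>2))) + exp (- (n * (h n)\<^sup>2 * (\<delta> / 4))))"
  have "\<forall>\<^sub>F n in sequentially. upper_edge \<alpha> (b n / n) < E + \<epsilon> / 2"
    using edge_lim(1) \<epsilon> by (intro order_tendstoD) (auto simp: E_def)
  then have "\<forall>\<^sub>F n in sequentially. norm (measure (M n) {\<omega>\<in>space (M n). \<exists>i\<in>{1..n}. z0 \<le> y n i \<omega>}) \<le> ?bound n"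
    using eventually_regular
      h_small[OF pos(1), of "2 ^ 25"] h_small[OF z0, of "2 ^ 20"]
      h_small[OF pos(1), of "4 * (2 + \<alpha> + 2 * C0) * W"] h_small[OF \<alpha>_pos, of 1]
      h_small[OF pos(3), of "16 * \<alpha>"] h_small[OF \<delta>(1), of "2 * (1 + \<alpha>)"]
      h_small[OF pos(2), of "\<kappa>m + 4 * \<alpha> + 4 * \<alpha> * C0"] e_small[OF pos(4), of S]
  proof eventually_elim
    case (elim n)
    interpret jacobi_particles "M n" "X n" n \<alpha> "b n" "c n" using elim(2) by (simp add: regular_def)
    have reg: "0 < n" "0 \<le> b n" "b n / n \<le> \<kappa>m" "r * n \<le> 1" "r * (C0 * n) \<le> 1/2"
      using elim(2) by (auto simp: regular_def r_def \<kappa>m_def)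
    have en: "0 < e n" "e n \<le> 1" "real n * e n ^ 20 = 1" "h n = (e n)\<^sup>2" using e_bounds[OF reg(1)] by auto
    have k0: "0 \<le> b n / n" using reg by simp
    have C0: "2 * (b n / n + 2 * \<alpha>) + 2 \<le> C0" using reg(3) by (simp add: C0_def \<kappa>m_def)
    have disc: "\<delta>\<^sup>2 \<le> (1 - b n / n / z)\<^sup>2 - 4 * \<alpha> / z" if z: "z0 \<le> z" for z
    proof -
      have zp: "0 < z" using z z0 by linarith
      let ?U = "upper_edge \<alpha> (b n / n)" and ?L = "lower_edge \<alpha> (b n / n)"
      have "?U / z \<le> (E + \<epsilon> / 2) / z0" using elim(1) z z0 E \<epsilon> by (intro frac_le) auto
      also have "\<dots> = 1 - \<delta>" using z0 by (simp add: \<delta>_def z0_def field_simps)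
      finally have 1: "\<delta> \<le> 1 - ?U / z" by simp
      have "?L / z \<le> ?U / z" using edges_order[OF \<alpha>_pos k0] zp \<alpha>_pos by (intro divide_right_mono) auto
      then have 2: "\<delta> \<le> 1 - ?L / z" using 1 by linarith
      have "\<delta> * \<delta> \<le> (1 - ?U / z) * (1 - ?L / z)" using 1 2 \<delta> by (intro mult_mono) auto
      also have "\<dots> = ((?U - z) * (?L - z)) / z\<^sup>2" using zp by (simp add: field_simps power2_eq_square)
      also have "\<dots> = ((b n / n - z)\<^sup>2 - 4 * \<alpha> * z) / z\<^sup>2"
        using discriminant_eq[of \<alpha> "b n / n" z] \<alpha>_pos k0 by simp
      also have "\<dots> = (1 - b n / n / z)\<^sup>2 - 4 * \<alpha> / z"
      proof -
        have "(k - z)\<^sup>2 / z\<^sup>2 = (1 - k / z)\<^sup>2" for k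
          using zp by (simp add: power2_commute[of k] diff_divide_distrib flip: power_divide)
        moreover have "4 * \<alpha> * z / z\<^sup>2 = 4 * \<alpha> / z" using zp by (simp add: power2_eq_square)
        ultimately show ?thesis by (simp only: diff_divide_distrib)
      qed
      finally show ?thesis by (simp add: power2_eq_square)
    qed
    have small4: "h n \<le> \<alpha>" using elim(6) by simp
    show ?case
      unfolding y_eq[OF elim(2)] real_norm_def abs_of_nonneg[OF measure_nonneg]
      by (rule upper_tail[OF en reg(2-5) C0 \<delta> z0 disc W_def Q_def S_def elim(3,4,5) small4 elim(7-10)])
  qed
  moreover have "?bound \<longlonglongrightarrow> 0"
  proof -
    have "0 < W" using z0 by (simp add: W_def add_pos_pos)
    then have "0 < W\<^sup>2" by simp
    moreover have "0 < 10 + 2 * \<kappa>m + 4 * \<alpha>" using \<alpha>_pos \<kappa>m by linarith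
    ultimately have "0 < 64 * (10 + 2 * \<kappa>m + 4 * \<alpha>) * W\<^sup>2" by simp
    from tail_bound_tendsto_0(1)[OF this pos(4) C0_pos] show ?thesis unfolding h_def .
  qed
  ultimately show ?thesis unfolding z0_def E_def by (rule Lim_null_comparison)
qed

text \<open>
  If \<open>lower_edge \<alpha> \<kappa> \<le> \<epsilon>\<close>, in particular for \<open>\<kappa> = 0\<close>, there is nothing to exclude because the particles are positive. Otherwise
  \<open>\<kappa> > 0\<close>, hence \<open>b\<close> tends to infinity.
\<close>

lemma no_lower_outlier:
  assumes \<epsilon>: "0 < \<epsilon>"
  shows "(\<lambda>n. measure (M n) {\<omega>\<in>space (M n). \<exists>i\<in>{1..n}. y n i \<omega> \<le> lower_edge \<alpha> \<kappa> - \<epsilon>}) \<longlonglongrightarrow> 0"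
proof (cases "lower_edge \<alpha> \<kappa> - \<epsilon> \<le> 0")
  case True
  have "\<forall>\<^sub>F n in sequentially. measure (M n) {\<omega>\<in>space (M n). \<exists>i\<in>{1..n}. y n i \<omega> \<le> lower_edge \<alpha> \<kappa> - \<epsilon>} = 0"
    using eventually_regular 
  proof eventually_elim
    case (elim n)
    show ?case by (rule y_nonpos_null[OF elim True])
  qed
  then show ?thesis by (rule tendsto_eventually)
next
  case False
  define z0 where "z0 = lower_edge \<alpha> \<kappa> - \<epsilon>"
  define \<delta> where "\<delta> = min 1 (\<epsilon> / 2)"
  define \<kappa>m where "\<kappa>m = \<kappa> + 1"
  define P where "P = \<kappa>m + 1"
  define Q where "Q = 4 / \<delta> * (16 * \<alpha> / \<delta>\<^sup>2 + 4 / \<delta> + 1)"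
  define S where "S = 24 * \<alpha> / \<delta> + 17 * 2 ^ 17 * (P + 24 * \<alpha> / \<delta>) + 2 * crowd_const \<alpha> Q * P + 4 + 2 ^ 17 * P + 2 * P\<^sup>2 + 2 ^ 20 * P"
  have z0: "0 \<le> z0" "z0 \<le> P"
    using False edges_order[OF \<alpha>_pos \<kappa>_nonneg] \<epsilon> by (auto simp: z0_def P_def \<kappa>m_def)
  have \<kappa>_pos: "0 < \<kappa>" using False edges_order[OF \<alpha>_pos \<kappa>_nonneg] \<epsilon> by linarith
  have \<delta>: "0 < \<delta>" "\<delta> \<le> 1" "\<delta> \<le> \<epsilon> / 2" using \<epsilon> by (auto simp: \<delta>_def)
  have \<kappa>m: "0 \<le> \<kappa>m" using \<kappa>_nonneg by (simp add: \<kappa>m_def)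
  have P: "0 < P" using \<kappa>m by (simp add: P_def)
  have pos: "0 < (1::real)" "0 < (1/2::real)" "0 < \<delta>\<^sup>2" "0 < \<delta> / 4" using \<delta> by auto
  let ?bound = "\<lambda>n::nat. exp (- (real n)\<^sup>2) + (P / h n + 2) *
       (4 * exp (- (1 / (64 * (10 + 2 * \<kappa>m + 4 * \<alpha>) * (P + 1)\<^sup>2 * (h n)\<^sup>2))) + exp (- (n * (h n)\<^sup>2 * (\<delta> / (8 * P)))))"
  have ev1: "\<forall>\<^sub>F n in sequentially. lower_edge \<alpha> \<kappa> - \<epsilon> / 2 < lower_edge \<alpha> (b n / n)"
    using edge_lim(2) \<epsilon> by (intro order_tendstoD) auto
  have "filterlim b at_top sequentially"
  proof -
    have lim: "filterlim (\<lambda>n. (b n / n) * real n) at_top sequentially"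
      by (rule filterlim_tendsto_pos_mult_at_top[OF b_lim \<kappa>_pos filterlim_real_sequentially])
    have eq: "\<forall>\<^sub>F n in sequentially. b n / n * real n = b n"
      using eventually_gt_at_top[of 0] by eventually_elim simp
    show ?thesis by (rule iffD1[OF filterlim_cong[OF refl refl eq] lim])
  qed
  then have ev2: "\<forall>\<^sub>F n in sequentially. 1 \<le> b n" by (simp add: filterlim_at_top)
  have "\<forall>\<^sub>F n in sequentially. norm (measure (M n) {\<omega>\<in>space (M n). \<exists>i\<in>{1..n}. y n i \<omega> \<le> z0}) \<le> ?bound n"
    using ev1 eventually_regular ev2
      h_small[OF pos(1), of "2 ^ 25"] h_small[OF pos(1), of "4 * (2 + \<alpha> + 2 * C0) * (P + 1)"]
      h_small[OF pos(1), of "4 * (C0 + 2)"] h_small[OF pos(3), of "16 * \<alpha> * P"]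
      h_small[OF \<delta>(1), of "2 * P"] h_small[OF pos(1), of "4 * P"] e_small[OF pos(4), of S]
  proof eventually_elim
    case (elim n)
    interpret jacobi_particles "M n" "X n" n \<alpha> "b n" "c n" using elim(2) by (simp add: regular_def)
    have reg: "0 < n" "0 \<le> b n" "b n / n \<le> \<kappa>m" "r * n \<le> 1" "r * (C0 * n) \<le> 1/2"
      using elim(2) by (auto simp: regular_def r_def \<kappa>m_def)
    have en: "0 < e n" "e n \<le> 1" "real n * e n ^ 20 = 1" "h n = (e n)\<^sup>2" using e_bounds[OF reg(1)] by auto
    have k0: "0 \<le> b n / n" using reg by simp
    have C0: "2 * (b n / n + 2 * \<alpha>) + 2 \<le> C0" using reg(3) by (simp add: C0_def \<kappa>m_def)
    have disc: "\<delta> \<le> b n / n - z \<and> \<delta>\<^sup>2 \<le> (b n / n - z)\<^sup>2 - 4 * \<alpha> * z" if z: "z \<le> z0" for z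
    proof
      let ?U = "upper_edge \<alpha> (b n / n)" and ?L = "lower_edge \<alpha> (b n / n)"
      note ord = edges_order[OF \<alpha>_pos k0]
      have L: "\<delta> \<le> ?L - z" using elim(1) z \<delta> by (simp add: z0_def)
      have U: "\<delta> \<le> ?U - z" using L ord \<alpha>_pos by linarith
      show "\<delta> \<le> b n / n - z" using L ord by linarith
      have "\<delta> * \<delta> \<le> (?U - z) * (?L - z)" using L U \<delta> by (intro mult_mono) auto
      then show "\<delta>\<^sup>2 \<le> (b n / n - z)\<^sup>2 - 4 * \<alpha> * z"
        using discriminant_eq[of \<alpha> "b n / n" z] \<alpha>_pos k0 by (simp add: power2_eq_square)
    qed
    show ?case
      unfolding y_eq[OF elim(2)] real_norm_def abs_of_nonneg[OF measure_nonneg]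
      by (rule lower_tail[OF en elim(3) reg(3-5) C0 \<delta>(1,2) z0 disc P_def Q_def S_def elim(4-10)])
  qed
  moreover have "?bound \<longlonglongrightarrow> 0"
  proof -
    have "0 < (P + 1)\<^sup>2" using P by simp
    moreover have "0 < 10 + 2 * \<kappa>m + 4 * \<alpha>" using \<alpha>_pos \<kappa>m by linarith
    ultimately have A: "0 < 64 * (10 + 2 * \<kappa>m + 4 * \<alpha>) * (P + 1)\<^sup>2" by simp
    have "0 < \<delta> / (8 * P)" using P \<delta> by simp
    from tail_bound_tendsto_0(2)[OF A this P] show ?thesis unfolding h_def .
  qed
  ultimately show ?thesis unfolding z0_def by (rule Lim_null_comparison)
qed

lemma bulk_not_empty:
  fixes z d :: real and l u :: "nat \<Rightarrow> real"
  assumes d: "0 < d" "d \<le> 1" and z: "0 < z"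
    and side: "\<And>n. (\<forall>x\<in>{l n..u n}. x \<le> z - d) \<or> (\<forall>x\<in>{l n..u n}. z + d \<le> x)"
    and inside: "0 < \<rho>" "\<forall>\<^sub>F n in sequentially. \<rho> \<le> (upper_edge \<alpha> (b n / n) - z) * (z - lower_edge \<alpha> (b n / n))"
  shows "(\<lambda>n. measure (M n) {\<omega>\<in>space (M n). \<forall>i\<in>{1..n}. y n i \<omega> \<in> {l n..u n}}) \<longlonglongrightarrow> 0"
proof -
  define \<kappa>m where "\<kappa>m = \<kappa> + 1"
  define W where "W = 1 + z"
  define L where "L = 2 * W / d\<^sup>2"
  define C1 where "C1 = 2 + \<alpha> + 2 * C0"
  define C2 where "C2 = 10 + 2 * \<kappa>m + 4 * \<alpha>"
  define s where "s = \<rho> / (4 * \<alpha> * z)"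
  have s_pos: "0 < s" using inside \<alpha>_pos z by (simp add: s_def)
  have C2_pos: "0 < C2" using \<alpha>_pos \<kappa>_nonneg by (simp add: C2_def \<kappa>m_def)
  have L_pos: "0 < L" using z d by (simp add: L_def W_def)
  have "(\<lambda>n. 2 * C1 * L / real n) \<longlonglongrightarrow> 0" by (rule lim_const_over_n)
  then have ev: "\<forall>\<^sub>F n in sequentially. 2 * C1 * L / real n < s" using s_pos by (rule order_tendstoD)
  let ?bound = "\<lambda>n::nat. exp (- (real n)\<^sup>2) + exp (- ((real n)\<^sup>2 * s\<^sup>2 / (16 * C2 * L\<^sup>2)))"
  have "\<forall>\<^sub>F n in sequentially. norm (measure (M n) {\<omega>\<in>space (M n). \<forall>i\<in>{1..n}. y n i \<omega> \<in> {l n..u n}}) \<le> ?bound n"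
    using ev inside(2) eventually_regular
  proof eventually_elim
    case (elim n)
    interpret jacobi_particles "M n" "X n" n \<alpha> "b n" "c n" using elim(3) by (simp add: regular_def)
    have reg: "0 < n" "0 \<le> b n" "b n / n \<le> \<kappa>m" "r * n \<le> 1" "r * (C0 * n) \<le> 1/2"
      using elim(3) by (auto simp: regular_def r_def \<kappa>m_def)
    have k0: "0 \<le> b n / n" using reg by simp
    have C0: "2 * (b n / n + 2 * \<alpha>) + 2 \<le> C0" using reg(3) by (simp add: C0_def \<kappa>m_def)
    have "4 * \<alpha> * z * s = \<rho>" using \<alpha>_pos z by (simp add: s_def)
    also have "\<dots> \<le> - ((upper_edge \<alpha> (b n / n) - z) * (lower_edge \<alpha> (b n / n) - z))"
      using elim(2) by (simp add: algebra_simps)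
    also have "\<dots> = 4 * \<alpha> * z - (b n / n - z)\<^sup>2"
      using discriminant_eq[of \<alpha> "b n / n" z] \<alpha>_pos k0 by simp
    finally have s2: "4 * \<alpha> * z * s \<le> 4 * \<alpha> * z - (b n / n - z)\<^sup>2" .
    have W: "z \<le> W" "1 \<le> W" using z by (auto simp: W_def)
    let ?A = "{\<omega>\<in>space (M n). C0 * n \<le> (\<Sum>i=1..n. Y i \<omega>)}"
    let ?B = "{\<omega>\<in>space (M n). (\<Sum>i=1..n. Y i \<omega>) \<le> C0 * n \<and> (\<forall>i\<in>{1..n}. Y i \<omega> \<in> {l n..u n})}"
    have B: "?B \<in> events"
    proof -
      have "Measurable.pred (\<Pi>\<^sub>M i\<in>{1..n}. borel) (\<lambda>x. (\<Sum>i=1..n. x i) \<le> C0 * n)" by measurable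
      from Y_event_box[OF this, of "l n" "u n"] show ?thesis by simp
    qed
    have "prob {\<omega>\<in>space (M n). \<forall>i\<in>{1..n}. Y i \<omega> \<in> {l n..u n}} \<le> prob ?A + prob ?B"
      by (rule prob_subset_Un[OF sum_event B]) auto
    also have "prob ?A \<le> exp (- (real n)\<^sup>2)" by (rule sum_tail[OF reg(2) C0])
    also have "prob ?B \<le> exp (- ((real n)\<^sup>2 * s\<^sup>2 / (16 * C2 * L\<^sup>2)))"
      by (rule bulk_bound[OF d z W L_def side reg(2-5) less_imp_le[OF C0_pos] C1_def C2_def less_imp_le[OF elim(1)] s2])
    finally show ?case unfolding y_eq[OF elim(3)] real_norm_def abs_of_nonneg[OF measure_nonneg] by simp
  qed
  moreover have "?bound \<longlonglongrightarrow> 0"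
  proof -
    define A where "A = s\<^sup>2 / (16 * C2 * L\<^sup>2)"
    have "0 < A" using s_pos C2_pos L_pos by (simp add: A_def)
    then have "(\<lambda>n::nat. exp (- ((real n)\<^sup>2 * A))) \<longlonglongrightarrow> 0" by real_asymp
    moreover have "(\<lambda>n::nat. exp (- (real n)\<^sup>2)) \<longlonglongrightarrow> 0" by real_asymp
    ultimately have "(\<lambda>n::nat. exp (- (real n)\<^sup>2) + exp (- ((real n)\<^sup>2 * A))) \<longlonglongrightarrow> 0"
      by (intro tendsto_add_zero)
    then show ?thesis by (simp only: A_def times_divide_eq_right)
  qed
  ultimately show ?thesis by (rule Lim_null_comparison)
qed

lemma near_edge:
  assumes \<epsilon>: "0 < \<epsilon>"
  shows "\<forall>\<^sub>F n in sequentially. upper_edge \<alpha> \<kappa> - \<epsilon> < upper_edge \<alpha> (b n / n) \<and> lower_edge \<alpha> (b n / n) < lower_edge \<alpha> \<kappa> + \<epsilon>"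
  by (rule eventually_conj[OF order_tendstoD(1)[OF edge_lim(1)] order_tendstoD(2)[OF edge_lim(2)]])
    (use \<epsilon> in simp_all)

lemma upper_edge_reached:
  assumes \<epsilon>: "0 < \<epsilon>" "\<epsilon> \<le> 1" "\<epsilon> \<le> \<alpha>"
  shows "(\<lambda>n. measure (M n) {\<omega>\<in>space (M n). \<forall>i\<in>{1..n}. y n i \<omega> \<in> {0..upper_edge \<alpha> \<kappa> - \<epsilon>}}) \<longlonglongrightarrow> 0"
proof -
  define z where "z = upper_edge \<alpha> \<kappa> - \<epsilon> / 2"
  note ord = edges_order[OF \<alpha>_pos \<kappa>_nonneg]
  have z: "0 < z" using ord \<epsilon> by (simp add: z_def)
  have d: "0 < \<epsilon> / 2" "\<epsilon> / 2 \<le> 1" using \<epsilon> by simp_all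
  have side: "(\<forall>x\<in>{0..upper_edge \<alpha> \<kappa> - \<epsilon>}. x \<le> z - \<epsilon> / 2) \<or> (\<forall>x\<in>{0..upper_edge \<alpha> \<kappa> - \<epsilon>}. z + \<epsilon> / 2 \<le> x)"
    by (rule disjI1) (simp add: z_def)
  have \<rho>: "0 < \<epsilon> / 4 * (3 * \<alpha>)" using \<epsilon> \<alpha>_pos by simp
  have "0 < \<epsilon> / 4" using \<epsilon> by simp
  from near_edge[OF this]
  have inside: "\<forall>\<^sub>F n in sequentially. \<epsilon> / 4 * (3 * \<alpha>) \<le> (upper_edge \<alpha> (b n / n) - z) * (z - lower_edge \<alpha> (b n / n))"
  proof eventually_elim
    case (elim n)
    show ?case unfolding z_def by (rule mult_mono) (use elim ord \<epsilon> in linarith)+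
  qed
  show ?thesis
    by (rule bulk_not_empty[where l = "\<lambda>_. 0" and u = "\<lambda>_. upper_edge \<alpha> \<kappa> - \<epsilon>", OF d z side \<rho> inside])
qed

lemma lower_edge_reached:
  assumes \<epsilon>: "0 < \<epsilon>" "\<epsilon> \<le> 1" "\<epsilon> \<le> \<alpha>"
  shows "(\<lambda>n. measure (M n) {\<omega>\<in>space (M n). \<forall>i\<in>{1..n}. y n i \<omega> \<in> {lower_edge \<alpha> \<kappa> + \<epsilon>..1 / (n / c n)}}) \<longlonglongrightarrow> 0"
proof -
  define z where "z = lower_edge \<alpha> \<kappa> + \<epsilon> / 2"
  note ord = edges_order[OF \<alpha>_pos \<kappa>_nonneg]
  have z: "0 < z" using ord \<epsilon> by (simp add: z_def)
  have d: "0 < \<epsilon> / 2" "\<epsilon> / 2 \<le> 1" using \<epsilon> by simp_all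
  have side: "(\<forall>x\<in>{lower_edge \<alpha> \<kappa> + \<epsilon>..1 / (n / c n)}. x \<le> z - \<epsilon> / 2)
      \<or> (\<forall>x\<in>{lower_edge \<alpha> \<kappa> + \<epsilon>..1 / (n / c n)}. z + \<epsilon> / 2 \<le> x)" for n :: nat
    by (rule disjI2) (simp add: z_def)
  have \<rho>: "0 < 3 * \<alpha> * (\<epsilon> / 4)" using \<epsilon> \<alpha>_pos by simp
  have "0 < \<epsilon> / 4" using \<epsilon> by simp
  from near_edge[OF this]
  have inside: "\<forall>\<^sub>F n in sequentially. 3 * \<alpha> * (\<epsilon> / 4) \<le> (upper_edge \<alpha> (b n / n) - z) * (z - lower_edge \<alpha> (b n / n))"
  proof eventually_elim
    case (elim n)
    show ?case unfolding z_def by (rule mult_mono) (use elim ord \<epsilon> in linarith)+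
  qed
  show ?thesis
    by (rule bulk_not_empty[where l = "\<lambda>_. lower_edge \<alpha> \<kappa> + \<epsilon>" and u = "\<lambda>n. 1 / (n / c n)", OF d z side \<rho> inside])
qed

lemma X_borel: "regular n \<Longrightarrow> i \<in> {1..n} \<Longrightarrow> X n i \<in> borel_measurable (M n)"
proof -
  assume reg: "regular n" and i: "i \<in> {1..n}"
  interpret jacobi_particles "M n" "X n" n \<alpha> "b n" "c n" using reg by (simp add: regular_def)
  have "X n i = (\<lambda>\<omega>. r * Y i \<omega>)" using r_pos by (simp add: Y_def fun_eq_iff)
  then show ?thesis using Y_borel[OF i] by simp
qed

text \<open>
  The statement to be proved scales the particles by \<open>a2/n\<close> instead of \<open>c/n\<close>; the quotient of the two tends to one.
\<close>

lemma tendsto_in_prob_rescaled: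
  assumes meas: "\<forall>\<^sub>F n in sequentially. Z n \<in> borel_measurable (M n)" and T: "0 \<le> T" and \<eta>0: "0 < \<eta>0"
    and close: "\<And>\<eta>. 0 < \<eta> \<Longrightarrow> \<eta> \<le> \<eta>0 \<Longrightarrow>
      (\<lambda>n. measure (M n) {\<omega>\<in>space (M n). \<eta> \<le> \<bar>Z n \<omega> / (n / c n) - T\<bar>}) \<longlonglongrightarrow> 0"
    and ratio: "(\<lambda>n. a n / c n) \<longlonglongrightarrow> 1"
  shows "tendsto_in_prob M (\<lambda>n \<omega>. a n / n * Z n \<omega>) T"
  unfolding tendsto_in_prob_def
proof (intro conjI allI impI)
  show "\<forall>\<^sub>F n in sequentially. prob_space (M n) \<and> (\<lambda>\<omega>. a n / n * Z n \<omega>) \<in> borel_measurable (M n)"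
    using meas eventually_regular
  proof eventually_elim
    case (elim n)
    interpret jacobi_particles "M n" "X n" n \<alpha> "b n" "c n" using elim by (simp add: regular_def)
    show ?case using elim(1) prob_space_axioms by simp
  qed
  fix \<epsilon> :: real assume \<epsilon>: "0 < \<epsilon>"
  define \<eta> where "\<eta> = min (\<epsilon> / 2) (min 1 \<eta>0)"
  have \<eta>: "0 < \<eta>" "\<eta> \<le> \<epsilon> / 2" "\<eta> \<le> 1" "\<eta> \<le> \<eta>0" using \<epsilon> \<eta>0 by (auto simp: \<eta>_def)
  have "(\<lambda>n. \<bar>a n / c n - 1\<bar> * (T + 1)) \<longlonglongrightarrow> \<bar>1 - 1\<bar> * (T + 1)"
    by (intro tendsto_intros ratio)
  then have "\<forall>\<^sub>F n in sequentially. \<bar>a n / c n - 1\<bar> * (T + 1) < \<epsilon> / 2"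
    by (rule order_tendstoD) (use \<epsilon> in simp)
  then have "\<forall>\<^sub>F n in sequentially. norm (measure (M n) {\<omega>\<in>space (M n). \<epsilon> < \<bar>a n / n * Z n \<omega> - T\<bar>})
      \<le> measure (M n) {\<omega>\<in>space (M n). \<eta> \<le> \<bar>Z n \<omega> / (n / c n) - T\<bar>}"
    using meas eventually_regular
  proof eventually_elim
    case (elim n)
    interpret jacobi_particles "M n" "X n" n \<alpha> "b n" "c n" using elim by (simp add: regular_def)
    note [measurable] = elim(2)
    have "prob {\<omega>\<in>space (M n). \<epsilon> < \<bar>a n / n * Z n \<omega> - T\<bar>} \<le> prob {\<omega>\<in>space (M n). \<eta> \<le> \<bar>Z n \<omega> / (n / c n) - T\<bar>}"
    proof (rule finite_measure_mono)
      show "{\<omega>\<in>space (M n). \<eta> \<le> \<bar>Z n \<omega> / (n / c n) - T\<bar>} \<in> events" by measurable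
      show "{\<omega>\<in>space (M n). \<epsilon> < \<bar>a n / n * Z n \<omega> - T\<bar>} \<subseteq> {\<omega>\<in>space (M n). \<eta> \<le> \<bar>Z n \<omega> / (n / c n) - T\<bar>}"
      proof (safe, rule ccontr)
        fix \<omega> assume far: "\<epsilon> < \<bar>a n / n * Z n \<omega> - T\<bar>" and "\<not> \<eta> \<le> \<bar>Z n \<omega> / (n / c n) - T\<bar>"
        define v where "v = Z n \<omega> / (n / c n)"
        have v: "\<bar>v - T\<bar> < \<eta>" using \<open>\<not> \<eta> \<le> _\<close> by (simp add: v_def)
        have "a n / n * Z n \<omega> = a n / c n * v" using n_pos c_pos by (simp add: v_def)
        then have "a n / n * Z n \<omega> - T = (a n / c n - 1) * v + (v - T)" by (simp add: algebra_simps)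
        then have "\<bar>a n / n * Z n \<omega> - T\<bar> \<le> \<bar>a n / c n - 1\<bar> * \<bar>v\<bar> + \<bar>v - T\<bar>"
          using abs_triangle_ineq[of "(a n / c n - 1) * v" "v - T"] by (simp only: abs_mult)
        also have "\<bar>a n / c n - 1\<bar> * \<bar>v\<bar> \<le> \<bar>a n / c n - 1\<bar> * (T + 1)"
          using v \<eta>(3) T by (intro mult_left_mono) auto
        finally show False using far v \<eta>(2) elim(1) by linarith
      qed
    qed
    then show ?case by simp
  qed
  then show "(\<lambda>n. measure (M n) {\<omega>\<in>space (M n). \<epsilon> < \<bar>a n / n * Z n \<omega> - T\<bar>}) \<longlonglongrightarrow> 0"
    by (rule Lim_null_comparison) (rule close[OF \<eta>(1,4)])
qed

lemma prob_le_of_two_events: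
  assumes reg: "regular n"
    and A: "Measurable.pred (M n) A" and B: "Measurable.pred (M n) B"
    and imp: "\<And>\<omega>. (\<And>i. i \<in> {1..n} \<Longrightarrow> 0 < y n i \<omega> \<and> y n i \<omega> \<le> 1 / (n / c n)) \<Longrightarrow> C \<omega> \<Longrightarrow> A \<omega> \<or> B \<omega>"
  shows "measure (M n) {\<omega>\<in>space (M n). C \<omega>} \<le> measure (M n) {\<omega>\<in>space (M n). A \<omega>} + measure (M n) {\<omega>\<in>space (M n). B \<omega>}"
proof -
  interpret jacobi_particles "M n" "X n" n \<alpha> "b n" "c n" using reg by (simp add: regular_def)
  have AB: "{\<omega>\<in>space (M n). A \<omega>} \<in> events" "{\<omega>\<in>space (M n). B \<omega>} \<in> events"
    using predE[OF A] predE[OF B] by auto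
  have "prob {\<omega>\<in>space (M n). C \<omega>} \<le> prob ({\<omega>\<in>space (M n). A \<omega>} \<union> {\<omega>\<in>space (M n). B \<omega>})"
  proof (rule finite_measure_mono_AE)
    show "AE \<omega> in M n. \<omega> \<in> {\<omega>\<in>space (M n). C \<omega>} \<longrightarrow> \<omega> \<in> {\<omega>\<in>space (M n). A \<omega>} \<union> {\<omega>\<in>space (M n). B \<omega>}"
      using Y_bounds
    proof eventually_elim
      case (elim \<omega>)
      have "0 < y n i \<omega> \<and> y n i \<omega> \<le> 1 / (n / c n)" if i: "i \<in> {1..n}" for i
      proof -
        have 1: "0 < Y i \<omega>" "r * Y i \<omega> < 1" using bspec[OF elim i] by auto
        have "Y i \<omega> \<le> 1 / r" using 1 r_pos by (simp add: le_divide_eq mult.commute less_imp_le)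
        then show ?thesis using 1 unfolding y_eq[OF reg] r_def by simp
      qed
      then show ?case using imp[of \<omega>] by blast
    qed
    show "{\<omega>\<in>space (M n). A \<omega>} \<union> {\<omega>\<in>space (M n). B \<omega>} \<in> events" using AB by auto
  qed
  also have "\<dots> \<le> prob {\<omega>\<in>space (M n). A \<omega>} + prob {\<omega>\<in>space (M n). B \<omega>}"
    using AB by (rule measure_Un_le)
  finally show ?thesis .
qed

lemma y_borel: "regular n \<Longrightarrow> i \<in> {1..n} \<Longrightarrow> (\<lambda>\<omega>. y n i \<omega>) \<in> borel_measurable (M n)"
  unfolding y_def using X_borel by simp

lemma y_preds:
  assumes "regular n"
  shows "Measurable.pred (M n) (\<lambda>\<omega>. \<exists>i\<in>{1..n}. k \<le> y n i \<omega>)" "Measurable.pred (M n) (\<lambda>\<omega>. \<exists>i\<in>{1..n}. y n i \<omega> \<le> k)"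
    "Measurable.pred (M n) (\<lambda>\<omega>. \<forall>i\<in>{1..n}. y n i \<omega> \<in> {l..u})"
proof -
  have [measurable]: "Measurable.pred (M n) (\<lambda>\<omega>. k \<le> y n i \<omega>)" "Measurable.pred (M n) (\<lambda>\<omega>. y n i \<omega> \<le> k)"
    "Measurable.pred (M n) (\<lambda>\<omega>. y n i \<omega> \<in> {l..u})" if "i \<in> {1..n}" for i
    using y_borel[OF assms that] by simp_all
  show "Measurable.pred (M n) (\<lambda>\<omega>. \<exists>i\<in>{1..n}. k \<le> y n i \<omega>)" "Measurable.pred (M n) (\<lambda>\<omega>. \<exists>i\<in>{1..n}. y n i \<omega> \<le> k)"
    "Measurable.pred (M n) (\<lambda>\<omega>. \<forall>i\<in>{1..n}. y n i \<omega> \<in> {l..u})"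
    by (rule pred_intros_finite, simp, measurable)+
qed

theorem max_tendsto_upper_edge:
  assumes ratio: "(\<lambda>n. a n / c n) \<longlonglongrightarrow> 1"
  shows "tendsto_in_prob M (\<lambda>n \<omega>. a n / n * Max ((\<lambda>i. X n i \<omega>) ` {1..n})) (upper_edge \<alpha> \<kappa>)"
proof (rule tendsto_in_prob_rescaled[OF _ _ _ _ ratio])
  show "\<forall>\<^sub>F n in sequentially. (\<lambda>\<omega>. Max ((\<lambda>i. X n i \<omega>) ` {1..n})) \<in> borel_measurable (M n)"
    using eventually_regular by eventually_elim (intro borel_measurable_Max X_borel, auto)
  show "0 \<le> upper_edge \<alpha> \<kappa>" by (simp add: upper_edge_def)
  show "0 < min 1 \<alpha>" using \<alpha>_pos by simp
  fix \<eta> :: real assume \<eta>: "0 < \<eta>" "\<eta> \<le> min 1 \<alpha>"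
  define E where "E = upper_edge \<alpha> \<kappa>"
  have "\<forall>\<^sub>F n in sequentially. norm (measure (M n) {\<omega>\<in>space (M n). \<eta> \<le> \<bar>Max ((\<lambda>i. X n i \<omega>) ` {1..n}) / (n / c n) - E\<bar>})
      \<le> measure (M n) {\<omega>\<in>space (M n). \<exists>i\<in>{1..n}. E + \<eta> \<le> y n i \<omega>}
        + measure (M n) {\<omega>\<in>space (M n). \<forall>i\<in>{1..n}. y n i \<omega> \<in> {0..E - \<eta>}}"
    using eventually_regular
  proof eventually_elim
    case (elim n)
    interpret jacobi_particles "M n" "X n" n \<alpha> "b n" "c n" using elim by (simp add: regular_def)
    have rc: "0 < n / c n" using n_pos c_pos by simp
    show ?case unfolding real_norm_def abs_of_nonneg[OF measure_nonneg]
    proof (rule prob_le_of_two_events[OF elim y_preds(1)[OF elim] y_preds(3)[OF elim]])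
      fix \<omega> assume pos: "\<And>i. i \<in> {1..n} \<Longrightarrow> 0 < y n i \<omega> \<and> y n i \<omega> \<le> 1 / (n / c n)"
        and far: "\<eta> \<le> \<bar>Max ((\<lambda>i. X n i \<omega>) ` {1..n}) / (n / c n) - E\<bar>"
      have "Max ((\<lambda>i. X n i \<omega>) ` {1..n}) \<in> (\<lambda>i. X n i \<omega>) ` {1..n}" using n_pos by (intro Max_in) auto
      then obtain j where j: "j \<in> {1..n}" "Max ((\<lambda>i. X n i \<omega>) ` {1..n}) = X n j \<omega>" by auto
      have le: "y n i \<omega> \<le> y n j \<omega>" if "i \<in> {1..n}" for i
        unfolding y_def j(2)[symmetric] using that rc by (intro divide_right_mono Max_ge) auto
      have "\<eta> \<le> \<bar>y n j \<omega> - E\<bar>" using far unfolding j(2) y_def .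
      then consider "E + \<eta> \<le> y n j \<omega>" | "y n j \<omega> \<le> E - \<eta>" by linarith
      then show "(\<exists>i\<in>{1..n}. E + \<eta> \<le> y n i \<omega>) \<or> (\<forall>i\<in>{1..n}. y n i \<omega> \<in> {0..E - \<eta>})"
      proof cases
        case 1
        then show ?thesis using j(1) by blast
      next
        case 2
        have "y n i \<omega> \<in> {0..E - \<eta>}" if "i \<in> {1..n}" for i using le[OF that] pos[OF that] 2 by simp
        then show ?thesis by blast
      qed
    qed
  qed
  moreover have "(\<lambda>n. measure (M n) {\<omega>\<in>space (M n). \<exists>i\<in>{1..n}. E + \<eta> \<le> y n i \<omega>}
        + measure (M n) {\<omega>\<in>space (M n). \<forall>i\<in>{1..n}. y n i \<omega> \<in> {0..E - \<eta>}}) \<longlonglongrightarrow> 0"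
    unfolding E_def using \<eta> by (intro tendsto_add_zero no_upper_outlier upper_edge_reached) auto
  ultimately show "(\<lambda>n. measure (M n) {\<omega>\<in>space (M n). \<eta> \<le> \<bar>Max ((\<lambda>i. X n i \<omega>) ` {1..n}) / (n / c n) - upper_edge \<alpha> \<kappa>\<bar>}) \<longlonglongrightarrow> 0"
    unfolding E_def by (rule Lim_null_comparison)
qed

theorem min_tendsto_lower_edge:
  assumes ratio: "(\<lambda>n. a n / c n) \<longlonglongrightarrow> 1"
  shows "tendsto_in_prob M (\<lambda>n \<omega>. a n / n * Min ((\<lambda>i. X n i \<omega>) ` {1..n})) (lower_edge \<alpha> \<kappa>)"
proof (rule tendsto_in_prob_rescaled[OF _ _ _ _ ratio])
  show "\<forall>\<^sub>F n in sequentially. (\<lambda>\<omega>. Min ((\<lambda>i. X n i \<omega>) ` {1..n})) \<in> borel_measurable (M n)"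
    using eventually_regular by eventually_elim (intro borel_measurable_Min X_borel, auto)
  show "0 \<le> lower_edge \<alpha> \<kappa>" by (simp add: lower_edge_def)
  show "0 < min 1 \<alpha>" using \<alpha>_pos by simp
  fix \<eta> :: real assume \<eta>: "0 < \<eta>" "\<eta> \<le> min 1 \<alpha>"
  define E where "E = lower_edge \<alpha> \<kappa>"
  have "\<forall>\<^sub>F n in sequentially. norm (measure (M n) {\<omega>\<in>space (M n). \<eta> \<le> \<bar>Min ((\<lambda>i. X n i \<omega>) ` {1..n}) / (n / c n) - E\<bar>})
      \<le> measure (M n) {\<omega>\<in>space (M n). \<exists>i\<in>{1..n}. y n i \<omega> \<le> E - \<eta>}
        + measure (M n) {\<omega>\<in>space (M n). \<forall>i\<in>{1..n}. y n i \<omega> \<in> {E + \<eta>..1 / (n / c n)}}"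
    using eventually_regular
  proof eventually_elim
    case (elim n)
    interpret jacobi_particles "M n" "X n" n \<alpha> "b n" "c n" using elim by (simp add: regular_def)
    have rc: "0 < n / c n" using n_pos c_pos by simp
    show ?case unfolding real_norm_def abs_of_nonneg[OF measure_nonneg]
    proof (rule prob_le_of_two_events[OF elim y_preds(2)[OF elim] y_preds(3)[OF elim]])
      fix \<omega> assume pos: "\<And>i. i \<in> {1..n} \<Longrightarrow> 0 < y n i \<omega> \<and> y n i \<omega> \<le> 1 / (n / c n)"
        and far: "\<eta> \<le> \<bar>Min ((\<lambda>i. X n i \<omega>) ` {1..n}) / (n / c n) - E\<bar>"
      have "Min ((\<lambda>i. X n i \<omega>) ` {1..n}) \<in> (\<lambda>i. X n i \<omega>) ` {1..n}" using n_pos by (intro Min_in) auto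
      then obtain j where j: "j \<in> {1..n}" "Min ((\<lambda>i. X n i \<omega>) ` {1..n}) = X n j \<omega>" by auto
      have le: "y n j \<omega> \<le> y n i \<omega>" if "i \<in> {1..n}" for i
        unfolding y_def j(2)[symmetric] using that rc by (intro divide_right_mono Min_le) auto
      have "\<eta> \<le> \<bar>y n j \<omega> - E\<bar>" using far unfolding j(2) y_def .
      then consider "E + \<eta> \<le> y n j \<omega>" | "y n j \<omega> \<le> E - \<eta>" by linarith
      then show "(\<exists>i\<in>{1..n}. y n i \<omega> \<le> E - \<eta>) \<or> (\<forall>i\<in>{1..n}. y n i \<omega> \<in> {E + \<eta>..1 / (n / c n)})"
      proof cases
        case 1
        have "y n i \<omega> \<in> {E + \<eta>..1 / (n / c n)}" if "i \<in> {1..n}" for i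
          unfolding atLeastAtMost_iff using le[OF that] pos[OF that] 1 by linarith
        then show ?thesis by blast
      next
        case 2
        then show ?thesis using j(1) by blast
      qed
    qed
  qed
  moreover have "(\<lambda>n. measure (M n) {\<omega>\<in>space (M n). \<exists>i\<in>{1..n}. y n i \<omega> \<le> E - \<eta>}
        + measure (M n) {\<omega>\<in>space (M n). \<forall>i\<in>{1..n}. y n i \<omega> \<in> {E + \<eta>..1 / (n / c n)}}) \<longlonglongrightarrow> 0"
    unfolding E_def using \<eta> by (intro tendsto_add_zero no_lower_outlier lower_edge_reached) auto
  ultimately show "(\<lambda>n. measure (M n) {\<omega>\<in>space (M n). \<eta> \<le> \<bar>Min ((\<lambda>i. X n i \<omega>) ` {1..n}) / (n / c n) - lower_edge \<alpha> \<kappa>\<bar>}) \<longlonglongrightarrow> 0"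
    unfolding E_def by (rule Lim_null_comparison)
qed

end

theorem theorem2:
  fixes \<beta> \<gamma> :: real
    and a1 a2 :: "nat \<Rightarrow> real"
    and M :: "nat \<Rightarrow> 'a measure"
    and X :: "nat \<Rightarrow> nat \<Rightarrow> 'a \<Rightarrow> real"
  assumes "\<beta> > 0"
    and "0 < \<gamma>" and "\<gamma> \<le> 1"
    and "\<And>n. n \<ge> 2 \<Longrightarrow> a1 n > \<beta>/2 * (real n - 1)"
    and "\<And>n. n \<ge> 2 \<Longrightarrow> a2 n > \<beta>/2 * (real n - 1)"
    and "\<And>n. n \<ge> 2 \<Longrightarrow> jacobi_ensemble n \<beta> (a1 n) (a2 n) (M n) (X n)"
    and "filterlim a1 at_top sequentially"
    and "filterlim a2 at_top sequentially"
    and "a1 \<in> o[sequentially](\<lambda>n. sqrt (a2 n))"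
    and "(\<lambda>n. real n) \<in> o[sequentially](\<lambda>n. sqrt (a2 n))"
    and "(\<lambda>n. real n * \<beta> / (2 * a1 n)) \<longlonglongrightarrow> \<gamma>"
  shows "tendsto_in_prob M
           (\<lambda>n \<omega>. a2 n / real n * Max ((\<lambda>i. X n i \<omega>) ` {1..n}))
           (\<beta> * ((1 + sqrt \<gamma>)^2 / (2 * \<gamma>))) \<and>
         tendsto_in_prob M
           (\<lambda>n \<omega>. a2 n / real n * Min ((\<lambda>i. X n i \<omega>) ` {1..n}))
           (\<beta> * ((1 - sqrt \<gamma>)^2 / (2 * \<gamma>)))"
proof -
  define \<alpha> where "\<alpha> = \<beta> / 2"
  define \<kappa> where "\<kappa> = \<alpha> / \<gamma> - \<alpha>"
  define b where "b n = a1 n - \<alpha> * (real n - 1)" for n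
  define c where "c n = a2 n - 1 - \<alpha> * (real n - 1)" for n
  have \<alpha>: "0 < \<alpha>" "2 * \<alpha> = \<beta>" using assms(1) by (auto simp: \<alpha>_def)
  have \<kappa>: "0 \<le> \<kappa>" using \<alpha> assms(2,3) by (simp add: \<kappa>_def le_divide_eq)
  have a2_pos: "\<forall>\<^sub>F n in sequentially. 0 < a2 n"
    using assms(8) by (simp add: filterlim_at_top_dense)
  have inv_n: "(\<lambda>n. 1 / real n) \<longlonglongrightarrow> 0" by (rule lim_const_over_n)
  have inv_a2: "(\<lambda>n. 1 / a2 n) \<longlonglongrightarrow> 0"
    using tendsto_inverse_0_at_top[OF assms(8)] by (simp add: inverse_eq_divide)
  have n2_a2: "(\<lambda>n. real n ^ 2 / a2 n) \<longlonglongrightarrow> 0"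
  proof -
    have "(\<lambda>n. (real n / sqrt (a2 n))\<^sup>2) \<longlonglongrightarrow> 0\<^sup>2"
      by (intro tendsto_power smalloD_tendsto assms(10))
    moreover have "\<forall>\<^sub>F n in sequentially. (real n / sqrt (a2 n))\<^sup>2 = real n ^ 2 / a2 n"
      using a2_pos by eventually_elim (simp add: power_divide)
    ultimately show ?thesis by (simp add: filterlim_cong)
  qed
  have n_a2: "(\<lambda>n. real n / a2 n) \<longlonglongrightarrow> 0"
  proof -
    have "(\<lambda>n. real n ^ 2 / a2 n * (1 / real n)) \<longlonglongrightarrow> 0 * 0" by (intro tendsto_mult n2_a2 inv_n)
    moreover have "real n ^ 2 / a2 n * (1 / real n) = real n / a2 n" for n
      by (cases "n = 0") (simp_all add: power2_eq_square)
    ultimately show ?thesis by simp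
  qed
  have c_a2: "(\<lambda>n. c n / a2 n) \<longlonglongrightarrow> 1"
  proof -
    have "(\<lambda>n. 1 - 1 / a2 n - \<alpha> * (real n / a2 n - 1 / a2 n)) \<longlonglongrightarrow> 1 - 0 - \<alpha> * (0 - 0)"
      by (intro tendsto_intros inv_a2 n_a2)
    moreover have "\<forall>\<^sub>F n in sequentially. 1 - 1 / a2 n - \<alpha> * (real n / a2 n - 1 / a2 n) = c n / a2 n"
      using a2_pos by eventually_elim (simp add: c_def field_simps)
    ultimately show ?thesis by (simp add: filterlim_cong)
  qed
  have c_pos: "\<forall>\<^sub>F n in sequentially. 0 < c n"
  proof -
    have "\<forall>\<^sub>F n in sequentially. 0 < c n / a2 n" using c_a2 by (rule order_tendstoD) simp
    then show ?thesis using a2_pos by eventually_elim (simp add: zero_less_divide_iff)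
  qed
  have a2_c: "(\<lambda>n. a2 n / c n) \<longlonglongrightarrow> 1"
    using tendsto_inverse[OF c_a2] by simp
  have n2_c: "(\<lambda>n. real n ^ 2 / c n) \<longlonglongrightarrow> 0"
  proof -
    have "(\<lambda>n. real n ^ 2 / a2 n * (a2 n / c n)) \<longlonglongrightarrow> 0 * 1" by (intro tendsto_mult n2_a2 a2_c)
    moreover have "\<forall>\<^sub>F n in sequentially. real n ^ 2 / a2 n * (a2 n / c n) = real n ^ 2 / c n"
      using a2_pos by eventually_elim simp
    ultimately have "(\<lambda>n. real n ^ 2 / c n) \<longlonglongrightarrow> 0 * 1" by (rule Lim_transform_eventually)
    then show ?thesis by simp
  qed
  have b_lim: "(\<lambda>n. b n / n) \<longlonglongrightarrow> \<kappa>"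
  proof -
    have inv: "(\<lambda>n. inverse (real n * \<beta> / (2 * a1 n))) \<longlonglongrightarrow> inverse \<gamma>"
      by (rule tendsto_inverse[OF assms(11)]) (use assms(2) in simp)
    have "(\<lambda>n. \<alpha> * inverse (real n * \<beta> / (2 * a1 n)) - \<alpha> + \<alpha> * (1 / real n)) \<longlonglongrightarrow> \<alpha> * inverse \<gamma> - \<alpha> + \<alpha> * 0"
      by (rule tendsto_add[OF tendsto_diff[OF tendsto_mult_left[OF inv] tendsto_const] tendsto_mult_left[OF inv_n]])
    moreover have "\<forall>\<^sub>F n in sequentially. \<alpha> * inverse (real n * \<beta> / (2 * a1 n)) - \<alpha> + \<alpha> * (1 / real n) = b n / n"
      using eventually_gt_at_top[of 0]
    proof eventually_elim
      case (elim n)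
      have "\<alpha> * inverse (real n * \<beta> / (2 * a1 n)) = a1 n / n" using assms(1) by (simp add: \<alpha>_def)
      moreover have "b n / n = a1 n / n - \<alpha> + \<alpha> * (1 / real n)" using elim by (simp add: b_def field_simps)
      ultimately show ?case by linarith
    qed
    ultimately have "(\<lambda>n. b n / n) \<longlonglongrightarrow> \<alpha> * inverse \<gamma> - \<alpha> + \<alpha> * 0" by (rule Lim_transform_eventually)
    then show ?thesis by (simp add: \<kappa>_def divide_inverse)
  qed
  have particles: "\<forall>\<^sub>F n in sequentially. jacobi_particles (M n) (X n) n \<alpha> (b n) (c n)"
    using eventually_ge_at_top[of 2] c_pos
  proof eventually_elim
    case (elim n)
    have ens: "jacobi_ensemble n \<beta> (a1 n) (a2 n) (M n) (X n)" by (rule assms(6)[OF elim(1)])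
    then interpret prob_space "M n" by (simp add: jacobi_ensemble_def)
    show ?case
    proof
      show "0 < n" "0 < \<alpha>" "0 < c n" using elim \<alpha> by auto
      show "jacobi_ensemble n (2 * \<alpha>) (b n + \<alpha> * (real n - 1)) (c n + 1 + \<alpha> * (real n - 1)) (M n) (X n)"
        using ens \<alpha>(2) by (simp add: b_def c_def)
    qed
  qed
  have b_nonneg: "\<forall>\<^sub>F n in sequentially. 0 \<le> b n"
    using eventually_ge_at_top[of 2]
  proof eventually_elim
    case (elim n)
    show ?case using assms(4)[OF elim] by (simp add: b_def \<alpha>_def)
  qed
  interpret jacobi_sequence M X \<alpha> \<kappa> b c
    by standard (fact \<alpha>(1) \<kappa> particles b_nonneg b_lim n2_c)+
  have sum: "\<kappa> + \<alpha> = \<alpha> / \<gamma>" by (simp add: \<kappa>_def)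
  have root: "sqrt (\<kappa> + \<alpha>) = sqrt \<alpha> / sqrt \<gamma>" unfolding sum by (rule real_sqrt_divide)
  have sq: "(sqrt \<alpha>)\<^sup>2 = \<alpha>" "(sqrt \<gamma>)\<^sup>2 = \<gamma>" "sqrt \<gamma> \<noteq> 0" using \<alpha> assms(2) by auto
  have upper: "upper_edge \<alpha> \<kappa> = \<beta> * ((1 + sqrt \<gamma>)^2 / (2 * \<gamma>))"
  proof -
    have "sqrt (\<kappa> + \<alpha>) + sqrt \<alpha> = sqrt \<alpha> * ((1 + sqrt \<gamma>) / sqrt \<gamma>)"
      unfolding root using sq(3) by (simp add: field_simps)
    then have "upper_edge \<alpha> \<kappa> = \<alpha> * ((1 + sqrt \<gamma>)\<^sup>2 / \<gamma>)"
      unfolding upper_edge_def by (simp only: power_mult_distrib power_divide sq)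
    then show ?thesis by (simp add: \<alpha>_def)
  qed
  have lower: "lower_edge \<alpha> \<kappa> = \<beta> * ((1 - sqrt \<gamma>)^2 / (2 * \<gamma>))"
  proof -
    have "sqrt (\<kappa> + \<alpha>) - sqrt \<alpha> = sqrt \<alpha> * ((1 - sqrt \<gamma>) / sqrt \<gamma>)"
      unfolding root using sq(3) by (simp add: field_simps)
    then have "lower_edge \<alpha> \<kappa> = \<alpha> * ((1 - sqrt \<gamma>)\<^sup>2 / \<gamma>)"
      unfolding lower_edge_def by (simp only: power_mult_distrib power_divide sq)
    then show ?thesis by (simp add: \<alpha>_def)
  qed
  show ?thesis
    using max_tendsto_upper_edge[OF a2_c] min_tendsto_lower_edge[OF a2_c] unfolding upper lower by blast
qed

end
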